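(* Let $A$ be a hereditary ring and $(\mathcal X,\mathcal Y)$ an Ext-orthogonal pair for the module category $\operatorname{Mod}A$. Then the following are equivalent. (1) The subcategory $\mathcal Y$ is closed under taking coproducts. (2) Every module in $\mathcal X$ is a filtered colimit of finitely presented modules from $\mathcal X$. (3) There exists a category $\mathcal C$ of finitely presented $A$-modules such that $\mathcal C^\perp=\mathcal Y$.
   Context: $\operatorname{Mod}A$ is the category of right $A$-modules. The ring $A$ is hereditary if it is right hereditary, i.e. $\operatorname{Ext}^n_A(-,-)$ vanishes on $\operatorname{Mod}A$ for all $n>1$. For $A$-modules $X,Y$ set $\operatorname{Ext}^*_A(X,Y)=\coprod_{n\in\mathbb Z}\operatorname{Ext}^n_A(X,Y)$ (including $n=0$, i.e. $\operatorname{Hom}$). For a subcategory $\mathcal C$ of $\operatorname{Mod}A$ let ${}^\perp\mathcal C=\{X\in\operatorname{Mod}A\mid\operatorname{Ext}^*_A(X,C)=0\ \forall C\in\mathcal C\}$ and $\mathcal C^\perp=\{Y\in\operatorname{Mod}A\mid\operatorname{Ext}^*_A(C,Y)=0\ \forall C\in\mathcal C\}$ (full subcategories). An Ext-orthogonal pair for $\operatorname{Mod}A$ is a pair $(\mathcal X,\mathcal Y)$ of full subcategories with $\mathcal X^\perp=\mathcal Y$ and $\mathcal X={}^\perp\mathcal Y$. *)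

theory Defs
  imports "HOL-Library.Equipollence" "HOL-Algebra.Module" "HOL-Algebra.Product_Groups"
begin

section \<open>The universe\<close>

text \<open>
  Mod A has a proper class of objects, so "all modules" and "all set-indexed coproducts" are
  understood relative to a Grothendieck universe.  The universe is represented by a type
  \<open>'m\<close>: a set is small if its cardinality is strictly below that of \<open>'m\<close>, and the
  cardinality of \<open>'m\<close> is required to be an uncountable strongly inaccessible cardinal
  (there is an infinite small set; small sets are closed under power sets and under small
  unions).  Every small set, of whatever type, then has a bijective copy inside \<open>'m\<close>, so
  that every small module is isomorphic to one with carrier a small subset of \<open>'m\<close>.
\<close>

definition small :: "'m itself \<Rightarrow> 'b set \<Rightarrow> bool" where
  "small U S \<longleftrightarrow> S \<prec> (UNIV :: 'm set)"

definition grothendieck_universe :: "'m itself \<Rightarrow> bool" where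
  "grothendieck_universe U \<longleftrightarrow>
     (\<exists>S :: 'm set. infinite S \<and> small U S) \<and>
     (\<forall>S :: 'm set. small U S \<longrightarrow> small U (Pow S)) \<and>
     (\<forall>(I :: 'm set) (F :: 'm \<Rightarrow> 'm set).
        small U I \<and> (\<forall>i\<in>I. small U (F i)) \<longrightarrow> small U (\<Union>i\<in>I. F i))"


section \<open>Right modules\<close>

text \<open>As in \<^theory>\<open>HOL-Algebra.Module\<close>, the record extends that of rings only in order to
  reuse \<^locale>\<open>abelian_group\<close>; the fields \<open>mult\<close> and \<open>one\<close> play no role.\<close>

record ('a, 'm) rmodule = "'m ring" +
  ract :: "['m, 'a] \<Rightarrow> 'm" (infixl \<open>\<triangleleft>\<index>\<close> 70)

locale right_module = A?: ring A + M?: abelian_group M for A (structure) and M (structure) +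
  assumes ract_closed:
      "\<lbrakk>x \<in> carrier M; a \<in> carrier A\<rbrakk> \<Longrightarrow> x \<triangleleft>\<^bsub>M\<^esub> a \<in> carrier M"
    and ract_add_left:
      "\<lbrakk>x \<in> carrier M; y \<in> carrier M; a \<in> carrier A\<rbrakk> \<Longrightarrow>
       (x \<oplus>\<^bsub>M\<^esub> y) \<triangleleft>\<^bsub>M\<^esub> a = x \<triangleleft>\<^bsub>M\<^esub> a \<oplus>\<^bsub>M\<^esub> y \<triangleleft>\<^bsub>M\<^esub> a"
    and ract_add_right:
      "\<lbrakk>x \<in> carrier M; a \<in> carrier A; b \<in> carrier A\<rbrakk> \<Longrightarrow>
       x \<triangleleft>\<^bsub>M\<^esub> (a \<oplus>\<^bsub>A\<^esub> b) = x \<triangleleft>\<^bsub>M\<^esub> a \<oplus>\<^bsub>M\<^esub> x \<triangleleft>\<^bsub>M\<^esub> b"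
    and ract_mult:
      "\<lbrakk>x \<in> carrier M; a \<in> carrier A; b \<in> carrier A\<rbrakk> \<Longrightarrow>
       x \<triangleleft>\<^bsub>M\<^esub> (a \<otimes>\<^bsub>A\<^esub> b) = (x \<triangleleft>\<^bsub>M\<^esub> a) \<triangleleft>\<^bsub>M\<^esub> b"
    and ract_one:
      "x \<in> carrier M \<Longrightarrow> x \<triangleleft>\<^bsub>M\<^esub> \<one>\<^bsub>A\<^esub> = x"

text \<open>Homomorphisms are extensional functions, so that equality of homomorphisms is
  equality in HOL.\<close>

definition mod_hom ::
  "('a, 'r) ring_scheme \<Rightarrow> ('a, 'm) rmodule \<Rightarrow> ('a, 'n) rmodule \<Rightarrow> ('m \<Rightarrow> 'n) set" where
  "mod_hom A M N = {f \<in> carrier M \<rightarrow>\<^sub>E carrier N.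
     (\<forall>x\<in>carrier M. \<forall>y\<in>carrier M. f (x \<oplus>\<^bsub>M\<^esub> y) = f x \<oplus>\<^bsub>N\<^esub> f y) \<and>
     (\<forall>x\<in>carrier M. \<forall>a\<in>carrier A. f (x \<triangleleft>\<^bsub>M\<^esub> a) = f x \<triangleleft>\<^bsub>N\<^esub> a)}"

definition zero_hom :: "('a, 'm) rmodule \<Rightarrow> ('a, 'n) rmodule \<Rightarrow> 'm \<Rightarrow> 'n" where
  "zero_hom M N = (\<lambda>x\<in>carrier M. \<zero>\<^bsub>N\<^esub>)"

definition hom_group ::
  "('a, 'r) ring_scheme \<Rightarrow> ('a, 'm) rmodule \<Rightarrow> ('a, 'n) rmodule \<Rightarrow> ('m \<Rightarrow> 'n) monoid" where
  "hom_group A M N =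
     \<lparr>carrier = mod_hom A M N,
      mult = (\<lambda>f g. \<lambda>x\<in>carrier M. f x \<oplus>\<^bsub>N\<^esub> g x),
      one = zero_hom M N\<rparr>"

definition hom_kernel :: "('a, 'm) rmodule \<Rightarrow> ('a, 'n) rmodule \<Rightarrow> ('m \<Rightarrow> 'n) \<Rightarrow> 'm set" where
  "hom_kernel M N f = {x \<in> carrier M. f x = \<zero>\<^bsub>N\<^esub>}"

definition Mod_cat :: "('a, 'r) ring_scheme \<Rightarrow> ('a, 'm) rmodule set" where
  "Mod_cat A = {M. right_module A M \<and> small TYPE('m) (carrier M)}"

definition free_rmodule :: "('a, 'r) ring_scheme \<Rightarrow> nat \<Rightarrow> ('a, nat \<Rightarrow> 'a) rmodule" where
  "free_rmodule A n =
     \<lparr>carrier = {..<n} \<rightarrow>\<^sub>E carrier A,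
      mult = undefined, one = undefined,
      zero = (\<lambda>i\<in>{..<n}. \<zero>\<^bsub>A\<^esub>),
      add = (\<lambda>x y. \<lambda>i\<in>{..<n}. x i \<oplus>\<^bsub>A\<^esub> y i),
      ract = (\<lambda>x a. \<lambda>i\<in>{..<n}. x i \<otimes>\<^bsub>A\<^esub> a)\<rparr>"

text \<open>Existence of an exact sequence \<open>A^m \<rightarrow> A^n \<rightarrow> M \<rightarrow> 0\<close>.\<close>

definition finitely_presented :: "('a, 'r) ring_scheme \<Rightarrow> ('a, 'm) rmodule \<Rightarrow> bool" where
  "finitely_presented A M \<longleftrightarrow>
     (\<exists>m n. \<exists>g \<in> mod_hom A (free_rmodule A m) (free_rmodule A n).
        \<exists>f \<in> mod_hom A (free_rmodule A n) M.
          f ` carrier (free_rmodule A n) = carrier M \<and>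
          hom_kernel (free_rmodule A n) M f = g ` carrier (free_rmodule A m))"


section \<open>Ext\<close>

definition projective :: "('a, 'r) ring_scheme \<Rightarrow> ('a, 'm) rmodule \<Rightarrow> bool" where
  "projective A P \<longleftrightarrow>
     (\<forall>M \<in> Mod_cat A :: ('a, 'm) rmodule set. \<forall>N \<in> Mod_cat A :: ('a, 'm) rmodule set.
        \<forall>p \<in> mod_hom A M N. \<forall>f \<in> mod_hom A P N. p ` carrier M = carrier N \<longrightarrow>
          (\<exists>g \<in> mod_hom A P M. compose (carrier P) p g = f))"

text \<open>\<open>\<dots> \<rightarrow> P 2 \<rightarrow> P 1 \<rightarrow> P 0 \<rightarrow> X \<rightarrow> 0\<close> with differentials \<open>d n : P (n+1) \<rightarrow> P n\<close> and
  augmentation \<open>e : P 0 \<rightarrow> X\<close>.\<close>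

definition projective_resolution ::
  "('a, 'r) ring_scheme \<Rightarrow> ('a, 'm) rmodule \<Rightarrow>
   (nat \<Rightarrow> ('a, 'm) rmodule) \<Rightarrow> (nat \<Rightarrow> 'm \<Rightarrow> 'm) \<Rightarrow> ('m \<Rightarrow> 'm) \<Rightarrow> bool" where
  "projective_resolution A X P d e \<longleftrightarrow>
     (\<forall>n. P n \<in> Mod_cat A \<and> projective A (P n)) \<and>
     (\<forall>n. d n \<in> mod_hom A (P (Suc n)) (P n)) \<and>
     e \<in> mod_hom A (P 0) X \<and>
     e ` carrier (P 0) = carrier X \<and>
     hom_kernel (P 0) X e = d 0 ` carrier (P 1) \<and>
     (\<forall>n. hom_kernel (P (Suc n)) (P n) (d n) = d (Suc n) ` carrier (P (Suc (Suc n))))"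

definition cocycles ::
  "('a, 'r) ring_scheme \<Rightarrow> (nat \<Rightarrow> ('a, 'm) rmodule) \<Rightarrow> (nat \<Rightarrow> 'm \<Rightarrow> 'm) \<Rightarrow>
   ('a, 'm) rmodule \<Rightarrow> nat \<Rightarrow> ('m \<Rightarrow> 'm) set" where
  "cocycles A P d Y n =
     {f \<in> mod_hom A (P n) Y.
        compose (carrier (P (Suc n))) f (d n) = zero_hom (P (Suc n)) Y}"

fun coboundaries ::
  "('a, 'r) ring_scheme \<Rightarrow> (nat \<Rightarrow> ('a, 'm) rmodule) \<Rightarrow> (nat \<Rightarrow> 'm \<Rightarrow> 'm) \<Rightarrow>
   ('a, 'm) rmodule \<Rightarrow> nat \<Rightarrow> ('m \<Rightarrow> 'm) set" where
  "coboundaries A P d Y 0 = {zero_hom (P 0) Y}"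
| "coboundaries A P d Y (Suc n) =
     (\<lambda>f. compose (carrier (P (Suc n))) f (d n)) ` mod_hom A (P n) Y"

definition cohomology_group ::
  "('a, 'r) ring_scheme \<Rightarrow> (nat \<Rightarrow> ('a, 'm) rmodule) \<Rightarrow> (nat \<Rightarrow> 'm \<Rightarrow> 'm) \<Rightarrow>
   ('a, 'm) rmodule \<Rightarrow> nat \<Rightarrow> ('m \<Rightarrow> 'm) set monoid" where
  "cohomology_group A P d Y n =
     ((hom_group A (P n) Y)\<lparr>carrier := cocycles A P d Y n\<rparr>) Mod coboundaries A P d Y n"

text \<open>Up to isomorphism, \<open>Ext\<close> does not depend on the chosen projective resolution, and
  \<open>Ext\<close> in degree 0 is \<open>Hom\<close>.\<close>

definition Ext ::
  "('a, 'r) ring_scheme \<Rightarrow> int \<Rightarrow> ('a, 'm) rmodule \<Rightarrow> ('a, 'm) rmodule \<Rightarrow>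
   ('m \<Rightarrow> 'm) set monoid" where
  "Ext A n X Y =
     (if n < 0 then singleton_group {}
      else let (P, d, e) = (SOME (P, d, e). projective_resolution A X P d e)
           in cohomology_group A P d Y (nat n))"

definition Ext_total ::
  "('a, 'r) ring_scheme \<Rightarrow> ('a, 'm) rmodule \<Rightarrow> ('a, 'm) rmodule \<Rightarrow>
   (int \<Rightarrow> ('m \<Rightarrow> 'm) set) monoid" where
  "Ext_total A X Y = sum_group UNIV (\<lambda>n. Ext A n X Y)"

definition hereditary_ring :: "'m itself \<Rightarrow> ('a, 'r) ring_scheme \<Rightarrow> bool" where
  "hereditary_ring U A \<longleftrightarrow> ring A \<and>
     (\<forall>n > 1. \<forall>X \<in> Mod_cat A :: ('a, 'm) rmodule set. \<forall>Y \<in> Mod_cat A.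
        trivial_group (Ext A n X Y))"


section \<open>Ext-orthogonal pairs\<close>

text \<open>A full subcategory of Mod A is given by its set of objects.\<close>

definition left_perp ::
  "('a, 'r) ring_scheme \<Rightarrow> ('a, 'm) rmodule set \<Rightarrow> ('a, 'm) rmodule set" where
  "left_perp A \<C> = {X \<in> Mod_cat A. \<forall>C \<in> \<C>. trivial_group (Ext_total A X C)}"

definition right_perp ::
  "('a, 'r) ring_scheme \<Rightarrow> ('a, 'm) rmodule set \<Rightarrow> ('a, 'm) rmodule set" where
  "right_perp A \<C> = {Y \<in> Mod_cat A. \<forall>C \<in> \<C>. trivial_group (Ext_total A C Y)}"

definition ext_orthogonal_pair ::
  "('a, 'r) ring_scheme \<Rightarrow> ('a, 'm) rmodule set \<Rightarrow> ('a, 'm) rmodule set \<Rightarrow> bool" where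
  "ext_orthogonal_pair A \<X> \<Y> \<longleftrightarrow>
     \<X> \<subseteq> Mod_cat A \<and> \<Y> \<subseteq> Mod_cat A \<and>
     right_perp A \<X> = \<Y> \<and> \<X> = left_perp A \<Y>"


section \<open>Coproducts and filtered colimits in Mod A\<close>

definition is_coproduct ::
  "('a, 'r) ring_scheme \<Rightarrow> 'i set \<Rightarrow> ('i \<Rightarrow> ('a, 'm) rmodule) \<Rightarrow>
   ('a, 'm) rmodule \<Rightarrow> ('i \<Rightarrow> 'm \<Rightarrow> 'm) \<Rightarrow> bool" where
  "is_coproduct A I F C \<iota> \<longleftrightarrow>
     C \<in> Mod_cat A \<and> (\<forall>i\<in>I. \<iota> i \<in> mod_hom A (F i) C) \<and>
     (\<forall>N \<in> Mod_cat A :: ('a, 'm) rmodule set. \<forall>g. (\<forall>i\<in>I. g i \<in> mod_hom A (F i) N) \<longrightarrow>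
        (\<exists>!h. h \<in> mod_hom A C N \<and> (\<forall>i\<in>I. compose (carrier (F i)) h (\<iota> i) = g i)))"

definition closed_under_coproducts ::
  "('a, 'r) ring_scheme \<Rightarrow> ('a, 'm) rmodule set \<Rightarrow> bool" where
  "closed_under_coproducts A \<Y> \<longleftrightarrow>
     (\<forall>(I :: 'm set) F C \<iota>.
        small TYPE('m) I \<and> (\<forall>i\<in>I. F i \<in> \<Y>) \<and> is_coproduct A I F C \<iota> \<longrightarrow> C \<in> \<Y>)"

text \<open>\<open>cmp J v u\<close> is the composite of \<open>u\<close> followed by \<open>v\<close>.\<close>

record ('o, 'w) cat =
  obj :: "'o set"
  arr :: "'w set"
  src :: "'w \<Rightarrow> 'o"
  tgt :: "'w \<Rightarrow> 'o"
  idt :: "'o \<Rightarrow> 'w"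
  cmp :: "'w \<Rightarrow> 'w \<Rightarrow> 'w"

definition arrows :: "('o, 'w) cat \<Rightarrow> 'o \<Rightarrow> 'o \<Rightarrow> 'w set" where
  "arrows J i j = {u \<in> arr J. src J u = i \<and> tgt J u = j}"

locale category =
  fixes J :: "('o, 'w) cat"
  assumes src_obj: "u \<in> arr J \<Longrightarrow> src J u \<in> obj J"
    and tgt_obj: "u \<in> arr J \<Longrightarrow> tgt J u \<in> obj J"
    and idt_arrow: "i \<in> obj J \<Longrightarrow> idt J i \<in> arrows J i i"
    and cmp_arrow: "\<lbrakk>u \<in> arrows J i j; v \<in> arrows J j k\<rbrakk> \<Longrightarrow> cmp J v u \<in> arrows J i k"
    and cmp_idt_right: "u \<in> arrows J i j \<Longrightarrow> cmp J u (idt J i) = u"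
    and cmp_idt_left: "u \<in> arrows J i j \<Longrightarrow> cmp J (idt J j) u = u"
    and cmp_assoc: "\<lbrakk>u \<in> arrows J i j; v \<in> arrows J j k; w \<in> arrows J k l\<rbrakk> \<Longrightarrow>
      cmp J w (cmp J v u) = cmp J (cmp J w v) u"

definition filtered_category :: "('o, 'w) cat \<Rightarrow> bool" where
  "filtered_category J \<longleftrightarrow> category J \<and> obj J \<noteq> {} \<and>
     (\<forall>i \<in> obj J. \<forall>j \<in> obj J. \<exists>k \<in> obj J. arrows J i k \<noteq> {} \<and> arrows J j k \<noteq> {}) \<and>
     (\<forall>i \<in> obj J. \<forall>j \<in> obj J. \<forall>u \<in> arrows J i j. \<forall>v \<in> arrows J i j.
        \<exists>k \<in> obj J. \<exists>w \<in> arrows J j k. cmp J w u = cmp J w v)"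

text \<open>A functor from \<open>J\<close> to Mod A, given by \<open>D\<close> on objects and \<open>T\<close> on arrows.\<close>

definition mod_functor ::
  "('a, 'r) ring_scheme \<Rightarrow> ('o, 'w) cat \<Rightarrow> ('o \<Rightarrow> ('a, 'm) rmodule) \<Rightarrow>
   ('w \<Rightarrow> 'm \<Rightarrow> 'm) \<Rightarrow> bool" where
  "mod_functor A J D T \<longleftrightarrow>
     (\<forall>i \<in> obj J. D i \<in> Mod_cat A) \<and>
     (\<forall>u \<in> arr J. T u \<in> mod_hom A (D (src J u)) (D (tgt J u))) \<and>
     (\<forall>i \<in> obj J. T (idt J i) = (\<lambda>x\<in>carrier (D i). x)) \<and>
     (\<forall>u \<in> arr J. \<forall>v \<in> arr J. src J v = tgt J u \<longrightarrow>
        T (cmp J v u) = compose (carrier (D (src J u))) (T v) (T u))"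

definition is_cocone ::
  "('a, 'r) ring_scheme \<Rightarrow> ('o, 'w) cat \<Rightarrow> ('o \<Rightarrow> ('a, 'm) rmodule) \<Rightarrow>
   ('w \<Rightarrow> 'm \<Rightarrow> 'm) \<Rightarrow> ('a, 'm) rmodule \<Rightarrow> ('o \<Rightarrow> 'm \<Rightarrow> 'm) \<Rightarrow> bool" where
  "is_cocone A J D T N g \<longleftrightarrow>
     N \<in> Mod_cat A \<and> (\<forall>i \<in> obj J. g i \<in> mod_hom A (D i) N) \<and>
     (\<forall>u \<in> arr J. compose (carrier (D (src J u))) (g (tgt J u)) (T u) = g (src J u))"

definition is_colimit ::
  "('a, 'r) ring_scheme \<Rightarrow> ('o, 'w) cat \<Rightarrow> ('o \<Rightarrow> ('a, 'm) rmodule) \<Rightarrow>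
   ('w \<Rightarrow> 'm \<Rightarrow> 'm) \<Rightarrow> ('a, 'm) rmodule \<Rightarrow> ('o \<Rightarrow> 'm \<Rightarrow> 'm) \<Rightarrow> bool" where
  "is_colimit A J D T C \<iota> \<longleftrightarrow>
     is_cocone A J D T C \<iota> \<and>
     (\<forall>N g. is_cocone A J D T N g \<longrightarrow>
        (\<exists>!h. h \<in> mod_hom A C N \<and> (\<forall>i \<in> obj J. compose (carrier (D i)) h (\<iota> i) = g i)))"

definition filtered_colimit_of ::
  "('a, 'r) ring_scheme \<Rightarrow> ('a, 'm) rmodule set \<Rightarrow> ('a, 'm) rmodule \<Rightarrow> bool" where
  "filtered_colimit_of A \<S> M \<longleftrightarrow>
     (\<exists>(J :: ('m, 'm) cat) D T \<iota>.
        filtered_category J \<and> small TYPE('m) (obj J) \<and> small TYPE('m) (arr J) \<and>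
        mod_functor A J D T \<and> (\<forall>i \<in> obj J. D i \<in> \<S>) \<and> is_colimit A J D T M \<iota>)"

end

theory Submission
  imports Defs
begin

text \<open>
  Over a hereditary ring, \<open>X\<close> is Ext-orthogonal to \<open>Y\<close> if and only if, for a projective presentation
  \<open>0 \<rightarrow> Q \<rightarrow> P \<rightarrow> X \<rightarrow> 0\<close>, every homomorphism \<open>Q \<rightarrow> Y\<close> extends uniquely to \<open>P\<close>.  If \<open>X\<close> is finitely presented, then
  \<open>Q\<close> can be taken finitely generated and the condition passes to coproducts in \<open>Y\<close>, so (3) implies (1).
  If \<open>X\<close> is a filtered colimit of modules \<open>X\<^sub>i\<close> orthogonal to \<open>Y\<close>, then the lifts of the maps \<open>X\<^sub>i \<rightarrow> X\<close> along an
  extension of \<open>X\<close> by \<open>Y\<close> exist, are unique, and hence glue to a splitting, so (2) implies (3).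

  For (1) implies (2), let \<open>X = P / Q\<close> be in \<open>\<X>\<close>.  Closure of \<open>\<Y>\<close> under coproducts forces the inverse of the restriction
  \<open>Hom(P, -) \<rightarrow> Hom(Q, -)\<close> on \<open>\<Y>\<close> to have finite support: for \<open>c\<close> in \<open>P\<close> there is a finite subset of \<open>Q\<close> such that
  every \<open>P \<rightarrow> Y\<close> that kills this subset kills \<open>c\<close>.  Enclose it in a finitely generated direct summand \<open>L\<close> of \<open>Q\<close>, and let \<open>R / L\<close> be
  the intersection of the kernels of all homomorphisms from \<open>P / L\<close> to modules in \<open>\<Y>\<close>.  Then \<open>c\<close> lies in \<open>R\<close>, and
  \<open>R / L\<close> lies in \<open>\<X>\<close>.  A finitely generated direct summand \<open>N\<close> of the projective module \<open>R\<close>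
  that contains \<open>L\<close> and \<open>c\<close> gives a finitely presented direct summand \<open>N / L\<close> of \<open>R / L\<close>, and \<open>X\<close> is the directed
  union of these subquotients.
\<close>

section \<open>Smallness\<close>

text \<open>Unique extension along \<open>L \<subseteq> N\<close> has two halves, secured
  separately. Existence holds for every direct summand \<open>L\<close> of \<open>Q\<close>: extend
  a map on \<open>L\<close> through the projection to \<open>Q\<close>, then to \<open>P\<close>,
  and restrict. Uniqueness fails on \<open>P\<close>, since \<open>P / L\<close> may have nonzero
  maps into the class; the reject \<open>R\<close> is the part of \<open>P\<close> that those maps
  cannot see. The obstacle is that a homomorphism given on \<open>R\<close> only need not extend to
  \<open>P\<close>, so the definition of \<open>R\<close> does not yet say that \<open>R / L\<close>
  has no maps into the class. Heredity removes it: Ext in degree 1 turns monomorphisms in the first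
  argument into surjections, so the extension that obstructs the prolongation is induced from one
  over a module of the class. Heredity also makes submodules of projectives projective. This is what
  splits finitely generated summands off \<open>Q\<close> and \<open>R\<close>, and it reduces
  finite presentation of \<open>N / L\<close> to finite generation of \<open>L\<close> and
  \<open>N\<close>.\<close>

lemma small_lepoll: "small U S \<Longrightarrow> T \<lesssim> S \<Longrightarrow> small U T"
  by (auto simp: small_def intro: lesspoll_trans1)

lemma small_subset: "small U S \<Longrightarrow> T \<subseteq> S \<Longrightarrow> small U T"
  by (meson small_lepoll subset_imp_lepoll)

lemma small_image: "small U S \<Longrightarrow> small U (f ` S)"
  by (meson image_lepoll small_lepoll)

lemma small_inj:
  fixes U :: "'m itself"
  assumes "small U S"
  obtains b :: "'b \<Rightarrow> 'm" where "inj_on b S"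
  using assms by (auto simp: small_def lesspoll_def lepoll_def)

locale universe =
  fixes U :: "'m itself"
  assumes univ: "grothendieck_universe U"
begin

lemma infinite_UNIV: "infinite (UNIV :: 'm set)"
proof
  assume fin: "finite (UNIV :: 'm set)"
  obtain S :: "'m set" where "infinite S"
    using univ unfolding grothendieck_universe_def by blast
  with fin show False using finite_subset[of S UNIV] by simp
qed

lemma finite_small: "finite S \<Longrightarrow> small U S"
  using infinite_UNIV by (simp add: finite_lesspoll_infinite small_def)

text \<open>The universe axioms speak of subsets of \<open>'m\<close> only; a small set of another
  type is first copied into \<open>'m\<close> by an injection.\<close>

lemma Pow_small:
  fixes S :: "'b set"
  assumes "small U S" shows "small U (Pow S)"
proof -
  obtain b :: "'b \<Rightarrow> 'm" where b: "inj_on b S"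
    using assms small_inj by blast
  have "small U (Pow (b ` S))"
    using univ small_image[OF assms, of b] unfolding grothendieck_universe_def by blast
  moreover have "Pow S \<lesssim> Pow (b ` S)"
    using b by (auto simp: lepoll_def intro!: exI[of _ "image b"] inj_on_image_Pow)
  ultimately show ?thesis by (rule small_lepoll)
qed

text \<open>An infinite cardinal equals its square. The pairing bounds products here and later
  encodes the arrows of a preorder as elements of \<open>'m\<close>.\<close>

lemma pairing_exists: "\<exists>b :: 'm \<times> 'm \<Rightarrow> 'm. inj b"
proof -
  obtain b :: "'m \<times> 'm \<Rightarrow> 'm" where "bij_betw b (UNIV \<times> UNIV) UNIV"
    using card_of_Times_same_infinite[OF infinite_UNIV] card_of_ordIso by blast
  then show ?thesis by (auto simp: bij_betw_def)
qed

lemma Times_small: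
  fixes S :: "'b set" and T :: "'c set"
  assumes "small U S" "small U T" shows "small U (S \<times> T)"
proof -
  obtain b :: "'b \<Rightarrow> 'm" where b: "inj_on b S"
    using assms small_inj by blast
  obtain d :: "'c \<Rightarrow> 'm" where d: "inj_on d T"
    using assms small_inj by blast
  obtain p :: "'m \<times> 'm \<Rightarrow> 'm" where p: "inj p"
    using pairing_exists by blast
  have "small U (\<Union>i\<in>b ` S. (\<lambda>t. p (i, t)) ` d ` T)"
  proof -
    have "\<forall>i\<in>b ` S. small U ((\<lambda>t. p (i, t)) ` d ` T)"
      by (intro ballI small_image assms(2))
    then show ?thesis
      using univ small_image[OF assms(1), of b] unfolding grothendieck_universe_def by presburger
  qed
  moreover have "S \<times> T \<lesssim> (\<Union>i\<in>b ` S. (\<lambda>t. p (i, t)) ` d ` T)"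
  proof -
    have "inj_on (\<lambda>(s, t). p (b s, d t)) (S \<times> T)"
      by (rule inj_onI) (auto dest!: injD[OF p] dest: inj_onD[OF b] inj_onD[OF d])
    moreover have "(\<lambda>(s, t). p (b s, d t)) ` (S \<times> T) \<subseteq> (\<Union>i\<in>b ` S. (\<lambda>t. p (i, t)) ` d ` T)"
      by (rule image_subsetI) (simp split: prod.splits, blast)
    ultimately show ?thesis unfolding lepoll_def by blast
  qed
  ultimately show ?thesis by (rule small_lepoll)
qed

lemma Union_small:
  fixes I :: "'i set" and F :: "'i \<Rightarrow> 'm set"
  assumes I: "small U I" and F: "\<And>i. i \<in> I \<Longrightarrow> small U (F i)"
  shows "small U (\<Union>i\<in>I. F i)"
proof -
  obtain b :: "'i \<Rightarrow> 'm" where b: "inj_on b I"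
    using assms small_inj by blast
  have "small U (\<Union>k\<in>b ` I. F (the_inv_into I b k))"
  proof -
    have "\<forall>k\<in>b ` I. small U (F (the_inv_into I b k))"
      using F b by (auto simp: the_inv_into_f_f)
    then show ?thesis
      using univ small_image[OF I, of b] unfolding grothendieck_universe_def by presburger
  qed
  moreover have "(\<Union>k\<in>b ` I. F (the_inv_into I b k)) = (\<Union>i\<in>I. F i)"
    using b by (auto simp: the_inv_into_f_f)
  ultimately show ?thesis by simp
qed

text \<open>An extensional function is determined by its graph over \<open>I\<close>, which is a
  subset of the small set \<open>I \<times> T\<close>.\<close>

lemma PiE_small:
  fixes I :: "'i set" and F :: "'i \<Rightarrow> 'x set"
  assumes I: "small U I" and F: "\<And>i. i \<in> I \<Longrightarrow> F i \<subseteq> T" and T: "small U T"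
  shows "small U (Pi\<^sub>E I F)"
proof -
  have "inj_on (\<lambda>f. (\<lambda>i. (i, f i)) ` I) (Pi\<^sub>E I F)"
  proof (rule inj_onI)
    fix f g assume f: "f \<in> Pi\<^sub>E I F" and g: "g \<in> Pi\<^sub>E I F"
      and eq: "(\<lambda>i. (i, f i)) ` I = (\<lambda>i. (i, g i)) ` I"
    show "f = g"
      using f g by (rule PiE_ext) (use eq in auto)
  qed
  moreover have "(\<lambda>f. (\<lambda>i. (i, f i)) ` I) ` Pi\<^sub>E I F \<subseteq> Pow (I \<times> T)"
    using F by fastforce
  ultimately have "Pi\<^sub>E I F \<lesssim> Pow (I \<times> T)"
    unfolding lepoll_def by blast
  then show ?thesis
    using Pow_small[OF Times_small[OF I T]] small_lepoll by blast
qed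

end

section \<open>Homomorphisms and submodules\<close>

context right_module
begin

lemma ract_zero_left:
  assumes "a \<in> carrier A"
  shows "\<zero>\<^bsub>M\<^esub> \<triangleleft>\<^bsub>M\<^esub> a = \<zero>\<^bsub>M\<^esub>"
proof -
  have "\<zero>\<^bsub>M\<^esub> \<triangleleft>\<^bsub>M\<^esub> a \<oplus>\<^bsub>M\<^esub> \<zero>\<^bsub>M\<^esub> \<triangleleft>\<^bsub>M\<^esub> a = \<zero>\<^bsub>M\<^esub> \<triangleleft>\<^bsub>M\<^esub> a"
    using ract_add_left[of "\<zero>\<^bsub>M\<^esub>" "\<zero>\<^bsub>M\<^esub>" a] assms by simp
  then show ?thesis
    using assms ract_closed[of "\<zero>\<^bsub>M\<^esub>" a] by (metis M.add.l_cancel_one' M.zero_closed)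
qed

lemma ract_zero_right:
  assumes "x \<in> carrier M"
  shows "x \<triangleleft>\<^bsub>M\<^esub> \<zero>\<^bsub>A\<^esub> = \<zero>\<^bsub>M\<^esub>"
proof -
  have "x \<triangleleft>\<^bsub>M\<^esub> \<zero>\<^bsub>A\<^esub> \<oplus>\<^bsub>M\<^esub> x \<triangleleft>\<^bsub>M\<^esub> \<zero>\<^bsub>A\<^esub> = x \<triangleleft>\<^bsub>M\<^esub> \<zero>\<^bsub>A\<^esub>"
    using ract_add_right[of x "\<zero>\<^bsub>A\<^esub>" "\<zero>\<^bsub>A\<^esub>"] assms by simp
  then show ?thesis
    using assms ract_closed[of x "\<zero>\<^bsub>A\<^esub>"] by (metis M.add.l_cancel_one' A.zero_closed)
qed

text \<open>Negation is a scalar action, so closure under scalars makes submodules closed under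
  negation and homomorphisms compatible with it.\<close>

lemma ract_neg_one:
  assumes "x \<in> carrier M"
  shows "x \<triangleleft>\<^bsub>M\<^esub> (\<ominus>\<^bsub>A\<^esub> \<one>\<^bsub>A\<^esub>) = \<ominus>\<^bsub>M\<^esub> x"
proof -
  have "x \<oplus>\<^bsub>M\<^esub> x \<triangleleft>\<^bsub>M\<^esub> (\<ominus>\<^bsub>A\<^esub> \<one>\<^bsub>A\<^esub>) = x \<triangleleft>\<^bsub>M\<^esub> (\<one>\<^bsub>A\<^esub> \<oplus>\<^bsub>A\<^esub> \<ominus>\<^bsub>A\<^esub> \<one>\<^bsub>A\<^esub>)"
    using assms by (simp add: ract_add_right ract_one del: A.r_neg)
  also have "\<dots> = \<zero>\<^bsub>M\<^esub>" using assms by (simp add: A.r_neg ract_zero_right)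
  finally show ?thesis
    using assms ract_closed[of x "\<ominus>\<^bsub>A\<^esub> \<one>\<^bsub>A\<^esub>"] by (metis A.a_inv_closed A.one_closed M.a_comm M.minus_equality)
qed

end

text \<open>The working notion of homomorphism. Unlike \<open>mod_hom\<close> it ignores values
  outside the carrier, so that composites and sums are plain lambda terms without restrictions, and
  it carries the module hypotheses on both sides.\<close>

definition lin :: "('a, 'r) ring_scheme \<Rightarrow> ('a, 'm) rmodule \<Rightarrow> ('a, 'n) rmodule \<Rightarrow> ('m \<Rightarrow> 'n) \<Rightarrow> bool" where
  "lin A M N f \<longleftrightarrow> right_module A M \<and> right_module A N \<and>
     (\<forall>x\<in>carrier M. f x \<in> carrier N) \<and>
     (\<forall>x\<in>carrier M. \<forall>y\<in>carrier M. f (x \<oplus>\<^bsub>M\<^esub> y) = f x \<oplus>\<^bsub>N\<^esub> f y) \<and>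
     (\<forall>x\<in>carrier M. \<forall>a\<in>carrier A. f (x \<triangleleft>\<^bsub>M\<^esub> a) = f x \<triangleleft>\<^bsub>N\<^esub> a)"

lemma linI:
  assumes "right_module A M" "right_module A N"
    and "\<And>x. x \<in> carrier M \<Longrightarrow> f x \<in> carrier N"
    and "\<And>x y. x \<in> carrier M \<Longrightarrow> y \<in> carrier M \<Longrightarrow> f (x \<oplus>\<^bsub>M\<^esub> y) = f x \<oplus>\<^bsub>N\<^esub> f y"
    and "\<And>x a. x \<in> carrier M \<Longrightarrow> a \<in> carrier A \<Longrightarrow> f (x \<triangleleft>\<^bsub>M\<^esub> a) = f x \<triangleleft>\<^bsub>N\<^esub> a"
  shows "lin A M N f"
  using assms by (simp add: lin_def)

lemma lin_dom: "lin A M N f \<Longrightarrow> right_module A M"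
  and lin_cod: "lin A M N f \<Longrightarrow> right_module A N"
  and lin_closed: "lin A M N f \<Longrightarrow> x \<in> carrier M \<Longrightarrow> f x \<in> carrier N"
  and lin_add: "lin A M N f \<Longrightarrow> x \<in> carrier M \<Longrightarrow> y \<in> carrier M \<Longrightarrow> f (x \<oplus>\<^bsub>M\<^esub> y) = f x \<oplus>\<^bsub>N\<^esub> f y"
  and lin_ract: "lin A M N f \<Longrightarrow> x \<in> carrier M \<Longrightarrow> a \<in> carrier A \<Longrightarrow> f (x \<triangleleft>\<^bsub>M\<^esub> a) = f x \<triangleleft>\<^bsub>N\<^esub> a"
  by (simp_all add: lin_def)

lemma right_module_abelian: "right_module A M \<Longrightarrow> abelian_group M"
  and right_module_ring: "right_module A M \<Longrightarrow> ring A"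
  by (simp_all add: right_module_def)

lemma lin_zero:
  assumes "lin A M N f" shows "f \<zero>\<^bsub>M\<^esub> = \<zero>\<^bsub>N\<^esub>"
proof -
  interpret M: right_module A M by (rule lin_dom[OF assms])
  interpret N: right_module A N by (rule lin_cod[OF assms])
  have "f \<zero>\<^bsub>M\<^esub> \<oplus>\<^bsub>N\<^esub> f \<zero>\<^bsub>M\<^esub> = f \<zero>\<^bsub>M\<^esub>"
    using lin_add[OF assms, of "\<zero>\<^bsub>M\<^esub>" "\<zero>\<^bsub>M\<^esub>"] by simp
  then show ?thesis
    using lin_closed[OF assms, of "\<zero>\<^bsub>M\<^esub>"] by (metis N.add.l_cancel_one' M.zero_closed)
qed

lemma lin_neg:
  assumes "lin A M N f" "x \<in> carrier M" shows "f (\<ominus>\<^bsub>M\<^esub> x) = \<ominus>\<^bsub>N\<^esub> f x"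
proof -
  interpret M: right_module A M by (rule lin_dom[OF assms(1)])
  interpret N: right_module A N by (rule lin_cod[OF assms(1)])
  show ?thesis
    using lin_ract[OF assms(1,2), of "\<ominus>\<^bsub>A\<^esub> \<one>\<^bsub>A\<^esub>"] lin_closed[OF assms] assms(2)
    by (simp add: M.ract_neg_one N.ract_neg_one)
qed

lemma lin_minus:
  assumes "lin A M N f" "x \<in> carrier M" "y \<in> carrier M"
  shows "f (x \<ominus>\<^bsub>M\<^esub> y) = f x \<ominus>\<^bsub>N\<^esub> f y"
proof -
  interpret M: right_module A M by (rule lin_dom[OF assms(1)])
  show ?thesis using assms by (simp add: a_minus_def lin_add lin_neg)
qed

lemma lin_compose:
  assumes "lin A M N f" "lin A N K g"
  shows "lin A M K (\<lambda>x. g (f x))"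
  using assms by (simp add: lin_def)

lemma lin_cong:
  assumes "lin A M N f" "\<And>x. x \<in> carrier M \<Longrightarrow> g x = f x"
  shows "lin A M N g"
proof -
  interpret M: right_module A M by (rule lin_dom[OF assms(1)])
  show ?thesis using assms by (auto simp: lin_def M.ract_closed)
qed

lemma lin_id: "right_module A M \<Longrightarrow> lin A M M (\<lambda>x. x)"
  by (simp add: lin_def)

lemma lin_const_zero:
  assumes "right_module A M" "right_module A N"
  shows "lin A M N (\<lambda>x. \<zero>\<^bsub>N\<^esub>)"
proof -
  interpret N: right_module A N by fact
  show ?thesis using assms by (simp add: lin_def N.ract_zero_left)
qed

lemma lin_plus:
  assumes "lin A M N f" "lin A M N g"
  shows "lin A M N (\<lambda>x. f x \<oplus>\<^bsub>N\<^esub> g x)"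
proof -
  interpret N: right_module A N by (rule lin_cod[OF assms(1)])
  show ?thesis
    using assms by (auto simp: lin_def N.ract_add_left N.a_ac)
qed

lemma lin_uminus:
  assumes "lin A M N f"
  shows "lin A M N (\<lambda>x. \<ominus>\<^bsub>N\<^esub> f x)"
proof -
  interpret N: right_module A N by (rule lin_cod[OF assms(1)])
  show ?thesis
  proof (rule linI)
    fix x a assume x: "x \<in> carrier M" and a: "a \<in> carrier A"
    have "(\<lambda>y. y \<triangleleft>\<^bsub>N\<^esub> a) (\<ominus>\<^bsub>N\<^esub> f x) \<oplus>\<^bsub>N\<^esub> f x \<triangleleft>\<^bsub>N\<^esub> a = \<zero>\<^bsub>N\<^esub>"
      using x a lin_closed[OF assms x]
      by (simp add: N.ract_add_left[symmetric] N.l_neg N.ract_zero_left)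
    then show "\<ominus>\<^bsub>N\<^esub> f (x \<triangleleft>\<^bsub>M\<^esub> a) = (\<ominus>\<^bsub>N\<^esub> f x) \<triangleleft>\<^bsub>N\<^esub> a"
      using x a lin_closed[OF assms x] lin_ract[OF assms x a]
      by (simp add: N.ract_closed N.minus_equality)
  qed (use assms in \<open>auto simp: lin_def N.minus_add N.a_ac\<close>)
qed

lemma lin_diff:
  assumes "lin A M N f" "lin A M N g"
  shows "lin A M N (\<lambda>x. f x \<ominus>\<^bsub>N\<^esub> g x)"
  using lin_plus[OF assms(1) lin_uminus[OF assms(2)]] by (simp add: a_minus_def)

lemma mod_hom_lin:
  assumes "right_module A M" "right_module A N" "f \<in> mod_hom A M N"
  shows "lin A M N f"
  using assms by (auto simp: mod_hom_def lin_def PiE_iff)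

lemma lin_restrict:
  assumes "lin A M N f" shows "restrict f (carrier M) \<in> mod_hom A M N"
proof -
  interpret M: right_module A M by (rule lin_dom[OF assms(1)])
  show ?thesis using assms by (auto simp: mod_hom_def lin_def M.ract_closed)
qed

lemma mod_hom_extensional: "f \<in> mod_hom A M N \<Longrightarrow> f \<in> extensional (carrier M)"
  by (auto simp: mod_hom_def PiE_def)

lemma mod_hom_eqI:
  assumes "f \<in> mod_hom A M N" "g \<in> mod_hom A M N" "\<And>x. x \<in> carrier M \<Longrightarrow> f x = g x"
  shows "f = g"
  using assms by (meson extensionalityI mod_hom_extensional)

section \<open>Submodules\<close>

definition submod :: "('a, 'r) ring_scheme \<Rightarrow> ('a, 'm) rmodule \<Rightarrow> 'm set \<Rightarrow> bool" where
  "submod A M S \<longleftrightarrow> right_module A M \<and> S \<subseteq> carrier M \<and> \<zero>\<^bsub>M\<^esub> \<in> S \<and>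
     (\<forall>x\<in>S. \<forall>y\<in>S. x \<oplus>\<^bsub>M\<^esub> y \<in> S) \<and> (\<forall>x\<in>S. \<forall>a\<in>carrier A. x \<triangleleft>\<^bsub>M\<^esub> a \<in> S)"

text \<open>Only the carrier changes. Zero, sum and action are those of \<open>M\<close>, inclusions
  are identities, and \<open>sub (sub M S) T\<close> simplifies to \<open>sub M T\<close>.\<close>

abbreviation sub :: "('a, 'm) rmodule \<Rightarrow> 'm set \<Rightarrow> ('a, 'm) rmodule" where
  "sub M S \<equiv> M\<lparr>carrier := S\<rparr>"

lemma submodI:
  assumes "right_module A M" "S \<subseteq> carrier M" "\<zero>\<^bsub>M\<^esub> \<in> S"
    and "\<And>x y. x \<in> S \<Longrightarrow> y \<in> S \<Longrightarrow> x \<oplus>\<^bsub>M\<^esub> y \<in> S"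
    and "\<And>x a. x \<in> S \<Longrightarrow> a \<in> carrier A \<Longrightarrow> x \<triangleleft>\<^bsub>M\<^esub> a \<in> S"
  shows "submod A M S"
  using assms by (simp add: submod_def)

lemma submod_mod: "submod A M S \<Longrightarrow> right_module A M"
  and submod_subset: "submod A M S \<Longrightarrow> S \<subseteq> carrier M"
  and submod_zero: "submod A M S \<Longrightarrow> \<zero>\<^bsub>M\<^esub> \<in> S"
  and submod_add: "submod A M S \<Longrightarrow> x \<in> S \<Longrightarrow> y \<in> S \<Longrightarrow> x \<oplus>\<^bsub>M\<^esub> y \<in> S"
  and submod_ract: "submod A M S \<Longrightarrow> x \<in> S \<Longrightarrow> a \<in> carrier A \<Longrightarrow> x \<triangleleft>\<^bsub>M\<^esub> a \<in> S"
  by (auto simp: submod_def)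

lemma submod_neg:
  assumes "submod A M S" "x \<in> S" shows "\<ominus>\<^bsub>M\<^esub> x \<in> S"
proof -
  interpret M: right_module A M by (rule submod_mod[OF assms(1)])
  show ?thesis
    using M.ract_neg_one[of x] submod_ract[OF assms, of "\<ominus>\<^bsub>A\<^esub> \<one>\<^bsub>A\<^esub>"] submod_subset[OF assms(1)] assms(2)
    by auto
qed

lemma submod_minus: "submod A M S \<Longrightarrow> x \<in> S \<Longrightarrow> y \<in> S \<Longrightarrow> x \<ominus>\<^bsub>M\<^esub> y \<in> S"
  by (simp add: a_minus_def submod_add submod_neg)

lemma right_module_sub:
  assumes S: "submod A M S" shows "right_module A (sub M S)"
proof -
  interpret M: right_module A M by (rule submod_mod[OF S])
  have sub: "x \<in> carrier M" if "x \<in> S" for x using that submod_subset[OF S] by blast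
  show ?thesis
  proof (intro right_module.intro M.A.ring_axioms abelian_groupI right_module_axioms.intro; simp?)
    fix x assume "x \<in> S"
    then show "\<exists>y\<in>S. y \<oplus>\<^bsub>M\<^esub> x = \<zero>\<^bsub>M\<^esub>"
      by (intro bexI[of _ "\<ominus>\<^bsub>M\<^esub> x"]) (auto simp: sub M.l_neg submod_neg[OF S])
  qed (auto simp: sub M.a_ac M.ract_add_left M.ract_add_right M.ract_mult M.ract_one
      submod_zero[OF S] submod_add[OF S] submod_ract[OF S])
qed

lemma submod_carrier: "right_module A M \<Longrightarrow> submod A M (carrier M)"
  by (rule submodI) (auto simp: right_module_def abelian_group_def abelian_monoid.zero_closed
      abelian_monoid.a_closed right_module.ract_closed intro: right_module.ract_closed)

lemma lin_sub:
  assumes "lin A M N f" "submod A M S" shows "lin A (sub M S) N f"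
  using assms submod_subset[OF assms(2)] right_module_sub[OF assms(2)]
  by (auto simp: lin_def subset_iff)

lemma lin_into_sub:
  assumes "lin A M N f" "submod A N S" "\<And>x. x \<in> carrier M \<Longrightarrow> f x \<in> S"
  shows "lin A M (sub N S) f"
  using assms right_module_sub[OF assms(2)] by (auto simp: lin_def)

lemma lin_from_sub:
  assumes "lin A M (sub N S) f" "submod A N S"
  shows "lin A M N f"
  using assms submod_subset[OF assms(2)] submod_mod[OF assms(2)] by (auto simp: lin_def)

lemma lin_inclusion: "submod A M S \<Longrightarrow> lin A (sub M S) M (\<lambda>x. x)"
  by (rule lin_sub[OF lin_id]) (auto dest: submod_mod)

lemma submod_sub:
  assumes "submod A M S" "submod A M T" "T \<subseteq> S" shows "submod A (sub M S) T"
  using assms right_module_sub[OF assms(1)] by (auto simp: submod_def)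

lemma submod_of_sub:
  assumes "submod A (sub M S) T" "submod A M S" shows "submod A M T"
  using assms by (auto simp: submod_def)

lemma submod_image:
  assumes f: "lin A M N f" and S: "submod A M S" shows "submod A N (f ` S)"
proof (rule submodI)
  have sub: "x \<in> carrier M" if "x \<in> S" for x using that submod_subset[OF S] by blast
  show "right_module A N" by (rule lin_cod[OF f])
  show "f ` S \<subseteq> carrier N" using sub lin_closed[OF f] by blast
  show "\<zero>\<^bsub>N\<^esub> \<in> f ` S" using lin_zero[OF f] submod_zero[OF S] by (metis imageI)
  show "x \<oplus>\<^bsub>N\<^esub> y \<in> f ` S" if "x \<in> f ` S" "y \<in> f ` S" for x y
    using that lin_add[OF f] sub submod_add[OF S] by (smt (verit) image_iff)
  show "x \<triangleleft>\<^bsub>N\<^esub> a \<in> f ` S" if "x \<in> f ` S" "a \<in> carrier A" for x a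
    using that lin_ract[OF f] sub submod_ract[OF S] by (smt (verit) image_iff)
qed

lemma submod_vimage:
  assumes f: "lin A M N f" and S: "submod A N S"
  shows "submod A M {x \<in> carrier M. f x \<in> S}"
proof -
  interpret M: right_module A M by (rule lin_dom[OF f])
  show ?thesis
    by (rule submodI)
      (auto simp: M.right_module_axioms M.ract_closed lin_zero[OF f] lin_add[OF f] lin_ract[OF f]
        submod_zero[OF S] submod_add[OF S] submod_ract[OF S])
qed

lemma submod_singleton_zero:
  assumes "right_module A M" shows "submod A M {\<zero>\<^bsub>M\<^esub>}"
proof -
  interpret M: right_module A M by fact
  show ?thesis by (rule submodI) (auto simp: M.ract_zero_left M.right_module_axioms)
qed

lemma submod_kernel:
  assumes f: "lin A M N f" shows "submod A M (hom_kernel M N f)"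
  using submod_vimage[OF f submod_singleton_zero[OF lin_cod[OF f]]] by (simp add: hom_kernel_def)

lemma submod_equalizer:
  assumes f: "lin A M N f" and g: "lin A M N g"
  shows "submod A M {x \<in> carrier M. f x = g x}"
proof -
  interpret M: right_module A M by (rule lin_dom[OF f])
  show ?thesis
    by (rule submodI)
      (auto simp: M.right_module_axioms M.ract_closed lin_zero[OF f] lin_add[OF f] lin_ract[OF f]
        lin_zero[OF g] lin_add[OF g] lin_ract[OF g])
qed

section \<open>Kernels and factorization of homomorphisms\<close>

lemma minus_eq_zero_iff:
  assumes "right_module A M" "x \<in> carrier M" "y \<in> carrier M"
  shows "x \<ominus>\<^bsub>M\<^esub> y = \<zero>\<^bsub>M\<^esub> \<longleftrightarrow> x = y"
proof -
  interpret M: right_module A M by fact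
  have "x \<ominus>\<^bsub>M\<^esub> y = y \<ominus>\<^bsub>M\<^esub> y \<longleftrightarrow> x = y"
    using assms by (simp add: a_minus_def del: M.r_neg)
  then show ?thesis using assms by (simp add: a_minus_def M.r_neg)
qed

lemma minus_zero_eq:
  assumes "right_module A M" "x \<in> carrier M"
  shows "x \<ominus>\<^bsub>M\<^esub> \<zero>\<^bsub>M\<^esub> = x"
proof -
  interpret M: right_module A M by fact
  have "\<ominus>\<^bsub>M\<^esub> \<zero>\<^bsub>M\<^esub> = \<zero>\<^bsub>M\<^esub>" by (rule M.minus_equality) simp_all
  then show ?thesis using assms(2) by (simp add: a_minus_def)
qed

text \<open>Any surjection serves as the quotient by its kernel: \<open>h\<close> is computed on an
  arbitrary preimage. Homomorphisms out of quotients and pushouts are all obtained in this way,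
  without reference to cosets.\<close>

lemma lin_factor:
  assumes f: "lin A M N f" and g: "lin A M K g"
    and surj: "f ` carrier M = carrier N"
    and ker: "\<And>x. x \<in> carrier M \<Longrightarrow> f x = \<zero>\<^bsub>N\<^esub> \<Longrightarrow> g x = \<zero>\<^bsub>K\<^esub>"
  obtains h where "lin A N K h" "\<And>x. x \<in> carrier M \<Longrightarrow> h (f x) = g x"
proof -
  interpret M: right_module A M by (rule lin_dom[OF f])
  interpret N: right_module A N by (rule lin_cod[OF f])
  interpret K: right_module A K by (rule lin_cod[OF g])
  have eq: "g x = g y" if "x \<in> carrier M" "y \<in> carrier M" "f x = f y" for x y
  proof -
    have "f (x \<ominus>\<^bsub>M\<^esub> y) = \<zero>\<^bsub>N\<^esub>"
      using that lin_closed[OF f] by (simp add: lin_minus[OF f] minus_eq_zero_iff[OF N.right_module_axioms])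
    then have "g x \<ominus>\<^bsub>K\<^esub> g y = \<zero>\<^bsub>K\<^esub>"
      using ker[of "x \<ominus>\<^bsub>M\<^esub> y"] that by (simp add: lin_minus[OF g])
    then show ?thesis
      using that lin_closed[OF g] by (simp add: minus_eq_zero_iff[OF K.right_module_axioms])
  qed
  define h where "h = (\<lambda>z. g (inv_into (carrier M) f z))"
  have h: "h (f x) = g x" if "x \<in> carrier M" for x
    unfolding h_def by (rule eq) (auto simp: that inv_into_into f_inv_into_f)
  have "lin A N K h"
  proof (rule linI[OF N.right_module_axioms K.right_module_axioms])
    fix u assume "u \<in> carrier N"
    then obtain x where x: "x \<in> carrier M" "u = f x" using surj by blast
    then show "h u \<in> carrier K" by (simp add: h lin_closed[OF g])
    { fix v assume "v \<in> carrier N"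
      then obtain y where y: "y \<in> carrier M" "v = f y" using surj by blast
      show "h (u \<oplus>\<^bsub>N\<^esub> v) = h u \<oplus>\<^bsub>K\<^esub> h v"
        using x y h[of "x \<oplus>\<^bsub>M\<^esub> y"] by (simp add: h lin_add[OF f] lin_add[OF g]) }
    { fix a assume a: "a \<in> carrier A"
      show "h (u \<triangleleft>\<^bsub>N\<^esub> a) = h u \<triangleleft>\<^bsub>K\<^esub> a"
        using x a h[of "x \<triangleleft>\<^bsub>M\<^esub> a"] by (simp add: h lin_ract[OF f] lin_ract[OF g] M.ract_closed) }
  qed
  with h that show thesis by blast
qed

lemma lin_kernel_inj:
  assumes f: "lin A M N f" and ker: "\<And>x. x \<in> carrier M \<Longrightarrow> f x = \<zero>\<^bsub>N\<^esub> \<Longrightarrow> x = \<zero>\<^bsub>M\<^esub>"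
  shows "inj_on f (carrier M)"
proof (rule inj_onI)
  fix x y assume xy: "x \<in> carrier M" "y \<in> carrier M" "f x = f y"
  interpret M: right_module A M by (rule lin_dom[OF f])
  have "f (x \<ominus>\<^bsub>M\<^esub> y) = \<zero>\<^bsub>N\<^esub>"
    using xy lin_closed[OF f] by (simp add: lin_minus[OF f] minus_eq_zero_iff[OF lin_cod[OF f]])
  with ker[of "x \<ominus>\<^bsub>M\<^esub> y"] xy show "x = y"
    by (simp add: minus_eq_zero_iff[OF M.right_module_axioms])
qed

text \<open>Dual to \<open>lin_factor\<close>. For a short exact sequence it turns a map that the
  projection kills into a map to the submodule.\<close>

lemma lin_lift_inj:
  assumes i: "lin A Y E i" and inj: "inj_on i (carrier Y)" and h: "lin A P E h"
    and im: "\<And>x. x \<in> carrier P \<Longrightarrow> h x \<in> i ` carrier Y"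
  obtains k where "lin A P Y k" "\<And>x. x \<in> carrier P \<Longrightarrow> i (k x) = h x"
proof -
  interpret Y: right_module A Y by (rule lin_dom[OF i])
  interpret P: right_module A P by (rule lin_dom[OF h])
  define k where "k = (\<lambda>x. inv_into (carrier Y) i (h x))"
  have k: "k x \<in> carrier Y" "i (k x) = h x" if "x \<in> carrier P" for x
    using im[OF that] by (auto simp: k_def inv_into_into f_inv_into_f)
  have "lin A P Y k"
  proof (rule linI[OF P.right_module_axioms Y.right_module_axioms])
    fix x assume x: "x \<in> carrier P"
    show "k x \<in> carrier Y" using k x by simp
    show "k (x \<oplus>\<^bsub>P\<^esub> y) = k x \<oplus>\<^bsub>Y\<^esub> k y" if y: "y \<in> carrier P" for y
      by (rule inj_onD[OF inj]) (simp_all add: k x y lin_add[OF i] lin_add[OF h])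
    show "k (x \<triangleleft>\<^bsub>P\<^esub> a) = k x \<triangleleft>\<^bsub>Y\<^esub> a" if a: "a \<in> carrier A" for a
      by (rule inj_onD[OF inj]) (simp_all add: k x a P.ract_closed Y.ract_closed lin_ract[OF i] lin_ract[OF h])
  qed
  with k that show thesis by blast
qed

section \<open>Quotients, products and direct sums\<close>

lemma Mod_catD: "M \<in> Mod_cat A \<Longrightarrow> right_module A M"
  by (simp add: Mod_cat_def)

lemma Mod_cat_sub: "M \<in> Mod_cat A \<Longrightarrow> submod A M S \<Longrightarrow> sub M S \<in> Mod_cat A"
  by (auto simp: Mod_cat_def right_module_sub dest: submod_subset intro: small_subset)

text \<open>The quotient has to live on the type \<open>'m\<close>, whereas cosets are sets; since
  the power set of a small carrier is small, each coset can be replaced by a code in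
  \<open>'m\<close>. The source type is arbitrary, so modules built on function types also return to
  \<open>Mod_cat A\<close> through this lemma.\<close>

lemma (in universe) quotient_exists:
  fixes M :: "('a, 'x) rmodule"
  assumes S: "submod A M S" and small: "small U (carrier M)"
  obtains N :: "('a, 'm) rmodule" and c where "N \<in> Mod_cat A" "lin A M N c"
    "c ` carrier M = carrier N" "hom_kernel M N c = S"
proof -
  interpret M: right_module A M by (rule submod_mod[OF S])
  have sub: "x \<in> carrier M" if "x \<in> S" for x using that submod_subset[OF S] by blast
  obtain b :: "'x set \<Rightarrow> 'm" where b: "inj_on b (Pow (carrier M))"
    using small_inj[OF Pow_small[OF small]] by blast
  define c where "c x = b {y \<in> carrier M. y \<ominus>\<^bsub>M\<^esub> x \<in> S}" for x
  have diff: "y \<ominus>\<^bsub>M\<^esub> x = (y \<ominus>\<^bsub>M\<^esub> z) \<oplus>\<^bsub>M\<^esub> (z \<ominus>\<^bsub>M\<^esub> x)"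
    if "x \<in> carrier M" "y \<in> carrier M" "z \<in> carrier M" for x y z
  proof -
    have "(y \<ominus>\<^bsub>M\<^esub> z) \<oplus>\<^bsub>M\<^esub> (z \<ominus>\<^bsub>M\<^esub> x) = y \<oplus>\<^bsub>M\<^esub> (\<ominus>\<^bsub>M\<^esub> z \<oplus>\<^bsub>M\<^esub> (z \<oplus>\<^bsub>M\<^esub> \<ominus>\<^bsub>M\<^esub> x))"
      using that by (simp add: a_minus_def M.a_assoc)
    also have "\<dots> = y \<ominus>\<^bsub>M\<^esub> x"
      using that by (simp add: M.r_neg1 a_minus_def)
    finally show ?thesis by simp
  qed
  have sym: "x \<ominus>\<^bsub>M\<^esub> y \<in> S" if "x \<in> carrier M" "y \<in> carrier M" "y \<ominus>\<^bsub>M\<^esub> x \<in> S" for x y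
    using submod_neg[OF S that(3)] that(1,2) by (simp add: a_minus_def M.minus_add M.a_comm)
  have c: "c x = c y \<longleftrightarrow> x \<ominus>\<^bsub>M\<^esub> y \<in> S" if "x \<in> carrier M" "y \<in> carrier M" for x y
  proof
    assume "c x = c y"
    then have "{z \<in> carrier M. z \<ominus>\<^bsub>M\<^esub> x \<in> S} = {z \<in> carrier M. z \<ominus>\<^bsub>M\<^esub> y \<in> S}"
      unfolding c_def by (rule inj_onD[OF b]) auto
    moreover have "x \<in> {z \<in> carrier M. z \<ominus>\<^bsub>M\<^esub> x \<in> S}"
      using that submod_zero[OF S] by (simp add: a_minus_def M.r_neg)
    ultimately show "x \<ominus>\<^bsub>M\<^esub> y \<in> S" by blast
  next
    assume xy: "x \<ominus>\<^bsub>M\<^esub> y \<in> S"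
    then have yx: "y \<ominus>\<^bsub>M\<^esub> x \<in> S" using sym that by blast
    have "z \<ominus>\<^bsub>M\<^esub> x \<in> S \<longleftrightarrow> z \<ominus>\<^bsub>M\<^esub> y \<in> S" if z: "z \<in> carrier M" for z
      using diff[of x z y] diff[of y z x] \<open>x \<in> carrier M\<close> \<open>y \<in> carrier M\<close> z xy yx
        submod_add[OF S] by metis
    then have "{z \<in> carrier M. z \<ominus>\<^bsub>M\<^esub> x \<in> S} = {z \<in> carrier M. z \<ominus>\<^bsub>M\<^esub> y \<in> S}" by blast
    then show "c x = c y" by (simp add: c_def)
  qed
  \<comment> \<open>Operations on classes are computed on chosen representatives;
    \<open>add_cong\<close> and \<open>ractN\<close> show that the choice is immaterial.\<close>
  define r where "r = inv_into (carrier M) c"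
  have r: "r (c x) \<in> carrier M" "c (r (c x)) = c x" if "x \<in> carrier M" for x
    using that by (auto simp: r_def inv_into_into f_inv_into_f)
  define N :: "('a, 'm) rmodule" where "N = \<lparr>carrier = c ` carrier M, mult = undefined,
    one = undefined, zero = c \<zero>\<^bsub>M\<^esub>, add = (\<lambda>u v. c (r u \<oplus>\<^bsub>M\<^esub> r v)), ract = (\<lambda>u a. c (r u \<triangleleft>\<^bsub>M\<^esub> a))\<rparr>"
  have add_cong: "c (x \<oplus>\<^bsub>M\<^esub> y) = c (x' \<oplus>\<^bsub>M\<^esub> y')"
    if "x \<in> carrier M" "y \<in> carrier M" "x' \<in> carrier M" "y' \<in> carrier M" "c x = c x'" "c y = c y'"
    for x y x' y'
  proof -
    have "x \<oplus>\<^bsub>M\<^esub> y \<ominus>\<^bsub>M\<^esub> (x' \<oplus>\<^bsub>M\<^esub> y') = (x \<ominus>\<^bsub>M\<^esub> x') \<oplus>\<^bsub>M\<^esub> (y \<ominus>\<^bsub>M\<^esub> y')"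
      using that by (simp add: a_minus_def M.minus_add M.a_ac)
    then show ?thesis using that c by (simp add: submod_add[OF S])
  qed
  have addN: "c x \<oplus>\<^bsub>N\<^esub> c y = c (x \<oplus>\<^bsub>M\<^esub> y)" if "x \<in> carrier M" "y \<in> carrier M" for x y
    using that r by (simp add: N_def) (rule add_cong, simp_all)
  have ractN: "c x \<triangleleft>\<^bsub>N\<^esub> a = c (x \<triangleleft>\<^bsub>M\<^esub> a)" if "x \<in> carrier M" "a \<in> carrier A" for x a
  proof -
    have "r (c x) \<ominus>\<^bsub>M\<^esub> x \<in> S" using c r that by blast
    then have "(r (c x) \<ominus>\<^bsub>M\<^esub> x) \<triangleleft>\<^bsub>M\<^esub> a \<in> S" using submod_ract[OF S] that by blast
    moreover have "(\<ominus>\<^bsub>M\<^esub> x) \<triangleleft>\<^bsub>M\<^esub> a = \<ominus>\<^bsub>M\<^esub> (x \<triangleleft>\<^bsub>M\<^esub> a)"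
      using that lin_ract[OF lin_uminus[OF lin_id[OF M.right_module_axioms]]] by simp
    ultimately have "r (c x) \<triangleleft>\<^bsub>M\<^esub> a \<ominus>\<^bsub>M\<^esub> x \<triangleleft>\<^bsub>M\<^esub> a \<in> S"
      using r that by (simp add: a_minus_def M.ract_add_left)
    then show ?thesis
      using c r that by (simp add: N_def M.ract_closed)
  qed
  have carN: "carrier N = c ` carrier M" and zeroN: "\<zero>\<^bsub>N\<^esub> = c \<zero>\<^bsub>M\<^esub>" by (simp_all add: N_def)
  have "right_module A N"
  proof (intro right_module.intro M.A.ring_axioms abelian_groupI right_module_axioms.intro)
    fix u assume "u \<in> carrier N"
    then obtain x where x: "x \<in> carrier M" "u = c x" by (auto simp: carN)
    then show "\<exists>y\<in>carrier N. y \<oplus>\<^bsub>N\<^esub> u = \<zero>\<^bsub>N\<^esub>"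
      by (intro bexI[of _ "c (\<ominus>\<^bsub>M\<^esub> x)"]) (auto simp: carN zeroN addN M.l_neg)
  qed (auto simp: carN zeroN addN ractN M.ract_closed M.a_ac M.ract_add_left M.ract_add_right
        M.ract_mult M.ract_one)
  moreover have "small U (carrier N)" using small small_image by (simp add: carN)
  ultimately have "N \<in> Mod_cat A" by (simp add: Mod_cat_def small_def)
  moreover have "lin A M N c"
    using \<open>right_module A N\<close> M.right_module_axioms by (auto simp: lin_def carN addN ractN)
  moreover have "hom_kernel M N c = S"
    using c sub by (auto simp: hom_kernel_def zeroN minus_zero_eq[OF M.right_module_axioms])
  ultimately show thesis using that carN by simp
qed

text \<open>A copy inside \<open>'m\<close> is the quotient by the zero submodule.\<close>

lemma (in universe) copy_exists:
  fixes M :: "('a, 'x) rmodule"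
  assumes M: "right_module A M" and small: "small U (carrier M)"
  obtains N :: "('a, 'm) rmodule" and c d where "N \<in> Mod_cat A" "lin A M N c" "lin A N M d"
    "\<And>x. x \<in> carrier M \<Longrightarrow> d (c x) = x" "\<And>y. y \<in> carrier N \<Longrightarrow> c (d y) = y"
proof -
  obtain N :: "('a, 'm) rmodule" and c where N: "N \<in> Mod_cat A" and c: "lin A M N c"
    and surj: "c ` carrier M = carrier N" and ker: "hom_kernel M N c = {\<zero>\<^bsub>M\<^esub>}"
    using quotient_exists[OF submod_singleton_zero[OF M] small] by blast
  obtain d where d: "lin A N M d" "\<And>x. x \<in> carrier M \<Longrightarrow> d (c x) = x"
    using lin_factor[OF c lin_id[OF M] surj] ker unfolding hom_kernel_def by blast
  have "c (d y) = y" if "y \<in> carrier N" for y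
    using that d(2) surj by force
  with N c d that show thesis by blast
qed

section \<open>Direct products and direct sums\<close>

definition dprod :: "'i set \<Rightarrow> ('i \<Rightarrow> ('a, 'm) rmodule) \<Rightarrow> ('a, 'i \<Rightarrow> 'm) rmodule" where
  "dprod J F = \<lparr>carrier = (\<Pi>\<^sub>E j\<in>J. carrier (F j)), mult = undefined, one = undefined,
     zero = (\<lambda>j\<in>J. \<zero>\<^bsub>F j\<^esub>), add = (\<lambda>v w. \<lambda>j\<in>J. v j \<oplus>\<^bsub>F j\<^esub> w j),
     ract = (\<lambda>v a. \<lambda>j\<in>J. v j \<triangleleft>\<^bsub>F j\<^esub> a)\<rparr>"

definition supp :: "'i set \<Rightarrow> ('i \<Rightarrow> ('a, 'm) rmodule) \<Rightarrow> ('i \<Rightarrow> 'm) \<Rightarrow> 'i set" where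
  "supp J F v = {j \<in> J. v j \<noteq> \<zero>\<^bsub>F j\<^esub>}"

definition dsum :: "'i set \<Rightarrow> ('i \<Rightarrow> ('a, 'm) rmodule) \<Rightarrow> ('a, 'i \<Rightarrow> 'm) rmodule" where
  "dsum J F = sub (dprod J F) {v \<in> \<Pi>\<^sub>E j\<in>J. carrier (F j). finite (supp J F v)}"

lemma carrier_dprod: "carrier (dprod J F) = (\<Pi>\<^sub>E j\<in>J. carrier (F j))"
  and zero_dprod: "\<zero>\<^bsub>dprod J F\<^esub> = (\<lambda>j\<in>J. \<zero>\<^bsub>F j\<^esub>)"
  and add_dprod: "v \<oplus>\<^bsub>dprod J F\<^esub> w = (\<lambda>j\<in>J. v j \<oplus>\<^bsub>F j\<^esub> w j)"
  and ract_dprod: "v \<triangleleft>\<^bsub>dprod J F\<^esub> a = (\<lambda>j\<in>J. v j \<triangleleft>\<^bsub>F j\<^esub> a)"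
  by (simp_all add: dprod_def)

lemma carrier_dsum: "carrier (dsum J F) = {v \<in> \<Pi>\<^sub>E j\<in>J. carrier (F j). finite (supp J F v)}"
  and zero_dsum: "\<zero>\<^bsub>dsum J F\<^esub> = (\<lambda>j\<in>J. \<zero>\<^bsub>F j\<^esub>)"
  and add_dsum: "v \<oplus>\<^bsub>dsum J F\<^esub> w = (\<lambda>j\<in>J. v j \<oplus>\<^bsub>F j\<^esub> w j)"
  and ract_dsum: "v \<triangleleft>\<^bsub>dsum J F\<^esub> a = (\<lambda>j\<in>J. v j \<triangleleft>\<^bsub>F j\<^esub> a)"
  by (simp_all add: dsum_def dprod_def)

lemma right_module_dprod:
  assumes A: "ring A" and F: "\<And>j. j \<in> J \<Longrightarrow> right_module A (F j)"
  shows "right_module A (dprod J F)"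
proof -
  have F': "abelian_group (F j)" if "j \<in> J" for j using F[OF that] by (rule right_module_abelian)
  note [simp] = abelian_monoid.a_closed[OF abelian_group.axioms(1)[OF F']]
    abelian_monoid.zero_closed[OF abelian_group.axioms(1)[OF F']]
    abelian_monoid.l_zero[OF abelian_group.axioms(1)[OF F']]
    abelian_monoid.r_zero[OF abelian_group.axioms(1)[OF F']]
    right_module.ract_closed[OF F]
  have mem [simp]: "v j \<in> carrier (F j)" if "v \<in> (\<Pi>\<^sub>E j\<in>J. carrier (F j))" "j \<in> J" for v j
    using that by auto
  have arb [simp]: "v j = undefined" if "v \<in> (\<Pi>\<^sub>E j\<in>J. carrier (F j))" "j \<notin> J" for v j
    using that by auto
  show ?thesis
  proof (intro right_module.intro A abelian_groupI right_module_axioms.intro;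
      simp add: carrier_dprod zero_dprod add_dprod ract_dprod)
    fix v assume v: "v \<in> (\<Pi>\<^sub>E j\<in>J. carrier (F j))"
    show "\<exists>w\<in>\<Pi>\<^sub>E j\<in>J. carrier (F j). (\<lambda>j\<in>J. w j \<oplus>\<^bsub>F j\<^esub> v j) = (\<lambda>j\<in>J. \<zero>\<^bsub>F j\<^esub>)"
      by (intro bexI[of _ "\<lambda>j\<in>J. \<ominus>\<^bsub>F j\<^esub> v j"] restrict_ext PiE_I)
        (auto simp: abelian_group.l_neg[OF F'] abelian_group.a_inv_closed[OF F'] mem[OF v])
  qed (auto simp: abelian_monoid.a_assoc[OF abelian_group.axioms(1)[OF F']]
      abelian_monoid.a_comm[OF abelian_group.axioms(1)[OF F']]
      abelian_monoid.a_lcomm[OF abelian_group.axioms(1)[OF F']]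
      right_module.ract_add_left[OF F] right_module.ract_add_right[OF F]
      right_module.ract_mult[OF F] right_module.ract_one[OF F] ring.ring_simprules[OF A] fun_eq_iff)
qed

lemma submod_dsum:
  assumes A: "ring A" and F: "\<And>j. j \<in> J \<Longrightarrow> right_module A (F j)"
  shows "submod A (dprod J F) {v \<in> \<Pi>\<^sub>E j\<in>J. carrier (F j). finite (supp J F v)}"
proof -
  interpret P: right_module A "dprod J F" by (rule right_module_dprod[OF A F])
  have F': "abelian_group (F j)" if "j \<in> J" for j using F[OF that] by (rule right_module_abelian)
  note [simp] = abelian_monoid.zero_closed[OF abelian_group.axioms(1)[OF F']]
    abelian_monoid.l_zero[OF abelian_group.axioms(1)[OF F']]
  show ?thesis
  proof (rule submodI[OF P.right_module_axioms])
    show "{v \<in> \<Pi>\<^sub>E j\<in>J. carrier (F j). finite (supp J F v)} \<subseteq> carrier (dprod J F)"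
      by (auto simp: carrier_dprod)
    show "\<zero>\<^bsub>dprod J F\<^esub> \<in> {v \<in> \<Pi>\<^sub>E j\<in>J. carrier (F j). finite (supp J F v)}"
      using P.zero_closed unfolding carrier_dprod by (simp add: supp_def zero_dprod cong: conj_cong)
  next
    fix v w assume v: "v \<in> {v \<in> \<Pi>\<^sub>E j\<in>J. carrier (F j). finite (supp J F v)}"
      and w: "w \<in> {v \<in> \<Pi>\<^sub>E j\<in>J. carrier (F j). finite (supp J F v)}"
    have "supp J F (v \<oplus>\<^bsub>dprod J F\<^esub> w) \<subseteq> supp J F v \<union> supp J F w"
      by (auto simp: supp_def add_dprod)
    then show "v \<oplus>\<^bsub>dprod J F\<^esub> w \<in> {v \<in> \<Pi>\<^sub>E j\<in>J. carrier (F j). finite (supp J F v)}"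
      using v w P.a_closed[of v w] unfolding carrier_dprod by (auto intro: finite_subset)
  next
    fix v a assume v: "v \<in> {v \<in> \<Pi>\<^sub>E j\<in>J. carrier (F j). finite (supp J F v)}"
      and a: "a \<in> carrier A"
    have "supp J F (v \<triangleleft>\<^bsub>dprod J F\<^esub> a) \<subseteq> supp J F v"
      using a by (auto simp: supp_def ract_dprod right_module.ract_zero_left[OF F])
    then show "v \<triangleleft>\<^bsub>dprod J F\<^esub> a \<in> {v \<in> \<Pi>\<^sub>E j\<in>J. carrier (F j). finite (supp J F v)}"
      using v P.ract_closed[of v a] a unfolding carrier_dprod by (auto intro: finite_subset)
  qed
qed

lemma right_module_dsum:
  assumes "ring A" "\<And>j. j \<in> J \<Longrightarrow> right_module A (F j)"
  shows "right_module A (dsum J F)"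
  unfolding dsum_def by (rule right_module_sub[OF submod_dsum[OF assms]])

lemma lin_dprod_proj:
  assumes A: "ring A" and F: "\<And>j. j \<in> J \<Longrightarrow> right_module A (F j)" and j: "j \<in> J"
  shows "lin A (dprod J F) (F j) (\<lambda>v. v j)"
  by (rule linI[OF right_module_dprod[OF A F] F[OF j]])
    (auto simp: carrier_dprod add_dprod ract_dprod j)

lemma lin_dsum_proj:
  assumes A: "ring A" and F: "\<And>j. j \<in> J \<Longrightarrow> right_module A (F j)" and j: "j \<in> J"
  shows "lin A (dsum J F) (F j) (\<lambda>v. v j)"
  by (rule linI[OF right_module_dsum[OF A F] F[OF j]])
    (auto simp: carrier_dsum add_dsum ract_dsum j)

lemma lin_dprod_tuple:
  assumes A: "ring A" and N: "right_module A N" and g: "\<And>j. j \<in> J \<Longrightarrow> lin A N (F j) (g j)"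
  shows "lin A N (dprod J F) (\<lambda>x. \<lambda>j\<in>J. g j x)"
  by (rule linI[OF N right_module_dprod[OF A lin_cod[OF g]]])
    (auto simp: carrier_dprod add_dprod ract_dprod lin_closed[OF g] lin_add[OF g] lin_ract[OF g])

lemma lin_dsum_tuple:
  assumes A: "ring A" and N: "right_module A N" and g: "\<And>j. j \<in> J \<Longrightarrow> lin A N (F j) (g j)"
    and fin: "\<And>x. x \<in> carrier N \<Longrightarrow> finite {j \<in> J. g j x \<noteq> \<zero>\<^bsub>F j\<^esub>}"
  shows "lin A N (dsum J F) (\<lambda>x. \<lambda>j\<in>J. g j x)"
  unfolding dsum_def
  by (rule lin_into_sub[OF lin_dprod_tuple[OF A N g] submod_dsum[OF A lin_cod[OF g]]])
    (auto simp: lin_closed[OF g] supp_def fin cong: conj_cong)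

definition single :: "'i set \<Rightarrow> ('i \<Rightarrow> ('a, 'm) rmodule) \<Rightarrow> 'i \<Rightarrow> 'm \<Rightarrow> 'i \<Rightarrow> 'm" where
  "single J F j x = (\<lambda>i\<in>J. if i = j then x else \<zero>\<^bsub>F i\<^esub>)"

lemma lin_single:
  assumes A: "ring A" and F: "\<And>j. j \<in> J \<Longrightarrow> right_module A (F j)" and j: "j \<in> J"
  shows "lin A (F j) (dsum J F) (single J F j)"
proof -
  have g: "lin A (F j) (F i) (\<lambda>x. if i = j then x else \<zero>\<^bsub>F i\<^esub>)" if "i \<in> J" for i
    using lin_id[OF F[OF j]] lin_const_zero[OF F[OF j] F[OF that]] by (cases "i = j") auto
  have fin: "finite {i \<in> J. (if i = j then x else \<zero>\<^bsub>F i\<^esub>) \<noteq> \<zero>\<^bsub>F i\<^esub>}" for x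
    by (rule finite_subset[of _ "{j}"]) auto
  show ?thesis
    using lin_dsum_tuple[where g = "\<lambda>i x. if i = j then x else \<zero>\<^bsub>F i\<^esub>", OF A F[OF j] g fin]
    by (simp add: single_def[abs_def])
qed

text \<open>Induction on a finite set that contains the support, splitting off one coordinate at a
  time. Applied to an equalizer, it says that maps out of a direct sum are determined on the
  summands.\<close>

lemma dsum_span:
  assumes A: "ring A" and F: "\<And>j. j \<in> J \<Longrightarrow> right_module A (F j)"
    and S: "submod A (dsum J F) S"
    and single: "\<And>j x. j \<in> J \<Longrightarrow> x \<in> carrier (F j) \<Longrightarrow> single J F j x \<in> S"
    and v: "v \<in> carrier (dsum J F)"
  shows "v \<in> S"
proof -
  have F': "abelian_group (F j)" if "j \<in> J" for j using F[OF that] by (rule right_module_abelian)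
  note [simp] = abelian_monoid.zero_closed[OF abelian_group.axioms(1)[OF F']]
    abelian_monoid.l_zero[OF abelian_group.axioms(1)[OF F']]
    abelian_monoid.r_zero[OF abelian_group.axioms(1)[OF F']]
  have "v \<in> S" if "finite B" "supp J F v \<subseteq> B" "v \<in> carrier (dsum J F)" for B v
    using that
  proof (induction B arbitrary: v)
    case empty
    then have "v = \<zero>\<^bsub>dsum J F\<^esub>"
      by (auto simp: supp_def zero_dsum carrier_dsum intro!: PiE_ext[of _ J "\<lambda>j. carrier (F j)"])
    then show ?case using submod_zero[OF S] by simp
  next
    case (insert j B)
    show ?case
    proof (cases "j \<in> J")
      case False
      then have "supp J F v \<subseteq> B" using insert.prems by (auto simp: supp_def)
      then show ?thesis using insert by blast
    next
      case j: True
      let ?w = "v(j := \<zero>\<^bsub>F j\<^esub>)"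
      have v: "v \<in> (\<Pi>\<^sub>E j\<in>J. carrier (F j))" "finite (supp J F v)"
        using insert.prems by (auto simp: carrier_dsum)
      have w: "supp J F ?w \<subseteq> B" "supp J F ?w \<subseteq> supp J F v"
        using insert.prems by (auto simp: supp_def)
      have "?w \<in> (\<Pi>\<^sub>E j\<in>J. carrier (F j))" using v j by (auto simp: PiE_iff extensional_def)
      then have "?w \<in> carrier (dsum J F)"
        using finite_subset[OF w(2) v(2)] by (simp add: carrier_dsum)
      then have "?w \<in> S" using insert.IH w(1) by blast
      moreover have "v = single J F j (v j) \<oplus>\<^bsub>dsum J F\<^esub> ?w"
      proof
        fix i
        have "v i \<in> carrier (F i)" if "i \<in> J" using v(1) that by blast
        moreover have "v i = undefined" if "i \<notin> J" using v(1) that by (rule PiE_arb)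
        ultimately show "v i = (single J F j (v j) \<oplus>\<^bsub>dsum J F\<^esub> ?w) i"
          by (cases "i \<in> J"; cases "i = j") (simp_all add: add_dsum single_def)
      qed
      ultimately show ?thesis
        using submod_add[OF S single[OF j PiE_mem[OF v(1) j]]] by metis
    qed
  qed
  then show ?thesis using v by (auto simp: carrier_dsum)
qed

text \<open>The homomorphism out of the direct sum induced by the family \<open>g\<close>. The sum
  runs over the support because \<open>J\<close> may be infinite.\<close>

definition total :: "'i set \<Rightarrow> ('i \<Rightarrow> ('a, 'm) rmodule) \<Rightarrow> ('a, 'n) rmodule \<Rightarrow>
    ('i \<Rightarrow> 'm \<Rightarrow> 'n) \<Rightarrow> ('i \<Rightarrow> 'm) \<Rightarrow> 'n" where
  "total J F N g v = (\<Oplus>\<^bsub>N\<^esub>j\<in>supp J F v. g j (v j))"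

text \<open>Different vectors have different supports; padding with zeros makes their sums
  comparable over one index set.\<close>

lemma total_superset:
  assumes N: "right_module A N" and g: "\<And>j. j \<in> J \<Longrightarrow> lin A (F j) N (g j)"
    and v: "v \<in> carrier (dsum J F)" and B: "finite B" "supp J F v \<subseteq> B" "B \<subseteq> J"
  shows "total J F N g v = (\<Oplus>\<^bsub>N\<^esub>j\<in>B. g j (v j))"
proof -
  interpret N: right_module A N by fact
  have "(\<Oplus>\<^bsub>N\<^esub>j\<in>supp J F v. g j (v j)) = (\<Oplus>\<^bsub>N\<^esub>j\<in>B. g j (v j))"
  proof (rule N.add.finprod_mono_neutral_cong_left)
    show "g j (v j) = \<zero>\<^bsub>N\<^esub>" if "j \<in> B - supp J F v" for j
      using that B lin_zero[OF g, of j] by (auto simp: supp_def)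
    show "(\<lambda>j. g j (v j)) \<in> B \<rightarrow> carrier N"
      using v B by (auto simp: carrier_dsum subset_iff intro!: lin_closed[OF g])
  qed (use B in auto)
  then show ?thesis by (simp add: total_def)
qed

lemma lin_total:
  fixes J :: "'i set"
  assumes A: "ring A" and N: "right_module A N"
    and g: "\<And>j. j \<in> J \<Longrightarrow> lin A (F j) N (g j)"
  shows "lin A (dsum J F) N (total J F N g)"
proof (rule linI)
  interpret N: right_module A N by fact
  have F: "right_module A (F j)" if "j \<in> J" for j using lin_dom[OF g[OF that]] .
  interpret D: right_module A "dsum J F" by (rule right_module_dsum[OF A F])
  show "right_module A (dsum J F)" "right_module A N" by unfold_locales
  have fin: "finite (supp J F v)" if "v \<in> carrier (dsum J F)" for v
    using that by (simp add: carrier_dsum)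
  have mem: "v j \<in> carrier (F j)" if "v \<in> carrier (dsum J F)" "j \<in> J" for v j
    using that by (auto simp: carrier_dsum)
  fix v assume v: "v \<in> carrier (dsum J F)"
  show "total J F N g v \<in> carrier N"
    unfolding total_def by (rule N.add.finprod_closed) (auto simp: supp_def intro!: lin_closed[OF g] mem[OF v])
  {
    fix w assume w: "w \<in> carrier (dsum J F)"
    \<comment> \<open>One finite set containing all three supports, so that no relation between them
      has to be established.\<close>
    let ?B = "supp J F v \<union> supp J F w \<union> supp J F (v \<oplus>\<^bsub>dsum J F\<^esub> w)"
    have B: "finite ?B" "?B \<subseteq> J" using fin v w D.a_closed by (auto simp: supp_def)
    have "total J F N g (v \<oplus>\<^bsub>dsum J F\<^esub> w) = (\<Oplus>\<^bsub>N\<^esub>j\<in>?B. g j (v j) \<oplus>\<^bsub>N\<^esub> g j (w j))"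
      using B v w
      by (subst total_superset[where B = ?B, OF N g D.a_closed[OF v w]])
        (auto simp: add_dsum subset_iff mem lin_add[OF g] intro!: N.add.finprod_cong' lin_closed[OF g])
    also have "\<dots> = (\<Oplus>\<^bsub>N\<^esub>j\<in>?B. g j (v j)) \<oplus>\<^bsub>N\<^esub> (\<Oplus>\<^bsub>N\<^esub>j\<in>?B. g j (w j))"
      using B v w by (intro N.add.finprod_multf) (auto simp: subset_iff intro!: lin_closed[OF g] mem)
    also have "(\<Oplus>\<^bsub>N\<^esub>j\<in>?B. g j (v j)) = total J F N g v"
      by (rule total_superset[symmetric, OF N g v B(1) _ B(2)]) auto
    also have "(\<Oplus>\<^bsub>N\<^esub>j\<in>?B. g j (w j)) = total J F N g w"
      by (rule total_superset[symmetric, OF N g w B(1) _ B(2)]) auto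
    finally show "total J F N g (v \<oplus>\<^bsub>dsum J F\<^esub> w) = total J F N g v \<oplus>\<^bsub>N\<^esub> total J F N g w" .
  }
  fix a assume a: "a \<in> carrier A"
  have B: "supp J F (v \<triangleleft>\<^bsub>dsum J F\<^esub> a) \<subseteq> supp J F v"
    using a by (auto simp: supp_def ract_dsum right_module.ract_zero_left[OF F])
  have z: "\<zero>\<^bsub>F j\<^esub> \<triangleleft>\<^bsub>F j\<^esub> a = \<zero>\<^bsub>F j\<^esub>" if "j \<in> J" for j
    by (rule right_module.ract_zero_left[OF F[OF that] a])
  have ract_sum: "(\<Oplus>\<^bsub>N\<^esub>j\<in>B. h j) \<triangleleft>\<^bsub>N\<^esub> a = (\<Oplus>\<^bsub>N\<^esub>j\<in>B. h j \<triangleleft>\<^bsub>N\<^esub> a)"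
    if "finite B" "h \<in> B \<rightarrow> carrier N" for h and B :: "'i set"
    using that
    by (induction B) (auto simp: N.ract_zero_left a N.ract_add_left N.ract_closed Pi_iff)
  have "total J F N g (v \<triangleleft>\<^bsub>dsum J F\<^esub> a) = (\<Oplus>\<^bsub>N\<^esub>j\<in>supp J F v. g j (v j) \<triangleleft>\<^bsub>N\<^esub> a)"
    using a v
    by (subst total_superset[where B = "supp J F v", OF N g D.ract_closed[OF v a]])
      (auto simp: fin[unfolded supp_def] z ract_dsum supp_def mem lin_ract[OF g]
        intro!: N.add.finprod_cong' lin_closed[OF g] N.ract_closed)
  also have "\<dots> = total J F N g v \<triangleleft>\<^bsub>N\<^esub> a"
    unfolding total_def
    by (rule ract_sum[OF fin[OF v], symmetric]) (auto simp: supp_def intro!: lin_closed[OF g] mem[OF v])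
  finally show "total J F N g (v \<triangleleft>\<^bsub>dsum J F\<^esub> a) = total J F N g v \<triangleleft>\<^bsub>N\<^esub> a" .
qed

lemma total_single:
  assumes A: "ring A" and N: "right_module A N"
    and g: "\<And>j. j \<in> J \<Longrightarrow> lin A (F j) N (g j)" and j: "j \<in> J" and x: "x \<in> carrier (F j)"
  shows "total J F N g (single J F j x) = g j x"
proof -
  interpret N: right_module A N by fact
  have s: "single J F j x \<in> carrier (dsum J F)"
    using lin_closed[OF lin_single[where F = F, OF A lin_dom[OF g] j] x] by simp
  have "total J F N g (single J F j x) = (\<Oplus>\<^bsub>N\<^esub>i\<in>{j}. g i (single J F j x i))"
    by (rule total_superset[OF N g s]) (auto simp: supp_def single_def j split: if_splits)
  then show ?thesis
    using j x lin_closed[OF g[OF j] x] by (simp add: single_def)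
qed

section \<open>Free and projective modules\<close>

definition reg :: "('a, 'r) ring_scheme \<Rightarrow> ('a, 'a) rmodule" where
  "reg A = \<lparr>carrier = carrier A, mult = undefined, one = undefined, zero = \<zero>\<^bsub>A\<^esub>,
     add = (\<lambda>x y. x \<oplus>\<^bsub>A\<^esub> y), ract = (\<lambda>x a. x \<otimes>\<^bsub>A\<^esub> a)\<rparr>"

lemma carrier_reg: "carrier (reg A) = carrier A"
  and zero_reg: "\<zero>\<^bsub>reg A\<^esub> = \<zero>\<^bsub>A\<^esub>"
  and add_reg: "x \<oplus>\<^bsub>reg A\<^esub> y = x \<oplus>\<^bsub>A\<^esub> y"
  and ract_reg: "x \<triangleleft>\<^bsub>reg A\<^esub> a = x \<otimes>\<^bsub>A\<^esub> a"
  by (simp_all add: reg_def)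

lemma right_module_reg: assumes "ring A" shows "right_module A (reg A)"
proof -
  interpret R: ring A by fact
  show ?thesis
  proof (intro right_module.intro assms abelian_groupI right_module_axioms.intro)
    fix x assume "x \<in> carrier (reg A)"
    then show "\<exists>y\<in>carrier (reg A). y \<oplus>\<^bsub>reg A\<^esub> x = \<zero>\<^bsub>reg A\<^esub>"
      by (intro bexI[of _ "\<ominus>\<^bsub>A\<^esub> x"]) (auto simp: carrier_reg zero_reg add_reg R.l_neg)
  qed (auto simp: carrier_reg zero_reg add_reg ract_reg R.a_ac R.l_distr R.r_distr R.m_assoc)
qed

abbreviation free :: "('a, 'r) ring_scheme \<Rightarrow> 'i set \<Rightarrow> ('a, 'i \<Rightarrow> 'a) rmodule" where
  "free A J \<equiv> dsum J (\<lambda>_. reg A)"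

abbreviation unit_vec :: "('a, 'r) ring_scheme \<Rightarrow> 'i set \<Rightarrow> 'i \<Rightarrow> 'i \<Rightarrow> 'a" where
  "unit_vec A J j \<equiv> single J (\<lambda>_. reg A) j \<one>\<^bsub>A\<^esub>"

text \<open>On a finite index set the support condition is vacuous, so the direct sum is the whole
  function space.\<close>

lemma free_rmodule_eq: "free_rmodule A n = free A {..<n}"
  by (simp add: free_rmodule_def dsum_def dprod_def reg_def supp_def)

lemma right_module_free: "ring A \<Longrightarrow> right_module A (free A J)"
  by (simp add: right_module_dsum right_module_reg)

lemma unit_vec_closed:
  assumes "ring A" "j \<in> J" shows "unit_vec A J j \<in> carrier (free A J)"
proof -
  interpret R: ring A by fact
  show ?thesis
    by (rule lin_closed[OF lin_single[OF assms(1) right_module_reg[OF assms(1)] assms(2)]])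
      (simp add: carrier_reg)
qed

lemma free_span:
  assumes A: "ring A" and S: "submod A (free A J) S"
    and unit: "\<And>j. j \<in> J \<Longrightarrow> unit_vec A J j \<in> S"
    and v: "v \<in> carrier (free A J)"
  shows "v \<in> S"
proof (rule dsum_span[OF A right_module_reg[OF A] S _ v])
  interpret R: ring A by fact
  fix j a assume j: "j \<in> J" and a: "a \<in> carrier (reg A)"
  then have a: "a \<in> carrier A" by (simp add: carrier_reg)
  have "unit_vec A J j \<triangleleft>\<^bsub>free A J\<^esub> a = single J (\<lambda>_. reg A) j a"
    using a by (auto simp: single_def ract_dsum ract_reg zero_reg)
  then show "single J (\<lambda>_. reg A) j a \<in> S"
    using submod_ract[OF S unit[OF j] a] by simp
qed

lemma lin_generator:
  assumes "right_module A M" "x \<in> carrier M"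
  shows "lin A (reg A) M (\<lambda>a. x \<triangleleft>\<^bsub>M\<^esub> a)"
proof -
  interpret M: right_module A M by fact
  show ?thesis
    using assms by (intro linI right_module_reg M.A.ring_axioms)
      (auto simp: carrier_reg add_reg ract_reg M.ract_closed M.ract_add_right M.ract_mult)
qed

definition free_map :: "('a, 'r) ring_scheme \<Rightarrow> 'i set \<Rightarrow> ('a, 'm) rmodule \<Rightarrow>
    ('i \<Rightarrow> 'm) \<Rightarrow> ('i \<Rightarrow> 'a) \<Rightarrow> 'm" where
  "free_map A J M x = total J (\<lambda>_. reg A) M (\<lambda>j a. x j \<triangleleft>\<^bsub>M\<^esub> a)"

lemma lin_free_map:
  assumes "right_module A M" "\<And>j. j \<in> J \<Longrightarrow> x j \<in> carrier M"
  shows "lin A (free A J) M (free_map A J M x)"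
  unfolding free_map_def
  by (rule lin_total[OF right_module_ring[OF assms(1)] assms(1) lin_generator[OF assms]])

lemma free_map_unit:
  assumes "right_module A M" "\<And>j. j \<in> J \<Longrightarrow> x j \<in> carrier M" "j \<in> J"
  shows "free_map A J M x (unit_vec A J j) = x j"
proof -
  interpret M: right_module A M by fact
  show ?thesis
    unfolding free_map_def
    using total_single[where g = "\<lambda>j a. x j \<triangleleft>\<^bsub>M\<^esub> a" and F = "\<lambda>_. reg A",
        OF right_module_ring[OF assms(1)] assms(1) lin_generator[OF assms(1,2)] assms(3), of "\<one>\<^bsub>A\<^esub>"]
    by (simp add: carrier_reg M.ract_one assms)
qed

lemma free_lin_eqI:
  assumes f: "lin A (free A J) M f" and g: "lin A (free A J) M g"
    and unit: "\<And>j. j \<in> J \<Longrightarrow> f (unit_vec A J j) = g (unit_vec A J j)"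
    and v: "v \<in> carrier (free A J)"
  shows "f v = g v"
proof -
  have A: "ring A" by (rule right_module_ring[OF lin_dom[OF f]])
  have "v \<in> {v \<in> carrier (free A J). f v = g v}"
    by (rule free_span[OF A submod_equalizer[OF f g] _ v]) (simp add: unit unit_vec_closed[OF A])
  then show ?thesis by simp
qed

lemma image_compose_retraction:
  assumes c: "lin A M N c" and d: "lin A N M d" and dc: "\<And>x. x \<in> carrier M \<Longrightarrow> d (c x) = x"
    and f: "f ` carrier M = T"
  shows "(\<lambda>y. f (d y)) ` carrier N = T"
  unfolding f[symmetric]
proof
  show "(\<lambda>y. f (d y)) ` carrier N \<subseteq> f ` carrier M" using lin_closed[OF d] by blast
  have "f x \<in> (\<lambda>y. f (d y)) ` carrier N" if "x \<in> carrier M" for x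
    by (rule image_eqI[OF _ lin_closed[OF c that]]) (simp add: dc that)
  then show "f ` carrier M \<subseteq> (\<lambda>y. f (d y)) ` carrier N" by (rule image_subsetI)
qed

lemma free_map_surj:
  assumes "right_module A M"
  shows "free_map A (carrier M) M (\<lambda>x. x) ` carrier (free A (carrier M)) = carrier M"
proof
  show "free_map A (carrier M) M (\<lambda>x. x) ` carrier (free A (carrier M)) \<subseteq> carrier M"
    by (rule image_subsetI, rule lin_closed[OF lin_free_map[OF assms]])
  show "carrier M \<subseteq> free_map A (carrier M) M (\<lambda>x. x) ` carrier (free A (carrier M))"
  proof
    fix x assume x: "x \<in> carrier M"
    show "x \<in> free_map A (carrier M) M (\<lambda>x. x) ` carrier (free A (carrier M))"
      by (rule image_eqI[OF _ unit_vec_closed[OF right_module_ring[OF assms] x]])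
        (simp add: free_map_unit[OF assms _ x])
  qed
qed

section \<open>Projective modules and enough projectives\<close>

lemma projectiveI:
  fixes P :: "('a, 'm) rmodule"
  assumes P: "right_module A P"
    and lift: "\<And>(M :: ('a, 'm) rmodule) (N :: ('a, 'm) rmodule) p f. M \<in> Mod_cat A \<Longrightarrow> N \<in> Mod_cat A \<Longrightarrow>
      lin A M N p \<Longrightarrow> p ` carrier M = carrier N \<Longrightarrow> lin A P N f \<Longrightarrow>
      \<exists>g. lin A P M g \<and> (\<forall>x\<in>carrier P. p (g x) = f x)"
  shows "projective A P"
  unfolding projective_def
proof (intro ballI impI)
  fix M N :: "('a, 'm) rmodule" and p f
  assume M: "M \<in> Mod_cat A" and N: "N \<in> Mod_cat A" and p: "p \<in> mod_hom A M N"
    and f: "f \<in> mod_hom A P N" and surj: "p ` carrier M = carrier N"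
  obtain g where g: "lin A P M g" "\<forall>x\<in>carrier P. p (g x) = f x"
    using lift[OF M N mod_hom_lin[OF Mod_catD[OF M] Mod_catD[OF N] p] surj
        mod_hom_lin[OF P Mod_catD[OF N] f]] by blast
  have "compose (carrier P) p (restrict g (carrier P)) = f"
    using g(2) mod_hom_extensional[OF f]
    by (intro ext) (simp add: compose_def extensional_def)
  then show "\<exists>g\<in>mod_hom A P M. compose (carrier P) p g = f"
    using lin_restrict[OF g(1)] by blast
qed

lemma projectiveD:
  fixes P M N :: "('a, 'm) rmodule"
  assumes P: "projective A P" and M: "M \<in> Mod_cat A" and N: "N \<in> Mod_cat A"
    and p: "lin A M N p" and surj: "p ` carrier M = carrier N" and f: "lin A P N f"
  obtains g where "lin A P M g" "\<And>x. x \<in> carrier P \<Longrightarrow> p (g x) = f x"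
proof -
  have "restrict p (carrier M) ` carrier M = carrier N" using surj by simp
  then obtain g where g: "g \<in> mod_hom A P M"
    "compose (carrier P) (restrict p (carrier M)) g = restrict f (carrier P)"
    using P lin_restrict[OF p] lin_restrict[OF f] M N unfolding projective_def by blast
  have g': "lin A P M g" using mod_hom_lin[OF lin_dom[OF f] Mod_catD[OF M] g(1)] .
  have "p (g x) = f x" if "x \<in> carrier P" for x
    using fun_cong[OF g(2), of x] that lin_closed[OF g' that] by (simp add: compose_def)
  with g' that show thesis by blast
qed

locale ring_universe = universe U for U :: "'m itself" +
  fixes A :: "('a, 'r) ring_scheme"
  assumes ring: "ring A" and small_ring: "small U (carrier A)"
begin

lemma dprod_small:
  fixes F :: "'i \<Rightarrow> ('a, 'x) rmodule"
  assumes "small U J" "\<And>j. j \<in> J \<Longrightarrow> carrier (F j) \<subseteq> T" "small U T"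
  shows "small U (carrier (dprod J F))"
  unfolding carrier_dprod using assms by (rule PiE_small)

lemma dsum_small:
  fixes F :: "'i \<Rightarrow> ('a, 'x) rmodule"
  assumes "small U J" "\<And>j. j \<in> J \<Longrightarrow> carrier (F j) \<subseteq> T" "small U T"
  shows "small U (carrier (dsum J F))"
  by (rule small_subset[OF dprod_small[OF assms]]) (auto simp: carrier_dprod carrier_dsum)

lemma Mod_cat_small: "M \<in> Mod_cat A \<Longrightarrow> small U (carrier (M :: ('a, 'm) rmodule))"
  by (simp add: Mod_cat_def small_def)

lemma free_small: "small U J \<Longrightarrow> small U (carrier (free A J))"
  by (rule dsum_small[where T = "carrier A"]) (auto simp: carrier_reg small_ring)

text \<open>Projectivity is a property of modules on \<open>'m\<close>, hence the copy. A lift is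
  obtained by choosing preimages of the images of the unit vectors.\<close>

lemma free_copy_exists:
  fixes J :: "'i set"
  assumes J: "small U J"
  obtains F :: "('a, 'm) rmodule" and c d where "F \<in> Mod_cat A" "projective A F"
    "lin A (free A J) F c" "lin A F (free A J) d"
    "\<And>x. x \<in> carrier (free A J) \<Longrightarrow> d (c x) = x" "\<And>y. y \<in> carrier F \<Longrightarrow> c (d y) = y"
proof -
  obtain F :: "('a, 'm) rmodule" and c d where F: "F \<in> Mod_cat A"
    and c: "lin A (free A J) F c" and d: "lin A F (free A J) d"
    and dc: "\<And>x. x \<in> carrier (free A J) \<Longrightarrow> d (c x) = x" and cd: "\<And>y. y \<in> carrier F \<Longrightarrow> c (d y) = y"
    using copy_exists[OF right_module_free[OF ring] free_small[OF J]] by blast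
  have "projective A F"
  proof (rule projectiveI[OF Mod_catD[OF F]])
    fix M N :: "('a, 'm) rmodule" and p f
    assume M: "M \<in> Mod_cat A" and p: "lin A M N p" "p ` carrier M = carrier N" and f: "lin A F N f"
    have "\<forall>j\<in>J. \<exists>x\<in>carrier M. p x = f (c (unit_vec A J j))"
    proof
      fix j assume "j \<in> J"
      then have "f (c (unit_vec A J j)) \<in> p ` carrier M"
        using lin_closed[OF f lin_closed[OF c unit_vec_closed[OF ring]]] p(2) by simp
      then show "\<exists>x\<in>carrier M. p x = f (c (unit_vec A J j))" by (metis imageE)
    qed
    from bchoice[OF this[unfolded Bex_def]]
    obtain x where xp: "\<forall>j\<in>J. x j \<in> carrier M \<and> p (x j) = f (c (unit_vec A J j))" ..
    have x: "\<And>j. j \<in> J \<Longrightarrow> x j \<in> carrier M"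
      "\<And>j. j \<in> J \<Longrightarrow> p (x j) = f (c (unit_vec A J j))"
      using xp by simp_all
    have m: "lin A (free A J) M (free_map A J M x)"
      by (rule lin_free_map[OF Mod_catD[OF M] x(1)])
    have eq: "p (free_map A J M x v) = f (c v)" if "v \<in> carrier (free A J)" for v
      by (rule free_lin_eqI[OF lin_compose[OF m p(1)] lin_compose[OF c f] _ that])
        (simp add: free_map_unit[OF Mod_catD[OF M]] x)
    show "\<exists>g. lin A F M g \<and> (\<forall>x\<in>carrier F. p (g x) = f x)"
      by (rule exI[of _ "\<lambda>y. free_map A J M x (d y)"])
        (auto simp: lin_compose[OF d m] eq[OF lin_closed[OF d]] cd)
  qed
  with F c d dc cd that show thesis by blast
qed

lemma enough_projectives:
  fixes X :: "('a, 'm) rmodule"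
  assumes X: "X \<in> Mod_cat A"
  obtains P :: "('a, 'm) rmodule" and f where "P \<in> Mod_cat A" "projective A P" "lin A P X f"
    "f ` carrier P = carrier X"
proof -
  obtain F :: "('a, 'm) rmodule" and c d where F: "F \<in> Mod_cat A" "projective A F"
    and c: "lin A (free A (carrier X)) F c" and d: "lin A F (free A (carrier X)) d"
    and dc: "\<And>x. x \<in> carrier (free A (carrier X)) \<Longrightarrow> d (c x) = x" and "\<And>y. y \<in> carrier F \<Longrightarrow> c (d y) = y"
    using free_copy_exists[OF Mod_cat_small[OF X]] by blast
  let ?m = "free_map A (carrier X) X (\<lambda>x. x)"
  have m: "lin A (free A (carrier X)) X ?m" by (rule lin_free_map[OF Mod_catD[OF X]])
  have "(\<lambda>y. ?m (d y)) ` carrier F = carrier X"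
    by (rule image_compose_retraction[OF c d dc free_map_surj[OF Mod_catD[OF X]]])
  with F lin_compose[OF d m] that show thesis by blast
qed

end

section \<open>Unique extension along projective presentations\<close>

text \<open>Bijectivity of the restriction from \<open>Hom(P, Y)\<close> to
  \<open>Hom(Q, Y)\<close>. For projective \<open>P\<close>, surjectivity is the vanishing of Ext in
  degree 1 of \<open>P / Q\<close> with values in \<open>Y\<close>, and injectivity is the vanishing
  of Hom. The target may have another element type, so direct sums and products can be treated
  before they are copied into \<open>'m\<close>.\<close>

definition unique_ext :: "('a, 'r) ring_scheme \<Rightarrow> ('a, 'm) rmodule \<Rightarrow> 'm set \<Rightarrow> ('a, 'n) rmodule \<Rightarrow> bool" where
  "unique_ext A P Q Y \<longleftrightarrow>
     (\<forall>g. lin A (sub P Q) Y g \<longrightarrow> (\<exists>h. lin A P Y h \<and> (\<forall>x\<in>Q. h x = g x))) \<and>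
     (\<forall>h. lin A P Y h \<longrightarrow> (\<forall>x\<in>Q. h x = \<zero>\<^bsub>Y\<^esub>) \<longrightarrow> (\<forall>x\<in>carrier P. h x = \<zero>\<^bsub>Y\<^esub>))"

lemma unique_extI:
  assumes "\<And>g. lin A (sub P Q) Y g \<Longrightarrow> \<exists>h. lin A P Y h \<and> (\<forall>x\<in>Q. h x = g x)"
    and "\<And>h x. lin A P Y h \<Longrightarrow> (\<And>x. x \<in> Q \<Longrightarrow> h x = \<zero>\<^bsub>Y\<^esub>) \<Longrightarrow> x \<in> carrier P \<Longrightarrow> h x = \<zero>\<^bsub>Y\<^esub>"
  shows "unique_ext A P Q Y"
  using assms unfolding unique_ext_def by blast

lemma unique_ext_exists:
  assumes "unique_ext A P Q Y" "lin A (sub P Q) Y g"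
  obtains h where "lin A P Y h" "\<And>x. x \<in> Q \<Longrightarrow> h x = g x"
  using assms unfolding unique_ext_def by blast

lemma unique_ext_zero:
  assumes "unique_ext A P Q Y" "lin A P Y h" "\<And>x. x \<in> Q \<Longrightarrow> h x = \<zero>\<^bsub>Y\<^esub>" "x \<in> carrier P"
  shows "h x = \<zero>\<^bsub>Y\<^esub>"
  using assms unfolding unique_ext_def by blast

lemma unique_ext_eq:
  assumes ue: "unique_ext A P Q Y" and h: "lin A P Y h" and k: "lin A P Y k"
    and eq: "\<And>x. x \<in> Q \<Longrightarrow> h x = k x" and Q: "Q \<subseteq> carrier P" and x: "x \<in> carrier P"
  shows "h x = k x"
proof -
  have "h x \<ominus>\<^bsub>Y\<^esub> k x = \<zero>\<^bsub>Y\<^esub>"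
    using unique_ext_zero[OF ue lin_diff[OF h k] _ x] eq Q lin_closed[OF k]
    by (metis lin_cod[OF h] minus_eq_zero_iff subset_iff)
  then show ?thesis
    using minus_eq_zero_iff[OF lin_cod[OF h]] lin_closed[OF h x] lin_closed[OF k x] by blast
qed

definition presents :: "('a, 'r) ring_scheme \<Rightarrow> ('a, 'm) rmodule \<Rightarrow> ('m \<Rightarrow> 'm) \<Rightarrow> ('a, 'm) rmodule \<Rightarrow> bool" where
  "presents A P f X \<longleftrightarrow> P \<in> Mod_cat A \<and> X \<in> Mod_cat A \<and> projective A P \<and> lin A P X f \<and>
     f ` carrier P = carrier X"

lemma presents_lift:
  assumes P: "presents A P f X" and P': "presents A P' f' X"
  obtains \<alpha> where "lin A P P' \<alpha>" "\<And>x. x \<in> carrier P \<Longrightarrow> f' (\<alpha> x) = f x"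
  using P P' projectiveD[of A P P' X f' f] unfolding presents_def by blast

text \<open>The definition of \<open>Ext\<close> fixes an unspecified resolution, so the criterion
  must not depend on the presentation. Two presentations are compared by lifts
  \<open>\<alpha>\<close> and \<open>\<beta>\<close> of the identity of \<open>X\<close>.\<close>

lemma unique_ext_presentation:
  assumes P: "presents A P f X" and P': "presents A P' f' X"
    and ue: "unique_ext A P (hom_kernel P X f) Y"
  shows "unique_ext A P' (hom_kernel P' X f') Y"
proof -
  obtain \<alpha> where \<alpha>: "lin A P P' \<alpha>" "\<And>x. x \<in> carrier P \<Longrightarrow> f' (\<alpha> x) = f x"
    using presents_lift[OF P P'] by blast
  obtain \<beta> where \<beta>: "lin A P' P \<beta>" "\<And>x. x \<in> carrier P' \<Longrightarrow> f (\<beta> x) = f' x"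
    using presents_lift[OF P' P] by blast
  let ?Q = "hom_kernel P X f" and ?Q' = "hom_kernel P' X f'"
  have f: "lin A P X f" and f': "lin A P' X f'" using P P' by (auto simp: presents_def)
  have Q: "submod A P ?Q" and Q': "submod A P' ?Q'"
    using submod_kernel f f' by blast+
  interpret P': right_module A P' by (rule lin_dom[OF f'])
  \<comment> \<open>\<open>\<alpha> \<circ> \<beta>\<close> and the identity induce the same map on
    \<open>X\<close>, so their difference takes values in \<open>?Q'\<close>, where \<open>g\<close>
    is defined.\<close>
  define \<delta> where "\<delta> x = \<alpha> (\<beta> x) \<ominus>\<^bsub>P'\<^esub> x" for x
  have \<delta>: "lin A P' P' \<delta>"
    unfolding \<delta>_def[abs_def] by (rule lin_diff[OF lin_compose[OF \<beta>(1) \<alpha>(1)] lin_id[OF P'.right_module_axioms]])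
  have \<delta>Q: "\<delta> x \<in> ?Q'" if "x \<in> carrier P'" for x
  proof -
    have "f' (\<delta> x) = \<zero>\<^bsub>X\<^esub>"
      using that lin_closed[OF \<beta>(1) that] lin_closed[OF \<alpha>(1)] lin_closed[OF f']
      by (simp add: \<delta>_def lin_minus[OF f'] \<alpha> \<beta> minus_eq_zero_iff[OF lin_cod[OF f']])
    then show ?thesis using lin_closed[OF \<delta> that] by (simp add: hom_kernel_def)
  qed
  have \<alpha>Q: "\<alpha> x \<in> ?Q'" if "x \<in> ?Q" for x
    using that \<alpha> lin_closed[OF \<alpha>(1)] by (auto simp: hom_kernel_def)
  have \<beta>Q: "\<beta> x \<in> ?Q" if "x \<in> ?Q'" for x
    using that \<beta> lin_closed[OF \<beta>(1)] by (auto simp: hom_kernel_def)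
  have \<delta>': "lin A P' (sub P' ?Q') \<delta>" by (rule lin_into_sub[OF \<delta> Q' \<delta>Q])
  show ?thesis
  proof (rule unique_extI)
    fix g assume g: "lin A (sub P' ?Q') Y g"
    interpret Y: right_module A Y by (rule lin_cod[OF g])
    have "lin A (sub P ?Q) (sub P' ?Q') \<alpha>"
      by (rule lin_into_sub[OF lin_sub[OF \<alpha>(1) Q] Q']) (simp add: \<alpha>Q)
    then obtain h where h: "lin A P Y h" "\<And>x. x \<in> ?Q \<Longrightarrow> h x = g (\<alpha> x)"
      using unique_ext_exists[OF ue lin_compose[of A "sub P ?Q" "sub P' ?Q'" \<alpha> Y g]] g by blast
    \<comment> \<open>For \<open>x\<close> in \<open>?Q'\<close>,
      \<open>\<alpha> (\<beta> x)\<close> is \<open>x\<close> plus \<open>\<delta> x\<close>, so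
      \<open>h \<circ> \<beta>\<close> exceeds \<open>g\<close> by
      \<open>g \<circ> \<delta>\<close>. This correction is defined on all of
      \<open>P'\<close>.\<close>
    have "h (\<beta> x) \<ominus>\<^bsub>Y\<^esub> g (\<delta> x) = g x" if x: "x \<in> ?Q'" for x
    proof -
      have xP: "x \<in> carrier P'" using x by (simp add: hom_kernel_def)
      have "\<alpha> (\<beta> x) = x \<oplus>\<^bsub>P'\<^esub> \<delta> x"
        using xP lin_closed[OF \<alpha>(1) lin_closed[OF \<beta>(1) xP]]
        by (simp add: \<delta>_def a_minus_def P'.a_comm[of x] P'.a_assoc P'.l_neg)
      then have "h (\<beta> x) = g x \<oplus>\<^bsub>Y\<^esub> g (\<delta> x)"
        using h(2)[OF \<beta>Q[OF x]] lin_add[OF g, of x "\<delta> x"] x \<delta>Q[OF xP] by simp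
      then show ?thesis
        using lin_closed[OF g, of x] lin_closed[OF g, of "\<delta> x"] x \<delta>Q[OF xP]
        by (simp add: a_minus_def Y.a_assoc Y.r_neg)
    qed
    then show "\<exists>h. lin A P' Y h \<and> (\<forall>x\<in>?Q'. h x = g x)"
      using lin_diff[OF lin_compose[OF \<beta>(1) h(1)] lin_compose[OF \<delta>' g]] by blast
  next
    fix h x assume h: "lin A P' Y h" and ker: "\<And>x. x \<in> ?Q' \<Longrightarrow> h x = \<zero>\<^bsub>Y\<^esub>" and x: "x \<in> carrier P'"
    interpret Y: right_module A Y by (rule lin_cod[OF h])
    have "h (\<alpha> (\<beta> x)) = \<zero>\<^bsub>Y\<^esub>"
      using unique_ext_zero[OF ue lin_compose[OF \<alpha>(1) h]] ker \<alpha>Q lin_closed[OF \<beta>(1) x] by blast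
    moreover have "h (\<alpha> (\<beta> x)) \<ominus>\<^bsub>Y\<^esub> h x = \<zero>\<^bsub>Y\<^esub>"
      using ker[OF \<delta>Q[OF x]] lin_minus[OF h lin_closed[OF \<alpha>(1) lin_closed[OF \<beta>(1) x]] x]
      by (simp add: \<delta>_def)
    ultimately show "h x = \<zero>\<^bsub>Y\<^esub>"
      using lin_closed[OF h x] by (metis Y.right_module_axioms Y.zero_closed minus_eq_zero_iff)
  qed
qed

section \<open>Projective resolutions\<close>

lemma resolutionD:
  assumes R: "projective_resolution A X P d e" and X: "X \<in> Mod_cat A"
  shows "P n \<in> Mod_cat A" "projective A (P n)" "lin A (P (Suc n)) (P n) (d n)" "lin A (P 0) X e"
    "e ` carrier (P 0) = carrier X" "hom_kernel (P 0) X e = d 0 ` carrier (P (Suc 0))"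
    "hom_kernel (P (Suc n)) (P n) (d n) = d (Suc n) ` carrier (P (Suc (Suc n)))"
    "presents A (P 0) e X"
proof -
  have P: "P n \<in> Mod_cat A" for n using R by (simp add: projective_resolution_def)
  show 1: "P n \<in> Mod_cat A" "projective A (P n)" "e ` carrier (P 0) = carrier X"
    "hom_kernel (P 0) X e = d 0 ` carrier (P (Suc 0))"
    "hom_kernel (P (Suc n)) (P n) (d n) = d (Suc n) ` carrier (P (Suc (Suc n)))"
    using R by (simp_all add: projective_resolution_def)
  show "lin A (P (Suc n)) (P n) (d n)"
    using R by (intro mod_hom_lin Mod_catD P) (simp add: projective_resolution_def)
  show e: "lin A (P 0) X e"
    using R by (intro mod_hom_lin Mod_catD P X) (simp add: projective_resolution_def)
  show "presents A (P 0) e X"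
    using R X P e by (simp add: presents_def projective_resolution_def)
qed

text \<open>Cover \<open>X\<close>, then the kernel, and so on; the choice function
  \<open>cov\<close> turns this into an iteration. A differential is the cover of a syzygy followed
  by its inclusion into the previous projective.\<close>

lemma (in ring_universe) resolution_exists:
  fixes X :: "('a, 'm) rmodule"
  assumes X: "X \<in> Mod_cat A"
  shows "\<exists>P d e. projective_resolution A X P d e"
proof -
  have "\<exists>c. presents A (fst c) (snd c) K" if "K \<in> Mod_cat A" for K :: "('a, 'm) rmodule"
    using enough_projectives[OF that] that unfolding presents_def by (metis fst_conv snd_conv)
  then obtain cov where cov: "\<And>K :: ('a, 'm) rmodule. K \<in> Mod_cat A \<Longrightarrow> presents A (fst (cov K)) (snd (cov K)) K"
    by metis
  define syz where "syz K = sub (fst (cov K)) (hom_kernel (fst (cov K)) K (snd (cov K)))" for K :: "('a, 'm) rmodule"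
  define K where "K n = (syz ^^ n) X" for n
  define P where "P n = fst (cov (K n))" for n
  define e where "e n = snd (cov (K n))" for n
  have K0: "K 0 = X" and KS: "K (Suc n) = sub (P n) (hom_kernel (P n) (K n) (e n))" for n
    by (simp_all add: K_def syz_def P_def e_def)
  have pres: "presents A (P n) (e n) (K n)" if "K n \<in> Mod_cat A" for n
    using cov[OF that] by (simp add: P_def e_def)
  have K: "K n \<in> Mod_cat A" for n
  proof (induction n)
    case (Suc n)
    then show ?case
      using pres[OF Suc] submod_kernel[of A "P n" "K n" "e n"] unfolding KS presents_def
      by (blast intro: Mod_cat_sub)
  qed (simp add: K0 X)
  have P: "P n \<in> Mod_cat A" "projective A (P n)" and e: "lin A (P n) (K n) (e n)"
    and surj: "e n ` carrier (P n) = carrier (K n)" for n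
    using pres[OF K[of n]] by (simp_all add: presents_def)
  define d where "d n = restrict (e (Suc n)) (carrier (P (Suc n)))" for n
  have sub: "submod A (P n) (hom_kernel (P n) (K n) (e n))" for n
    by (rule submod_kernel[OF e])
  have im: "e (Suc n) ` carrier (P (Suc n)) = hom_kernel (P n) (K n) (e n)" for n
    using surj[of "Suc n"] by (simp add: KS)
  have lin: "lin A (P (Suc n)) (P n) (e (Suc n))" for n
    using lin_from_sub[OF _ sub] e[of "Suc n"] unfolding KS by blast
  have ker: "hom_kernel (P (Suc n)) (P n) (d n) = hom_kernel (P (Suc n)) (K (Suc n)) (e (Suc n))" for n
    by (auto simp: hom_kernel_def d_def KS)
  have "projective_resolution A X P d (restrict (e 0) (carrier (P 0)))"
    unfolding projective_resolution_def
  proof (intro conjI allI)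
    show "P n \<in> Mod_cat A" "projective A (P n)" for n by (rule P)+
    show "d n \<in> mod_hom A (P (Suc n)) (P n)" for n
      unfolding d_def by (rule lin_restrict[OF lin])
    show "restrict (e 0) (carrier (P 0)) \<in> mod_hom A (P 0) X"
      using lin_restrict[OF e[of 0]] by (simp add: K0)
    show "restrict (e 0) (carrier (P 0)) ` carrier (P 0) = carrier X"
      using surj[of 0] by (simp add: K0)
    have "hom_kernel (P 0) X (restrict (e 0) (carrier (P 0))) = hom_kernel (P 0) (K 0) (e 0)"
      by (auto simp: hom_kernel_def K0)
    then show "hom_kernel (P 0) X (restrict (e 0) (carrier (P 0))) = d 0 ` carrier (P 1)"
      using im[of 0] by (simp add: d_def)
    show "hom_kernel (P (Suc n)) (P n) (d n) = d (Suc n) ` carrier (P (Suc (Suc n)))" for n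
      using im[of "Suc n"] unfolding ker by (simp add: d_def)
  qed
  then show ?thesis by blast
qed

section \<open>Cohomology of the Hom complex\<close>

lemma comm_group_hom_group:
  assumes M: "right_module A M" and N: "right_module A N"
  shows "comm_group (hom_group A M N)"
proof -
  interpret M: right_module A M by fact
  interpret N: right_module A N by fact
  have lin: "lin A M N f" if "f \<in> mod_hom A M N" for f using that by (rule mod_hom_lin[OF M N])
  have mem: "f x \<in> carrier N" if "f \<in> mod_hom A M N" "x \<in> carrier M" for f x
    using lin_closed[OF lin] that by blast
  have arb: "f x = undefined" if "f \<in> mod_hom A M N" "x \<notin> carrier M" for f x
    using mod_hom_extensional[OF that(1)] that(2) by (rule extensional_arb)
  have zero: "zero_hom M N \<in> mod_hom A M N"
    unfolding zero_hom_def by (rule lin_restrict[OF lin_const_zero[OF M N]])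
  show ?thesis
  proof (rule comm_groupI; simp only: hom_group_def monoid.simps partial_object.simps zero)
    fix f assume f: "f \<in> mod_hom A M N"
    show "(\<lambda>x\<in>carrier M. zero_hom M N x \<oplus>\<^bsub>N\<^esub> f x) = f"
      by (rule ext) (simp add: zero_hom_def mem[OF f] arb[OF f])
    show "\<exists>g\<in>mod_hom A M N. (\<lambda>x\<in>carrier M. g x \<oplus>\<^bsub>N\<^esub> f x) = zero_hom M N"
      by (rule bexI[OF _ lin_restrict[OF lin_uminus[OF lin[OF f]]]], rule ext)
        (simp add: zero_hom_def N.l_neg mem[OF f])
  next
    fix f g assume f: "f \<in> mod_hom A M N" and g: "g \<in> mod_hom A M N"
    show "(\<lambda>x\<in>carrier M. f x \<oplus>\<^bsub>N\<^esub> g x) \<in> mod_hom A M N"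
      by (rule lin_restrict[OF lin_plus[OF lin[OF f] lin[OF g]]])
    show "(\<lambda>x\<in>carrier M. f x \<oplus>\<^bsub>N\<^esub> g x) = (\<lambda>x\<in>carrier M. g x \<oplus>\<^bsub>N\<^esub> f x)"
      by (rule ext) (simp add: mem[OF f] mem[OF g] N.a_comm)
    fix h assume h: "h \<in> mod_hom A M N"
    show "(\<lambda>x\<in>carrier M. (\<lambda>x\<in>carrier M. f x \<oplus>\<^bsub>N\<^esub> g x) x \<oplus>\<^bsub>N\<^esub> h x) =
        (\<lambda>x\<in>carrier M. f x \<oplus>\<^bsub>N\<^esub> (\<lambda>x\<in>carrier M. g x \<oplus>\<^bsub>N\<^esub> h x) x)"
      by (rule ext) (simp add: mem[OF f] mem[OF g] mem[OF h] N.a_assoc)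
  qed
qed

lemma zero_hom_in: "right_module A M \<Longrightarrow> right_module A N \<Longrightarrow> zero_hom M N \<in> mod_hom A M N"
  unfolding zero_hom_def by (rule lin_restrict[OF lin_const_zero])

lemma coset_coboundaries:
  "H #>\<^bsub>(hom_group A M N)\<lparr>carrier := C\<rparr>\<^esub> f = (\<lambda>h. \<lambda>x\<in>carrier M. h x \<oplus>\<^bsub>N\<^esub> f x) ` H"
  by (auto simp: r_coset_def hom_group_def)

context
  fixes A :: "('a, 'r) ring_scheme" and X :: "('a, 'm) rmodule" and P d e
    and Y :: "('a, 'm) rmodule"
  assumes res: "projective_resolution A X P d e" and X: "X \<in> Mod_cat A" and Y: "Y \<in> Mod_cat A"
begin

lemmas resD = resolutionD[OF res X]

lemma P_module: "right_module A (P n)"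
  and Y_module: "right_module A Y"
  using resD(1) Y by (simp_all add: Mod_catD)

lemma cocycle_iff:
  "f \<in> cocycles A P d Y n \<longleftrightarrow>
     f \<in> mod_hom A (P n) Y \<and> (\<forall>x\<in>carrier (P (Suc n)). f (d n x) = \<zero>\<^bsub>Y\<^esub>)"
  by (auto simp: cocycles_def compose_def zero_hom_def fun_eq_iff)

lemma zero_cocycle: "zero_hom (P n) Y \<in> cocycles A P d Y n"
  using zero_hom_in[OF P_module Y_module, of n] lin_closed[OF resD(3)]
  by (simp add: cocycle_iff zero_hom_def)

lemma zero_coboundary: "zero_hom (P n) Y \<in> coboundaries A P d Y n"
proof (cases n)
  case (Suc k)
  have "zero_hom (P (Suc k)) Y = compose (carrier (P (Suc k))) (zero_hom (P k) Y) (d k)"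
    using lin_closed[OF resD(3)[of k]] by (auto simp: zero_hom_def compose_def)
  then show ?thesis
    unfolding Suc coboundaries.simps by (rule image_eqI[OF _ zero_hom_in[OF P_module Y_module]])
qed simp

lemma coboundaries_hom: "coboundaries A P d Y n \<subseteq> mod_hom A (P n) Y"
proof (cases n)
  case (Suc k)
  have "compose (carrier (P (Suc k))) f (d k) \<in> mod_hom A (P (Suc k)) Y" if "f \<in> mod_hom A (P k) Y" for f
    using lin_restrict[OF lin_compose[OF resD(3) mod_hom_lin[OF P_module Y_module that]]]
    by (simp add: compose_def)
  then show ?thesis by (auto simp: Suc)
qed (auto simp: zero_hom_in[OF P_module Y_module])

text \<open>The neutral class is the coset of the zero cocycle. This supplies the default
  coordinates when a single degree is read off from the sum of all Ext groups.\<close>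

lemma one_cohomology_closed:
  "one (cohomology_group A P d Y n) \<in> carrier (cohomology_group A P d Y n)"
proof -
  interpret Y: right_module A Y by (rule Y_module)
  have "(\<lambda>x\<in>carrier (P n). h x \<oplus>\<^bsub>Y\<^esub> zero_hom (P n) Y x) = h" if "h \<in> coboundaries A P d Y n" for h
  proof -
    have h: "h \<in> mod_hom A (P n) Y" using that coboundaries_hom by blast
    show ?thesis
      using lin_closed[OF mod_hom_lin[OF P_module Y_module h]] extensional_arb[OF mod_hom_extensional[OF h]]
      by (auto simp: zero_hom_def)
  qed
  then have "coboundaries A P d Y n = coboundaries A P d Y n
      #>\<^bsub>(hom_group A (P n) Y)\<lparr>carrier := cocycles A P d Y n\<rparr>\<^esub> zero_hom (P n) Y"
    unfolding coset_coboundaries by force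
  then show ?thesis
    using zero_cocycle[of n] by (auto simp: cohomology_group_def FactGroup_def RCOSETS_def)
qed

text \<open>Zero is a coboundary, so a cocycle lies in its own coset; if the only coset is the
  neutral one, the cocycle is a coboundary.\<close>

lemma cocycles_coboundaries:
  assumes "carrier (cohomology_group A P d Y n) = {one (cohomology_group A P d Y n)}"
  shows "cocycles A P d Y n \<subseteq> coboundaries A P d Y n"
proof
  interpret Y: right_module A Y by (rule Y_module)
  let ?H = "coboundaries A P d Y n" and ?G = "(hom_group A (P n) Y)\<lparr>carrier := cocycles A P d Y n\<rparr>"
  fix f assume f: "f \<in> cocycles A P d Y n"
  then have fh: "f \<in> mod_hom A (P n) Y" by (simp add: cocycle_iff)
  have "?H #>\<^bsub>?G\<^esub> f \<in> carrier (cohomology_group A P d Y n)"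
    using f by (auto simp: cohomology_group_def FactGroup_def RCOSETS_def)
  then have "?H #>\<^bsub>?G\<^esub> f = ?H"
    using assms by (simp add: cohomology_group_def FactGroup_def)
  moreover have "f = (\<lambda>x\<in>carrier (P n). zero_hom (P n) Y x \<oplus>\<^bsub>Y\<^esub> f x)"
    using lin_closed[OF mod_hom_lin[OF P_module Y_module fh]] extensional_arb[OF mod_hom_extensional[OF fh]]
    by (auto simp: zero_hom_def)
  then have "f \<in> ?H #>\<^bsub>?G\<^esub> f"
    unfolding coset_coboundaries by (rule image_eqI[OF _ zero_coboundary])
  ultimately show "f \<in> ?H" by simp
qed

lemma trivial_cohomology:
  assumes eq: "cocycles A P d Y n = coboundaries A P d Y n"
  shows "trivial_group (cohomology_group A P d Y n)"
proof -
  interpret Y: right_module A Y by (rule Y_module)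
  interpret G: comm_group "hom_group A (P n) Y" by (rule comm_group_hom_group[OF P_module Y_module])
  let ?C = "cocycles A P d Y n" and ?G = "(hom_group A (P n) Y)\<lparr>carrier := cocycles A P d Y n\<rparr>"
  have inv: "inv\<^bsub>hom_group A (P n) Y\<^esub> f = (\<lambda>x\<in>carrier (P n). \<ominus>\<^bsub>Y\<^esub> f x)" if f: "f \<in> mod_hom A (P n) Y" for f
  proof (rule G.inv_equality)
    note l = mod_hom_lin[OF P_module Y_module f]
    show "(\<lambda>x\<in>carrier (P n). \<ominus>\<^bsub>Y\<^esub> f x) \<otimes>\<^bsub>hom_group A (P n) Y\<^esub> f = \<one>\<^bsub>hom_group A (P n) Y\<^esub>"
      using lin_closed[OF l] by (auto simp: hom_group_def zero_hom_def Y.l_neg)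
    show "f \<in> carrier (hom_group A (P n) Y)"
      "(\<lambda>x\<in>carrier (P n). \<ominus>\<^bsub>Y\<^esub> f x) \<in> carrier (hom_group A (P n) Y)"
      using f lin_restrict[OF lin_uminus[OF l]] by (simp_all add: hom_group_def)
  qed
  have dcl: "d n x \<in> carrier (P n)" if "x \<in> carrier (P (Suc n))" for x
    using lin_closed[OF resD(3) that] .
  have neg0: "\<ominus>\<^bsub>Y\<^esub> \<zero>\<^bsub>Y\<^esub> = \<zero>\<^bsub>Y\<^esub>" by (rule Y.minus_equality) simp_all
  have C: "subgroup ?C (hom_group A (P n) Y)"
  proof (rule G.subgroupI)
    show "?C \<subseteq> carrier (hom_group A (P n) Y)" by (auto simp: cocycle_iff hom_group_def)
    show "?C \<noteq> {}" using zero_cocycle by blast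
    show "inv\<^bsub>hom_group A (P n) Y\<^esub> f \<in> ?C" if "f \<in> ?C" for f
      using that lin_restrict[OF lin_uminus[OF mod_hom_lin[OF P_module Y_module, of f]]]
      by (auto simp: cocycle_iff inv dcl neg0)
    show "f \<otimes>\<^bsub>hom_group A (P n) Y\<^esub> g \<in> ?C" if "f \<in> ?C" "g \<in> ?C" for f g
      using that lin_restrict[OF lin_plus[OF mod_hom_lin[OF P_module Y_module, of f]
          mod_hom_lin[OF P_module Y_module, of g]]]
      by (auto simp: cocycle_iff hom_group_def dcl)
  qed
  interpret K: comm_group ?G
    by (rule group.group_comm_groupI[OF subgroup.subgroup_is_group[OF C G.is_group]])
      (use subgroup.subset[OF C] in \<open>auto simp: subset_iff intro: G.m_comm\<close>)
  have self: "subgroup ?C ?G" using K.subgroup_self by simp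
  interpret N: normal ?C ?G using K.normal_iff_subgroup self by blast
  have "carrier (?G Mod ?C) = {?C}"
    using K.coset_join2[OF _ self] zero_cocycle by (auto simp: FactGroup_def RCOSETS_def)
  then have "trivial_group (?G Mod ?C)"
    using N.factorgroup_is_group by (simp add: trivial_group_def FactGroup_def)
  then show ?thesis by (simp add: cohomology_group_def eq)
qed

text \<open>By exactness, a cocycle in degree 0 is a map on \<open>P 0\<close> that kills the kernel
  of \<open>e\<close>, and a cocycle in degree 1 is a map defined on that kernel, pulled back along
  \<open>d 0\<close>. The latter is a coboundary exactly when it extends to
  \<open>P 0\<close>.\<close>

lemma unique_ext_iff_cocycles:
  "unique_ext A (P 0) (hom_kernel (P 0) X e) Y \<longleftrightarrow>
     cocycles A P d Y 0 \<subseteq> coboundaries A P d Y 0 \<and> cocycles A P d Y 1 \<subseteq> coboundaries A P d Y 1"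
    (is "_ = ?R")
proof
  let ?Q = "hom_kernel (P 0) X e"
  have Q: "submod A (P 0) ?Q" by (rule submod_kernel[OF resD(4)])
  have d0: "lin A (P 1) (sub (P 0) ?Q) (d 0)"
    using lin_into_sub[OF resD(3)[of 0] Q] resD(6) by auto
  assume R: ?R
  show "unique_ext A (P 0) ?Q Y"
  proof (rule unique_extI)
    fix g assume g: "lin A (sub (P 0) ?Q) Y g"
    let ?f = "restrict (\<lambda>x. g (d 0 x)) (carrier (P 1))"
    have f: "?f \<in> mod_hom A (P 1) Y" by (rule lin_restrict[OF lin_compose[OF d0 g]])
    have "d 0 (d 1 x) = \<zero>\<^bsub>P 0\<^esub>" if "x \<in> carrier (P 2)" for x
      using resD(7)[of 0] that by (auto simp: hom_kernel_def numeral_2_eq_2)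
    then have "?f \<in> cocycles A P d Y 1"
      using f lin_closed[OF resD(3)[of 1]] lin_zero[OF g] by (simp add: cocycle_iff numeral_2_eq_2)
    then obtain h where h: "h \<in> mod_hom A (P 0) Y" "?f = compose (carrier (P 1)) h (d 0)"
      using R by auto
    have "h x = g x" if x: "x \<in> ?Q" for x
    proof -
      obtain y where y: "y \<in> carrier (P 1)" "x = d 0 y" using x resD(6) by auto
      show ?thesis using fun_cong[OF h(2), of y] y by (simp add: compose_def)
    qed
    then show "\<exists>h. lin A (P 0) Y h \<and> (\<forall>x\<in>?Q. h x = g x)"
      using mod_hom_lin[OF P_module Y_module h(1)] by blast
  next
    fix h x assume h: "lin A (P 0) Y h" and ker: "\<And>x. x \<in> ?Q \<Longrightarrow> h x = \<zero>\<^bsub>Y\<^esub>" and x: "x \<in> carrier (P 0)"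
    have "d 0 y \<in> carrier (P 0) \<and> h (d 0 y) = \<zero>\<^bsub>Y\<^esub>" if "y \<in> carrier (P 1)" for y
      using ker resD(6) that lin_closed[OF resD(3)[of 0]] by auto
    then have "restrict h (carrier (P 0)) \<in> cocycles A P d Y 0"
      using lin_restrict[OF h] by (simp add: cocycle_iff)
    then have "restrict h (carrier (P 0)) = zero_hom (P 0) Y" using R by auto
    then show "h x = \<zero>\<^bsub>Y\<^esub>" using x by (metis restrict_apply' zero_hom_def)
  qed
next
  let ?Q = "hom_kernel (P 0) X e"
  have Q: "submod A (P 0) ?Q" by (rule submod_kernel[OF resD(4)])
  have d0: "lin A (P 1) (sub (P 0) ?Q) (d 0)"
    using lin_into_sub[OF resD(3)[of 0] Q] resD(6) by auto
  assume ue: "unique_ext A (P 0) ?Q Y"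
  have "f = zero_hom (P 0) Y" if "f \<in> cocycles A P d Y 0" for f
  proof -
    have f: "f \<in> mod_hom A (P 0) Y" "\<And>y. y \<in> carrier (P 1) \<Longrightarrow> f (d 0 y) = \<zero>\<^bsub>Y\<^esub>"
      using that by (simp_all add: cocycle_iff)
    show ?thesis
      by (rule mod_hom_eqI[OF f(1) zero_hom_in[OF P_module Y_module]])
        (use unique_ext_zero[OF ue mod_hom_lin[OF P_module Y_module f(1)]] f(2) resD(6)
          in \<open>auto simp: zero_hom_def\<close>)
  qed
  moreover have "f \<in> coboundaries A P d Y 1" if "f \<in> cocycles A P d Y 1" for f
  proof -
    have f: "f \<in> mod_hom A (P 1) Y" "\<And>y. y \<in> carrier (P 2) \<Longrightarrow> f (d 1 y) = \<zero>\<^bsub>Y\<^esub>"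
      using that by (simp_all add: cocycle_iff numeral_2_eq_2)
    have "f y = \<zero>\<^bsub>Y\<^esub>" if "y \<in> carrier (P 1)" "d 0 y = \<zero>\<^bsub>sub (P 0) ?Q\<^esub>" for y
    proof -
      have "y \<in> hom_kernel (P 1) (P 0) (d 0)" using that by (simp add: hom_kernel_def)
      then have "y \<in> d 1 ` carrier (P 2)" using resD(7)[of 0] by (simp add: numeral_2_eq_2)
      then show ?thesis using f(2) by blast
    qed
    moreover have "d 0 ` carrier (P 1) = carrier (sub (P 0) ?Q)" using resD(6) by simp
    ultimately obtain k where k: "lin A (sub (P 0) ?Q) Y k" "\<And>y. y \<in> carrier (P 1) \<Longrightarrow> k (d 0 y) = f y"
      using lin_factor[OF d0 mod_hom_lin[OF P_module Y_module f(1)]] by blast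
    obtain h where h: "lin A (P 0) Y h" "\<And>x. x \<in> ?Q \<Longrightarrow> h x = k x"
      using unique_ext_exists[OF ue k(1)] by blast
    have "f = compose (carrier (P 1)) (restrict h (carrier (P 0))) (d 0)"
    proof
      fix y show "f y = compose (carrier (P 1)) (restrict h (carrier (P 0))) (d 0) y"
        using k(2)[of y] h(2)[of "d 0 y"] resD(6) lin_closed[OF resD(3)[of 0], of y]
          extensional_arb[OF mod_hom_extensional[OF f(1)], of y]
        by (cases "y \<in> carrier (P 1)") (auto simp: compose_def)
    qed
    then show ?thesis using lin_restrict[OF h(1)] by auto
  qed
  ultimately show ?R by auto
qed

lemma unique_ext_cocycles_eq:
  assumes "unique_ext A (P 0) (hom_kernel (P 0) X e) Y"
  shows "cocycles A P d Y 0 = coboundaries A P d Y 0" "cocycles A P d Y 1 = coboundaries A P d Y 1"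
proof -
  show "cocycles A P d Y 0 = coboundaries A P d Y 0"
    using assms zero_cocycle[of 0] unfolding unique_ext_iff_cocycles by auto
  have "compose (carrier (P 1)) h (d 0) \<in> cocycles A P d Y 1" if h: "h \<in> mod_hom A (P 0) Y" for h
  proof -
    have "d 0 (d 1 x) = \<zero>\<^bsub>P 0\<^esub>" if "x \<in> carrier (P 2)" for x
      using resD(7)[of 0] that by (auto simp: hom_kernel_def numeral_2_eq_2)
    moreover have "compose (carrier (P 1)) h (d 0) \<in> mod_hom A (P 1) Y"
      using coboundaries_hom[of 1] h by auto
    ultimately show ?thesis
      using lin_closed[OF resD(3)[of 1]] lin_zero[OF mod_hom_lin[OF P_module Y_module h]]
      by (simp add: cocycle_iff compose_def numeral_2_eq_2)
  qed
  then show "cocycles A P d Y 1 = coboundaries A P d Y 1"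
    using assms unfolding unique_ext_iff_cocycles by auto
qed

end

section \<open>Ext over a hereditary ring\<close>

lemma (in ring_universe) Ext_cohomology:
  fixes X :: "('a, 'm) rmodule"
  assumes X: "X \<in> Mod_cat A"
  obtains P d e where "projective_resolution A X P d e"
    "\<And>n (Y :: ('a, 'm) rmodule). Ext A (int n) X Y = cohomology_group A P d Y n"
proof -
  let ?t = "SOME (P, d, e). projective_resolution A X P d e"
  obtain P d e where t: "?t = (P, d, e)" by (metis prod_cases3)
  have "\<exists>t. case t of (P, d, e) \<Rightarrow> projective_resolution A X P d e"
    using resolution_exists[OF X] by auto
  from someI_ex[OF this] have "projective_resolution A X P d e" by (simp add: t)
  moreover have "Ext A (int n) X Y = cohomology_group A P d Y n" for n and Y :: "('a, 'm) rmodule"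
    by (simp add: Ext_def t)
  ultimately show thesis using that by blast
qed

text \<open>A family with a single possibly nontrivial coordinate is among the generators of the
  sum, so triviality of the sum is inherited by each component.\<close>

lemma trivial_sum_group_component:
  assumes triv: "trivial_group (sum_group I G)" and i: "i \<in> I"
    and one: "\<And>k. k \<in> I \<Longrightarrow> one (G k) \<in> carrier (G k)"
  shows "carrier (G i) = {one (G i)}"
proof -
  have "x = one (G i)" if x: "x \<in> carrier (G i)" for x
  proof -
    let ?v = "\<lambda>k\<in>I. if k = i then x else one (G k)"
    have "?v \<in> (\<Pi>\<^sub>E k\<in>I. carrier (G k))" using x one by (auto simp: PiE_iff)
    moreover have "finite {k \<in> I. ?v k \<noteq> one (G k)}"
      by (rule finite_subset[of _ "{i}"]) auto
    ultimately have "?v \<in> carrier (sum_group I G)"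
      by (auto simp: sum_group_def carrier_subgroup_generated intro!: generate.incl)
    then have "?v = (\<lambda>k\<in>I. one (G k))"
      using triv by (simp add: trivial_group_def)
    from fun_cong[OF this, of i] i show ?thesis by simp
  qed
  then show ?thesis using one[OF i] by blast
qed

lemma trivial_sum_group:
  assumes "\<And>i. i \<in> I \<Longrightarrow> trivial_group (G i)"
  shows "trivial_group (sum_group I G)"
proof -
  have G: "group (G i)" if "i \<in> I" for i using assms[OF that] by (simp add: trivial_group_def)
  have "v = one (sum_group I G)" if "v \<in> carrier (sum_group I G)" for v
  proof -
    have v: "v \<in> (\<Pi>\<^sub>E i\<in>I. carrier (G i))" using that by (simp add: carrier_sum_group[OF G])
    have "v i = one (G i)" if "i \<in> I" for i
      using PiE_mem[OF v that] assms[OF that] by (simp add: trivial_group_def)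
    then show ?thesis using PiE_arb[OF v] by (auto simp: fun_eq_iff)
  qed
  then show ?thesis
    by (simp add: group.trivial_group_subset[OF sum_group[OF G]] subsetI)
qed

locale hereditary_universe = ring_universe U A for U :: "'m itself" and A :: "('a, 'r) ring_scheme" +
  assumes hereditary: "hereditary_ring U A"
begin

text \<open>Negative degrees vanish by definition and degrees above 1 by heredity; degrees 0 and 1
  are what \<open>unique_ext\<close> measures on the resolution chosen by \<open>Ext\<close>.
  Independence of the presentation then moves the condition to the given \<open>P\<close>.\<close>

lemma Ext_total_trivial_iff:
  fixes X Y :: "('a, 'm) rmodule"
  assumes P: "presents A P f X" and Y: "Y \<in> Mod_cat A"
  shows "trivial_group (Ext_total A X Y) \<longleftrightarrow> unique_ext A P (hom_kernel P X f) Y"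
proof -
  have X: "X \<in> Mod_cat A" using P by (simp add: presents_def)
  obtain R d e where res: "projective_resolution A X R d e"
    and Ext: "\<And>n (Y :: ('a, 'm) rmodule). Ext A (int n) X Y = cohomology_group A R d Y n"
    using Ext_cohomology[OF X] by blast
  have R: "presents A (R 0) e X" by (rule resolutionD[OF res X])
  have "trivial_group (Ext_total A X Y) \<longleftrightarrow> unique_ext A (R 0) (hom_kernel (R 0) X e) Y"
  proof
    assume triv: "trivial_group (Ext_total A X Y)"
    have one: "one (Ext A n X Y) \<in> carrier (Ext A n X Y)" for n
    proof (cases "n < 0")
      case True
      then show ?thesis by (simp add: Ext_def singleton_group_def)
    next
      case False
      then obtain k where "n = int k" using nonneg_int_cases[of n] by auto
      then show ?thesis using one_cohomology_closed[OF res X Y] by (simp add: Ext)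
    qed
    have "carrier (Ext A n X Y) = {one (Ext A n X Y)}" for n
      using trivial_sum_group_component[where G = "\<lambda>n. Ext A n X Y" and I = UNIV] triv one by (simp add: Ext_total_def)
    from this[of "int 0"] this[of "int 1"]
    show "unique_ext A (R 0) (hom_kernel (R 0) X e) Y"
      unfolding unique_ext_iff_cocycles[OF res X Y] Ext
      using cocycles_coboundaries[OF res X Y] by blast
  next
    assume ue: "unique_ext A (R 0) (hom_kernel (R 0) X e) Y"
    have "trivial_group (Ext A n X Y)" for n
    proof -
      consider "n < 0" | "n = int 0" | "n = int 1" | "n > 1" by linarith
      then show ?thesis
      proof cases
        case 1
        then show ?thesis by (simp add: Ext_def)
      next
        case 2
        then show ?thesis
          unfolding 2 Ext using trivial_cohomology[OF res X Y unique_ext_cocycles_eq(1)[OF res X Y ue]] by simp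
      next
        case 3
        then show ?thesis
          unfolding 3 Ext using trivial_cohomology[OF res X Y unique_ext_cocycles_eq(2)[OF res X Y ue]] by simp
      next
        case 4
        then show ?thesis using hereditary X Y by (simp add: hereditary_ring_def)
      qed
    qed
    then show "trivial_group (Ext_total A X Y)"
      unfolding Ext_total_def by (intro trivial_sum_group)
  qed
  then show ?thesis
    using unique_ext_presentation[OF P R] unique_ext_presentation[OF R P] by blast
qed

text \<open>The vanishing of Ext in degree 2 speaks of the resolution hidden in \<open>Ext\<close>.
  Projectivity is therefore proved for the kernel \<open>?Q'\<close> of its augmentation and then
  transported to \<open>Q\<close> by comparing the two presentations of \<open>P / Q\<close>, as in
  Schanuel's lemma.\<close>

lemma projective_sub:
  fixes P :: "('a, 'm) rmodule"
  assumes P: "P \<in> Mod_cat A" and proj: "projective A P" and Q: "submod A P Q"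
  shows "projective A (sub P Q)"
proof -
  obtain X :: "('a, 'm) rmodule" and f where X: "X \<in> Mod_cat A" and f: "lin A P X f"
    and surj: "f ` carrier P = carrier X" and ker: "hom_kernel P X f = Q"
    using quotient_exists[OF Q Mod_cat_small[OF P]] by blast
  have pres: "presents A P f X" using P proj X f surj by (simp add: presents_def)
  obtain R d e where res: "projective_resolution A X R d e"
    and Ext: "\<And>n (Y :: ('a, 'm) rmodule). Ext A (int n) X Y = cohomology_group A R d Y n"
    using Ext_cohomology[OF X] by blast
  note rD = resolutionD[OF res X]
  let ?Z = "hom_kernel (R 1) (R 0) (d 0)" and ?Q' = "hom_kernel (R 0) X e"
  have Z: "submod A (R 1) ?Z" and Q': "submod A (R 0) ?Q'"
    using submod_kernel[OF rD(3)[of 0]] submod_kernel[OF rD(4)] by simp_all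
  have ZC: "sub (R 1) ?Z \<in> Mod_cat A" by (rule Mod_cat_sub[OF rD(1) Z])
  have Zim: "d 1 ` carrier (R 2) = ?Z" using rD(7)[of 0] by (simp add: numeral_2_eq_2)
  have d1: "lin A (R 2) (sub (R 1) ?Z) (d 1)"
    using lin_into_sub[OF rD(3)[of 1, simplified] Z[simplified]] Zim by (auto simp: numeral_2_eq_2)
  \<comment> \<open>Since the second Ext vanishes, the second syzygy \<open>?Z\<close> is a direct summand of \<open>R 1\<close>.\<close>
  obtain \<rho> where \<rho>: "lin A (R 1) (sub (R 1) ?Z) \<rho>" "\<And>z. z \<in> ?Z \<Longrightarrow> \<rho> z = z"
  proof -
    have "trivial_group (Ext A (int 2) X (sub (R 1) ?Z))"
      using hereditary X ZC by (simp add: hereditary_ring_def)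
    then have sub2: "cocycles A R d (sub (R 1) ?Z) 2 \<subseteq> coboundaries A R d (sub (R 1) ?Z) 2"
      unfolding Ext trivial_group_def by (intro cocycles_coboundaries[OF res X ZC]) blast
    \<comment> \<open>The test cocycle is \<open>d 1\<close> with codomain narrowed to
      \<open>?Z\<close>. Being a coboundary, it has the form \<open>r \<circ> d 1\<close>, and this
      says that \<open>r\<close> fixes \<open>?Z\<close>.\<close>
    have "d 1 (d 2 x) = \<zero>\<^bsub>R 1\<^esub>" if "x \<in> carrier (R 3)" for x
      using rD(7)[of 1] that by (auto simp: hom_kernel_def numeral_2_eq_2 numeral_3_eq_3)
    then have "restrict (d 1) (carrier (R 2)) \<in> cocycles A R d (sub (R 1) ?Z) 2"
      using lin_restrict[OF d1] lin_closed[OF rD(3)[of 2]] unfolding cocycle_iff[OF res X ZC]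
      by (simp add: numeral_2_eq_2 numeral_3_eq_3)
    then obtain r where r: "r \<in> mod_hom A (R 1) (sub (R 1) ?Z)"
      "restrict (d 1) (carrier (R 2)) = compose (carrier (R 2)) r (d 1)"
      using sub2 by (auto simp: numeral_2_eq_2)
    have "r z = z" if z: "z \<in> ?Z" for z
    proof -
      obtain y where "y \<in> carrier (R 2)" "z = d 1 y" using z Zim by blast
      then show ?thesis using fun_cong[OF r(2), of y] by (simp add: compose_def)
    qed
    with mod_hom_lin[OF Mod_catD[OF rD(1)] Mod_catD[OF ZC] r(1)] that show thesis by blast
  qed
  have Q'proj: "projective A (sub (R 0) ?Q')"
  proof (rule projectiveI[OF right_module_sub[OF Q']])
    fix M N :: "('a, 'm) rmodule" and p g
    assume M: "M \<in> Mod_cat A" and N: "N \<in> Mod_cat A" and p: "lin A M N p" "p ` carrier M = carrier N"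
      and g: "lin A (sub (R 0) ?Q') N g"
    interpret R1: right_module A "R 1" by (rule Mod_catD[OF rD(1)])
    interpret M: right_module A M by (rule Mod_catD[OF M])
    interpret N: right_module A N by (rule Mod_catD[OF N])
    have d0: "lin A (R 1) (sub (R 0) ?Q') (d 0)"
      using lin_into_sub[OF rD(3)[of 0] Q'] rD(6) by auto
    obtain h where h: "lin A (R 1) M h" "\<And>x. x \<in> carrier (R 1) \<Longrightarrow> p (h x) = g (d 0 x)"
      using projectiveD[OF rD(2) M N p lin_compose[OF d0 g]] by blast
    \<comment> \<open>Subtracting the part along \<open>?Z\<close> makes the lift vanish on the
      kernel of \<open>d 0\<close>, so that it descends to \<open>?Q'\<close>. The subtracted term
      is invisible after \<open>p\<close>, since \<open>\<rho> x\<close> is killed by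
      \<open>d 0\<close>.\<close>
    let ?k = "\<lambda>x. h x \<ominus>\<^bsub>M\<^esub> h (\<rho> x)"
    have h\<rho>: "lin A (R 1) M (\<lambda>x. h (\<rho> x))"
      by (rule lin_compose[OF \<rho>(1) lin_sub[OF h(1) Z]])
    have k: "lin A (R 1) M ?k" by (rule lin_diff[OF h(1) h\<rho>])
    have "?k x = \<zero>\<^bsub>M\<^esub>" if "x \<in> carrier (R 1)" "d 0 x = \<zero>\<^bsub>sub (R 0) ?Q'\<^esub>" for x
      using that \<rho>(2)[of x] lin_closed[OF h(1)]
      by (simp add: hom_kernel_def minus_eq_zero_iff[OF M.right_module_axioms])
    moreover have "d 0 ` carrier (R 1) = carrier (sub (R 0) ?Q')" using rD(6) by simp
    ultimately obtain g' where g': "lin A (sub (R 0) ?Q') M g'"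
      "\<And>x. x \<in> carrier (R 1) \<Longrightarrow> g' (d 0 x) = ?k x"
      using lin_factor[OF d0 k] by blast
    have "p (g' y) = g y" if y: "y \<in> ?Q'" for y
    proof -
      obtain x where x: "x \<in> carrier (R 1)" "y = d 0 x" using y rD(6) by auto
      have \<rho>x: "\<rho> x \<in> ?Z" using lin_closed[OF \<rho>(1) x(1)] by simp
      then have \<rho>x': "\<rho> x \<in> carrier (R 1)" "d 0 (\<rho> x) = \<zero>\<^bsub>R 0\<^esub>" by (simp_all add: hom_kernel_def)
      have "p (g' y) = p (h x) \<ominus>\<^bsub>N\<^esub> p (h (\<rho> x))"
        using x g'(2) lin_minus[OF p(1) lin_closed[OF h(1) x(1)] lin_closed[OF h(1) \<rho>x'(1)]] by simp
      also have "p (h (\<rho> x)) = \<zero>\<^bsub>N\<^esub>" using h(2)[OF \<rho>x'(1)] \<rho>x'(2) lin_zero[OF g] by simp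
      also have "p (h x) \<ominus>\<^bsub>N\<^esub> \<zero>\<^bsub>N\<^esub> = g y"
        using h(2)[OF x(1)] x lin_closed[OF g, of y] y
        by (simp add: minus_zero_eq[OF N.right_module_axioms])
      finally show ?thesis .
    qed
    with g'(1) show "\<exists>g'. lin A (sub (R 0) ?Q') M g' \<and> (\<forall>x\<in>carrier (sub (R 0) ?Q'). p (g' x) = g x)"
      by auto
  qed
  obtain \<alpha> where \<alpha>: "lin A P (R 0) \<alpha>" "\<And>x. x \<in> carrier P \<Longrightarrow> e (\<alpha> x) = f x"
    using presents_lift[OF pres rD(8)] by blast
  obtain \<beta> where \<beta>: "lin A (R 0) P \<beta>" "\<And>x. x \<in> carrier (R 0) \<Longrightarrow> f (\<beta> x) = e x"
    using presents_lift[OF rD(8) pres] by blast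
  have Qeq: "x \<in> Q \<longleftrightarrow> x \<in> carrier P \<and> f x = \<zero>\<^bsub>X\<^esub>" for x using ker by (auto simp: hom_kernel_def)
  have \<alpha>Q: "lin A (sub P Q) (sub (R 0) ?Q') \<alpha>"
    by (rule lin_into_sub[OF lin_sub[OF \<alpha>(1) Q] Q'])
      (simp add: Qeq hom_kernel_def \<alpha> lin_closed[OF \<alpha>(1)])
  have \<beta>Q: "lin A (sub (R 0) ?Q') (sub P Q) \<beta>"
    by (rule lin_into_sub[OF lin_sub[OF \<beta>(1) Q'] Q])
      (simp add: Qeq hom_kernel_def \<beta> lin_closed[OF \<beta>(1)])
  define \<delta> where "\<delta> x = x \<ominus>\<^bsub>P\<^esub> \<beta> (\<alpha> x)" for x
  have \<delta>: "lin A P (sub P Q) \<delta>"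
  proof (rule lin_into_sub[OF _ Q])
    show \<delta>P: "lin A P P \<delta>"
      unfolding \<delta>_def[abs_def] by (rule lin_diff[OF lin_id[OF Mod_catD[OF P]] lin_compose[OF \<alpha>(1) \<beta>(1)]])
    show "\<delta> x \<in> Q" if "x \<in> carrier P" for x
    proof -
      have "f (\<delta> x) = \<zero>\<^bsub>X\<^esub>"
        using that lin_closed[OF \<alpha>(1) that] lin_closed[OF \<beta>(1)] lin_closed[OF f that]
        by (simp add: \<delta>_def lin_minus[OF f] \<alpha> \<beta> minus_eq_zero_iff[OF Mod_catD[OF X]])
      then show ?thesis using lin_closed[OF \<delta>P that] by (simp add: Qeq)
    qed
  qed
  show ?thesis
  proof (rule projectiveI[OF right_module_sub[OF Q]])
    fix M N :: "('a, 'm) rmodule" and p g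
    assume M: "M \<in> Mod_cat A" and N: "N \<in> Mod_cat A" and p: "lin A M N p" "p ` carrier M = carrier N"
      and g: "lin A (sub P Q) N g"
    obtain u where u: "lin A (sub (R 0) ?Q') M u" "\<And>x. x \<in> ?Q' \<Longrightarrow> p (u x) = g (\<beta> x)"
      using projectiveD[OF Q'proj M N p lin_compose[OF \<beta>Q g]] by auto
    obtain v where v: "lin A P M v" "\<And>x. x \<in> carrier P \<Longrightarrow> p (v x) = g (\<delta> x)"
      using projectiveD[OF proj M N p lin_compose[OF \<delta> g]] by blast
    interpret P: right_module A P by (rule Mod_catD[OF P])
    \<comment> \<open>On \<open>Q\<close> the identity is \<open>\<beta> \<circ> \<alpha>\<close>
      plus \<open>\<delta>\<close>. The first summand passes through the projective
      \<open>?Q'\<close>, the second extends to the projective \<open>P\<close>, and each is lifted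
      separately.\<close>
    let ?w = "\<lambda>x. u (\<alpha> x) \<oplus>\<^bsub>M\<^esub> v x"
    have "lin A (sub P Q) M ?w"
      by (rule lin_plus[OF lin_compose[OF \<alpha>Q u(1)] lin_sub[OF v(1) Q]])
    moreover have "p (?w x) = g x" if x: "x \<in> Q" for x
    proof -
      have xP: "x \<in> carrier P" using x by (simp add: Qeq)
      have \<alpha>x: "\<alpha> x \<in> ?Q'" using lin_closed[OF \<alpha>Q] x by simp
      have \<beta>x: "\<beta> (\<alpha> x) \<in> Q" using lin_closed[OF \<beta>Q] \<alpha>x by simp
      have \<delta>x: "\<delta> x \<in> Q" using lin_closed[OF \<delta> xP] by simp
      have "p (?w x) = g (\<beta> (\<alpha> x)) \<oplus>\<^bsub>N\<^esub> g (\<delta> x)"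
        using lin_add[OF p(1)] lin_closed[OF u(1)] lin_closed[OF v(1) xP] \<alpha>x u(2) v(2)[OF xP] by simp
      also have "\<dots> = g (\<beta> (\<alpha> x) \<oplus>\<^bsub>P\<^esub> \<delta> x)"
        using lin_add[OF g, of "\<beta> (\<alpha> x)" "\<delta> x"] \<beta>x \<delta>x by simp
      also have "\<beta> (\<alpha> x) \<oplus>\<^bsub>P\<^esub> \<delta> x = x"
        using xP \<beta>x by (simp add: \<delta>_def a_minus_def Qeq P.a_comm[of "\<beta> (\<alpha> x)"] P.a_assoc P.l_neg)
      finally show ?thesis .
    qed
    ultimately show "\<exists>w. lin A (sub P Q) M w \<and> (\<forall>x\<in>carrier (sub P Q). p (w x) = g x)" by auto
  qed
qed

end

section \<open>Finite generation\<close>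

text \<open>Generation is expressed by the submodules that contain \<open>B\<close>, without linear
  combinations, and relative to an ambient module so that nested submodules can be compared.\<close>

definition fin_gen :: "('a, 'r) ring_scheme \<Rightarrow> ('a, 'm) rmodule \<Rightarrow> 'm set \<Rightarrow> bool" where
  "fin_gen A M Q \<longleftrightarrow> (\<exists>B. finite B \<and> B \<subseteq> Q \<and> (\<forall>S. submod A M S \<longrightarrow> B \<subseteq> S \<longrightarrow> Q \<subseteq> S))"

lemma fin_gen_image:
  assumes f: "lin A M N f" and Q: "Q \<subseteq> carrier M" and fg: "fin_gen A M Q"
  shows "fin_gen A N (f ` Q)"
proof -
  obtain B where B: "finite B" "B \<subseteq> Q" "\<And>S. submod A M S \<Longrightarrow> B \<subseteq> S \<Longrightarrow> Q \<subseteq> S"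
    using fg by (auto simp: fin_gen_def)
  have "f ` Q \<subseteq> S" if S: "submod A N S" and sub: "f ` B \<subseteq> S" for S
    using B(3)[OF submod_vimage[OF f S]] B(2) Q sub by blast
  then show ?thesis
    unfolding fin_gen_def using B(1,2) by (intro exI[of _ "f ` B"]) auto
qed

lemma fin_gen_free:
  assumes "ring A" "finite J" shows "fin_gen A (free A J) (carrier (free A J))"
  unfolding fin_gen_def
proof (intro exI[of _ "unit_vec A J ` J"] conjI allI impI)
  show "carrier (free A J) \<subseteq> S" if "submod A (free A J) S" "unit_vec A J ` J \<subseteq> S" for S
    by (rule subsetI, rule free_span[OF assms(1) that(1)]) (use that(2) in auto)
qed (auto simp: assms unit_vec_closed)

lemma fin_gen_cover:
  assumes Q: "submod A M Q" and fg: "fin_gen A M Q"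
  obtains n and u where "lin A (free A {..<n::nat}) M u" "u ` carrier (free A {..<n}) = Q"
proof -
  obtain B where B: "finite B" "B \<subseteq> Q" "\<And>S. submod A M S \<Longrightarrow> B \<subseteq> S \<Longrightarrow> Q \<subseteq> S"
    using fg by (auto simp: fin_gen_def)
  obtain b and n :: nat where b: "B = b ` {..<n}"
    using B(1) by (metis finite_imp_nat_seg_image_inj_on lessThan_def)
  note M = submod_mod[OF Q]
  note A = right_module_ring[OF M]
  have bM: "b j \<in> carrier M" "b j \<in> Q" if "j \<in> {..<n}" for j
    using that B(2) b submod_subset[OF Q] by auto
  let ?u = "free_map A {..<n} M b"
  have u: "lin A (free A {..<n}) M ?u" by (rule lin_free_map[OF M bM(1)])
  have unit: "?u (unit_vec A {..<n} j) = b j" if "j \<in> {..<n}" for j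
    by (rule free_map_unit[OF M bM(1) that])
  have "?u v \<in> Q" if v: "v \<in> carrier (free A {..<n})" for v
  proof -
    have "v \<in> {v \<in> carrier (free A {..<n}). ?u v \<in> Q}"
    proof (rule free_span[OF A submod_vimage[OF u Q] _ v])
      fix j assume j: "j \<in> {..<n}"
      show "unit_vec A {..<n} j \<in> {v \<in> carrier (free A {..<n}). ?u v \<in> Q}"
        using unit[OF j] unit_vec_closed[OF A j] bM(2)[OF j] by simp
    qed
    then show ?thesis by simp
  qed
  moreover have "Q \<subseteq> ?u ` carrier (free A {..<n})"
  proof (rule B(3)[OF submod_image[OF u submod_carrier[OF right_module_free[OF A]]]])
    show "B \<subseteq> ?u ` carrier (free A {..<n})"
      unfolding b
    proof (rule image_subsetI)
      fix j assume j: "j \<in> {..<n}"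
      show "b j \<in> ?u ` carrier (free A {..<n})"
        by (rule image_eqI[where f = ?u, OF unit[OF j, symmetric] unit_vec_closed[OF A j]])
    qed
  qed
  ultimately have "?u ` carrier (free A {..<n}) = Q" by blast
  with u that show thesis by blast
qed

lemma finitely_presented_cover:
  assumes M: "right_module A M" and fp: "finitely_presented A M"
  obtains n and f where "lin A (free A {..<n::nat}) M f" "f ` carrier (free A {..<n}) = carrier M"
    "fin_gen A (free A {..<n}) (hom_kernel (free A {..<n}) M f)"
proof -
  note A = right_module_ring[OF M]
  obtain m n g f where g: "g \<in> mod_hom A (free A {..<m::nat}) (free A {..<n::nat})"
    and f: "f \<in> mod_hom A (free A {..<n}) M" "f ` carrier (free A {..<n}) = carrier M"
    and ker: "hom_kernel (free A {..<n}) M f = g ` carrier (free A {..<m})"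
    using fp unfolding finitely_presented_def free_rmodule_eq by (elim exE bexE conjE) (rule that)
  have "fin_gen A (free A {..<n}) (hom_kernel (free A {..<n}) M f)"
    unfolding ker
    by (rule fin_gen_image[OF mod_hom_lin[OF right_module_free[OF A] right_module_free[OF A] g]
          subset_refl fin_gen_free[OF A]]) simp
  then show thesis by (rule that[OF mod_hom_lin[OF right_module_free[OF A] M f(1)] f(2)])
qed

section \<open>Finite presentations and summands of projective modules\<close>

context ring_universe
begin

text \<open>\<open>finitely_presented\<close> asks for a free cover. A finite free cover
  \<open>u\<close> of \<open>P\<close> splits by projectivity, so the kernel of its composite with
  \<open>\<pi>\<close> is generated by lifts of generators of the kernel of \<open>\<pi>\<close>
  together with generators of the kernel of \<open>u\<close>.\<close>

lemma finitely_presentedI: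
  fixes P K :: "('a, 'm) rmodule"
  assumes P: "P \<in> Mod_cat A" "projective A P" and \<pi>: "lin A P K \<pi>" "\<pi> ` carrier P = carrier K"
    and fgP: "fin_gen A P (carrier P)" and fgL: "fin_gen A P (hom_kernel P K \<pi>)"
  shows "finitely_presented A K"
proof -
  interpret P: right_module A P by (rule lin_dom[OF \<pi>(1)])
  obtain n and u where u: "lin A (free A {..<n::nat}) P u" "u ` carrier (free A {..<n}) = carrier P"
    using fin_gen_cover[OF submod_carrier[OF P.right_module_axioms] fgP] by blast
  let ?F = "free A {..<n}"
  interpret F: right_module A ?F by (rule right_module_free[OF ring])
  \<comment> \<open>Lifting against \<open>P\<close> is available only for modules on
    \<open>'m\<close>, hence the copy of the free module.\<close>
  obtain F :: "('a, 'm) rmodule" and c d where F: "F \<in> Mod_cat A" and c: "lin A ?F F c" and d: "lin A F ?F d"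
    and dc: "\<And>x. x \<in> carrier ?F \<Longrightarrow> d (c x) = x"
    by (rule copy_exists[OF right_module_free[OF ring] free_small[OF finite_small[OF finite_lessThan[of n]]]]) (rule that)
  have surj: "(\<lambda>x. u (d x)) ` carrier F = carrier P"
    by (rule image_compose_retraction[OF c d dc u(2)])
  obtain \<sigma> where \<sigma>: "lin A P F \<sigma>" "\<And>x. x \<in> carrier P \<Longrightarrow> u (d (\<sigma> x)) = x"
    by (rule projectiveD[OF P(2) F P(1) lin_compose[OF d u(1)] surj lin_id[OF P.right_module_axioms]])
      (rule that)
  define s where "s x = d (\<sigma> x)" for x
  have s: "lin A P ?F s" unfolding s_def[abs_def] by (rule lin_compose[OF \<sigma>(1) d])
  have us: "u (s x) = x" if "x \<in> carrier P" for x using \<sigma>(2) that by (simp add: s_def)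
  let ?\<phi> = "\<lambda>v. \<pi> (u v)"
  have \<phi>: "lin A ?F K ?\<phi>" by (rule lin_compose[OF u(1) \<pi>(1)])
  let ?N = "hom_kernel ?F K ?\<phi>"
  \<comment> \<open>The projection of the free module onto the kernel of \<open>u\<close>; its
    values on the unit vectors generate that kernel.\<close>
  define \<kappa> where "\<kappa> v = v \<ominus>\<^bsub>?F\<^esub> s (u v)" for v
  have \<kappa>: "lin A ?F ?F \<kappa>"
    unfolding \<kappa>_def[abs_def] by (rule lin_diff[OF lin_id[OF F.right_module_axioms] lin_compose[OF u(1) s]])
  have u\<kappa>: "u (\<kappa> v) = \<zero>\<^bsub>P\<^esub>" if v: "v \<in> carrier ?F" for v
    using v lin_closed[OF u(1) v] lin_closed[OF s]
    by (simp add: \<kappa>_def lin_minus[OF u(1)] us minus_eq_zero_iff[OF P.right_module_axioms])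
  obtain B where B: "finite B" "B \<subseteq> hom_kernel P K \<pi>"
    "\<And>S. submod A P S \<Longrightarrow> B \<subseteq> S \<Longrightarrow> hom_kernel P K \<pi> \<subseteq> S"
    using fgL by (auto simp: fin_gen_def)
  let ?B = "s ` B \<union> (\<lambda>i. \<kappa> (unit_vec A {..<n} i)) ` {..<n}"
  have "fin_gen A ?F ?N"
    unfolding fin_gen_def
  proof (intro exI[of _ ?B] conjI allI impI)
    show "finite ?B" using B(1) by simp
    have "\<kappa> (unit_vec A {..<n} i) \<in> ?N" if "i < n" for i
      using that lin_closed[OF \<kappa>] unit_vec_closed[OF ring, of i "{..<n}"] lin_zero[OF \<pi>(1)]
      by (simp add: hom_kernel_def u\<kappa>)
    moreover have "s x \<in> ?N" if "x \<in> B" for x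
    proof -
      have "x \<in> carrier P" "\<pi> x = \<zero>\<^bsub>K\<^esub>" using that B(2) by (auto simp: hom_kernel_def)
      then show ?thesis by (simp add: hom_kernel_def us lin_closed[OF s])
    qed
    ultimately show "?B \<subseteq> ?N" by auto
    fix S assume S: "submod A ?F S" and sub: "?B \<subseteq> S"
    show "?N \<subseteq> S"
    proof
      fix v assume v: "v \<in> ?N"
      then have vF: "v \<in> carrier ?F" by (simp add: hom_kernel_def)
      have "hom_kernel P K \<pi> \<subseteq> {x \<in> carrier P. s x \<in> S}"
        by (rule B(3)[OF submod_vimage[OF s S]]) (use sub B(2) in \<open>auto simp: hom_kernel_def\<close>)
      moreover have "u v \<in> hom_kernel P K \<pi>"
        using v lin_closed[OF u(1)] by (simp add: hom_kernel_def)
      ultimately have 1: "s (u v) \<in> S" by blast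
      have "v \<in> {v \<in> carrier ?F. \<kappa> v \<in> S}"
        by (rule free_span[OF ring submod_vimage[OF \<kappa> S] _ vF]) (use sub in \<open>auto simp: unit_vec_closed[OF ring]\<close>)
      then have "\<kappa> v \<oplus>\<^bsub>?F\<^esub> s (u v) \<in> S" using 1 submod_add[OF S] by blast
      moreover have "\<kappa> v \<oplus>\<^bsub>?F\<^esub> s (u v) = v"
        using vF lin_closed[OF s lin_closed[OF u(1) vF]]
        by (simp add: \<kappa>_def a_minus_def F.a_assoc F.l_neg)
      ultimately show "v \<in> S" by simp
    qed
  qed
  then obtain m g where g: "lin A (free A {..<m::nat}) ?F g" "g ` carrier (free A {..<m}) = ?N"
    using fin_gen_cover[OF submod_kernel[OF \<phi>]] by blast
  have "?\<phi> ` carrier ?F = carrier K" using u(2) \<pi>(2) by (metis image_image)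
  then have "restrict ?\<phi> (carrier ?F) ` carrier ?F = carrier K" by simp
  moreover have "hom_kernel ?F K (restrict ?\<phi> (carrier ?F)) = restrict g (carrier (free A {..<m})) ` carrier (free A {..<m})"
    using g(2) by (auto simp: hom_kernel_def)
  ultimately show ?thesis
    unfolding finitely_presented_def free_rmodule_eq
    using lin_restrict[OF \<phi>] lin_restrict[OF g(1)] by blast
qed

text \<open>A splitting of the canonical cover by the free module on all elements of
  \<open>P\<close>. The coordinates of \<open>s x\<close> are the values at \<open>x\<close> of the
  dual functionals, finitely many of them nonzero.\<close>

lemma dual_basis:
  fixes P :: "('a, 'm) rmodule"
  assumes P: "P \<in> Mod_cat A" "projective A P"
  obtains s where "lin A P (free A (carrier P)) s"
    "\<And>x. x \<in> carrier P \<Longrightarrow> free_map A (carrier P) P (\<lambda>y. y) (s x) = x"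
proof -
  let ?J = "carrier P" and ?r = "free_map A (carrier P) P (\<lambda>y. y)"
  have r: "lin A (free A ?J) P ?r" by (rule lin_free_map[OF Mod_catD[OF P(1)]])
  obtain F :: "('a, 'm) rmodule" and c d where F: "F \<in> Mod_cat A" and c: "lin A (free A ?J) F c"
    and d: "lin A F (free A ?J) d" and dc: "\<And>x. x \<in> carrier (free A ?J) \<Longrightarrow> d (c x) = x"
    by (rule copy_exists[OF right_module_free[OF ring] free_small[OF Mod_cat_small[OF P(1)]]]) (rule that)
  have surj: "(\<lambda>y. ?r (d y)) ` carrier F = carrier P"
    by (rule image_compose_retraction[OF c d dc free_map_surj[OF Mod_catD[OF P(1)]]])
  obtain \<sigma> where \<sigma>: "lin A P F \<sigma>" "\<And>x. x \<in> carrier P \<Longrightarrow> ?r (d (\<sigma> x)) = x"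
    by (rule projectiveD[OF P(2) F P(1) lin_compose[OF d r] surj lin_id[OF Mod_catD[OF P(1)]]])
      (rule that)
  with that[OF lin_compose[OF \<sigma>(1) d]] show thesis by blast
qed

end

text \<open>View \<open>P\<close> as the summand \<open>s P\<close> of a free module. Only finitely
  many coordinates \<open>T\<close> occur in \<open>C\<close>, and the desired summand is the
  intersection of \<open>s P\<close> with \<open>free A T\<close>. It is the kernel of
  \<open>\<psi>\<close>, whose image lies in a free module and is therefore projective. Hence the
  intersection is a summand of \<open>free A T\<close>, which makes it finitely generated, and also
  a summand of the big free module, hence of \<open>P\<close>.\<close>

lemma (in hereditary_universe) finite_subset_in_fin_gen_summand:
  fixes P :: "('a, 'm) rmodule"
  assumes P: "P \<in> Mod_cat A" "projective A P" and C: "finite C" "C \<subseteq> carrier P"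
  obtains \<rho> where "lin A P P \<rho>" "\<And>x. x \<in> carrier P \<Longrightarrow> \<rho> (\<rho> x) = \<rho> x" "\<And>x. x \<in> C \<Longrightarrow> \<rho> x = x"
    "fin_gen A P (\<rho> ` carrier P)"
proof -
  let ?J = "carrier P"
  note PM = Mod_catD[OF P(1)]
  obtain s where s: "lin A P (free A ?J) s"
    and rs: "\<And>x. x \<in> carrier P \<Longrightarrow> free_map A ?J P (\<lambda>y. y) (s x) = x"
    using dual_basis[OF P] by blast
  let ?r = "free_map A ?J P (\<lambda>y. y)"
  have r: "lin A (free A ?J) P ?r" by (rule lin_free_map[OF PM])
  define T where "T = (\<Union>x\<in>C. supp ?J (\<lambda>_. reg A) (s x))"
  have T: "finite T" "T \<subseteq> ?J"
    using C lin_closed[OF s] by (auto simp: T_def supp_def carrier_dsum)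
  let ?m = "free_map A T P (\<lambda>y. y)"
  have m: "lin A (free A T) P ?m" using T by (intro lin_free_map[OF PM]) auto
  define \<iota> where "\<iota> w = (\<lambda>j\<in>?J. if j \<in> T then w j else \<zero>\<^bsub>A\<^esub>)" for w :: "'m \<Rightarrow> 'a"
  define \<tau> where "\<tau> v = (\<lambda>j\<in>T. v j)" for v :: "'m \<Rightarrow> 'a"
  have \<iota>: "lin A (free A T) (free A ?J) \<iota>"
    unfolding \<iota>_def[abs_def]
  proof (rule lin_dsum_tuple[OF ring right_module_free[OF ring]])
    show "lin A (free A T) (reg A) (\<lambda>w. if j \<in> T then w j else \<zero>\<^bsub>A\<^esub>)" for j
      using lin_dsum_proj[where J = T and F = "\<lambda>_. reg A" and j = j, OF ring right_module_reg[OF ring]]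
        lin_const_zero[OF right_module_free[OF ring] right_module_reg[OF ring], of T]
      by (cases "j \<in> T") (simp_all add: zero_reg)
    show "finite {j \<in> ?J. (if j \<in> T then w j else \<zero>\<^bsub>A\<^esub>) \<noteq> \<zero>\<^bsub>reg A\<^esub>}" for w
      by (rule finite_subset[OF _ T(1)]) (auto simp: zero_reg split: if_splits)
  qed
  have \<tau>: "lin A (free A ?J) (free A T) \<tau>"
    unfolding \<tau>_def[abs_def]
    by (rule lin_dsum_tuple[OF ring right_module_free[OF ring] lin_dsum_proj[OF ring right_module_reg[OF ring]]])
      (use T in auto)
  have r\<iota>: "?r (\<iota> w) = ?m w" if "w \<in> carrier (free A T)" for w
  proof (rule free_lin_eqI[OF lin_compose[OF \<iota> r] m _ that])
    fix j assume j: "j \<in> T"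
    have "\<iota> (unit_vec A T j) = unit_vec A ?J j" using T j by (auto simp: \<iota>_def single_def zero_reg)
    then show "?r (\<iota> (unit_vec A T j)) = ?m (unit_vec A T j)"
      using T j by (simp add: free_map_unit[OF PM] subset_iff)
  qed
  have \<tau>\<iota>: "\<tau> (\<iota> w) = w" if "w \<in> carrier (free A T)" for w
    using that T by (auto simp: \<tau>_def \<iota>_def carrier_dsum PiE_iff extensional_def fun_eq_iff)
  \<comment> \<open>The identity minus the idempotent \<open>s \<circ> ?r\<close>, restricted to the
    coordinates in \<open>T\<close>; note that \<open>?r \<circ> \<iota>\<close> is
    \<open>?m\<close>.\<close>
  define \<psi> where "\<psi> w = \<iota> w \<ominus>\<^bsub>free A ?J\<^esub> s (?m w)" for w
  have \<psi>: "lin A (free A T) (free A ?J) \<psi>"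
    unfolding \<psi>_def[abs_def] by (rule lin_diff[OF \<iota> lin_compose[OF m s]])
  have \<psi>0: "\<psi> w = \<zero>\<^bsub>free A ?J\<^esub> \<longleftrightarrow> \<iota> w = s (?m w)" if "w \<in> carrier (free A T)" for w
    unfolding \<psi>_def using lin_closed[OF \<iota> that] lin_closed[OF lin_compose[OF m s] that]
    by (rule minus_eq_zero_iff[OF right_module_free[OF ring]])
  obtain F :: "('a, 'm) rmodule" and c d where F: "F \<in> Mod_cat A" "projective A F"
    and c: "lin A (free A ?J) F c" and d: "lin A F (free A ?J) d"
    and dc: "\<And>x. x \<in> carrier (free A ?J) \<Longrightarrow> d (c x) = x"
    by (rule free_copy_exists[OF Mod_cat_small[OF P(1)]]) (rule that)
  obtain F' :: "('a, 'm) rmodule" and c' d' where F': "F' \<in> Mod_cat A"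
    and c': "lin A (free A T) F' c'" and d': "lin A F' (free A T) d'"
    and dc': "\<And>x. x \<in> carrier (free A T) \<Longrightarrow> d' (c' x) = x"
    by (rule free_copy_exists[OF finite_small[OF T(1)]]) (rule that)
  let ?p = "\<lambda>w. c (\<psi> (d' w))"
  have p: "lin A F' F ?p" by (rule lin_compose[OF d' lin_compose[OF \<psi> c]])
  let ?G = "?p ` carrier F'"
  have G: "submod A F ?G" by (rule submod_image[OF p submod_carrier[OF Mod_catD[OF F']]])
  have p': "lin A F' (sub F ?G) ?p" by (rule lin_into_sub[OF p G]) simp
  \<comment> \<open>\<open>?G\<close> is projective, so the kernel of \<open>\<psi>\<close> is a summand of \<open>free A T\<close>.\<close>
  obtain \<sigma> where \<sigma>: "lin A (sub F ?G) F' \<sigma>" "\<And>y. y \<in> ?G \<Longrightarrow> ?p (\<sigma> y) = y"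
    using projectiveD[OF projective_sub[OF F G] F' Mod_cat_sub[OF F(1) G] p' _ lin_id[OF right_module_sub[OF G]]]
    by auto
  have G': "c (\<psi> w) \<in> ?G" if "w \<in> carrier (free A T)" for w
    by (rule image_eqI[OF _ lin_closed[OF c' that]]) (simp add: dc' that)
  \<comment> \<open>The projection of \<open>free A T\<close> onto the kernel of
    \<open>\<psi>\<close> that belongs to the section \<open>\<sigma>\<close>.\<close>
  define \<kappa> where "\<kappa> w = w \<ominus>\<^bsub>free A T\<^esub> d' (\<sigma> (c (\<psi> w)))" for w
  have c\<psi>: "lin A (free A T) (sub F ?G) (\<lambda>w. c (\<psi> w))"
    by (rule lin_into_sub[OF lin_compose[OF \<psi> c] G G'])
  have \<kappa>: "lin A (free A T) (free A T) \<kappa>"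
    unfolding \<kappa>_def[abs_def]
    by (rule lin_diff[OF lin_id[OF right_module_free[OF ring]] lin_compose[OF c\<psi> lin_compose[OF \<sigma>(1) d']]])
  have \<psi>\<kappa>: "\<psi> (\<kappa> w) = \<zero>\<^bsub>free A ?J\<^esub>" if w: "w \<in> carrier (free A T)" for w
  proof -
    have 1: "d' (\<sigma> (c (\<psi> w))) \<in> carrier (free A T)"
      by (rule lin_closed[OF lin_compose[OF c\<psi> lin_compose[OF \<sigma>(1) d']] w])
    have "c (\<psi> (d' (\<sigma> (c (\<psi> w))))) = c (\<psi> w)" by (rule \<sigma>(2)[OF G'[OF w]])
    then have "\<psi> (d' (\<sigma> (c (\<psi> w)))) = \<psi> w"
      using dc lin_closed[OF \<psi> 1] lin_closed[OF \<psi> w] by metis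
    then show ?thesis
      unfolding \<kappa>_def lin_minus[OF \<psi> w 1]
      using lin_closed[OF \<psi> w] by (simp add: minus_eq_zero_iff[OF right_module_free[OF ring]])
  qed
  have \<kappa>0: "\<kappa> w = w" if w: "w \<in> carrier (free A T)" "\<psi> w = \<zero>\<^bsub>free A ?J\<^esub>" for w
  proof -
    have "d' (\<sigma> (c (\<psi> w))) = \<zero>\<^bsub>free A T\<^esub>"
      using w lin_zero[OF c] lin_zero[OF \<sigma>(1)] lin_zero[OF d'] by simp
    then show ?thesis using w(1) by (simp add: \<kappa>_def minus_zero_eq[OF right_module_free[OF ring]])
  qed
  \<comment> \<open>Take coordinates, truncate to \<open>T\<close>, project onto the kernel of
    \<open>\<psi>\<close> and return to \<open>P\<close>. On that kernel \<open>s \<circ> ?m\<close>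
    is \<open>\<iota>\<close> and \<open>\<tau>\<close> undoes \<open>\<iota>\<close>, so
    \<open>\<rho>\<close> fixes its image in \<open>P\<close>.\<close>
  define \<rho> where "\<rho> x = ?m (\<kappa> (\<tau> (s x)))" for x
  have \<rho>: "lin A P P \<rho>"
    unfolding \<rho>_def[abs_def] by (rule lin_compose[OF s lin_compose[OF \<tau> lin_compose[OF \<kappa> m]]])
  have fixed: "\<rho> (?m w) = ?m w" if w: "w \<in> carrier (free A T)" "\<psi> w = \<zero>\<^bsub>free A ?J\<^esub>" for w
    using w \<psi>0[OF w(1)] \<tau>\<iota>[OF w(1)] \<kappa>0[OF w] by (simp add: \<rho>_def)
  have st: "\<tau> (s x) \<in> carrier (free A T)" if "x \<in> carrier P" for x
    by (rule lin_closed[OF lin_compose[OF s \<tau>] that])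
  show thesis
  proof (rule that[OF \<rho>])
    show "\<rho> (\<rho> x) = \<rho> x" if x: "x \<in> carrier P" for x
      using fixed[OF lin_closed[OF \<kappa> st[OF x]] \<psi>\<kappa>[OF st[OF x]]] by (simp add: \<rho>_def)
    show "\<rho> x = x" if x: "x \<in> C" for x
    proof -
      have xP: "x \<in> carrier P" using x C by blast
      have sx: "s x \<in> (\<Pi>\<^sub>E j\<in>?J. carrier A)" using lin_closed[OF s xP] by (simp add: carrier_dsum carrier_reg)
      have "s x j = \<zero>\<^bsub>A\<^esub>" if "j \<in> ?J" "j \<notin> T" for j using that x by (auto simp: T_def supp_def zero_reg)
      then have "\<iota> (\<tau> (s x)) = s x" using PiE_arb[OF sx] by (auto simp: \<iota>_def \<tau>_def)
      moreover from this have mx: "?m (\<tau> (s x)) = x" using r\<iota>[OF st[OF xP]] rs[OF xP] by simp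
      ultimately have "\<psi> (\<tau> (s x)) = \<zero>\<^bsub>free A ?J\<^esub>" using \<psi>0[OF st[OF xP]] by simp
      from fixed[OF st[OF xP] this] mx show ?thesis by simp
    qed
    have "\<rho> ` carrier P = (\<lambda>w. ?m (\<kappa> w)) ` carrier (free A T)"
    proof (intro equalityI subsetI)
      fix y assume "y \<in> (\<lambda>w. ?m (\<kappa> w)) ` carrier (free A T)"
      then obtain w where w: "w \<in> carrier (free A T)" "y = ?m (\<kappa> w)" by blast
      then show "y \<in> \<rho> ` carrier P"
        using fixed[OF lin_closed[OF \<kappa>] \<psi>\<kappa>] lin_closed[OF m lin_closed[OF \<kappa>]] by (metis image_eqI)
    qed (use st in \<open>auto simp: \<rho>_def\<close>)
    then show "fin_gen A P (\<rho> ` carrier P)"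
      using fin_gen_image[OF lin_compose[OF \<kappa> m] subset_refl fin_gen_free[OF ring T(1)]] by simp
  qed
qed

section \<open>Extensions, products and coproducts\<close>

text \<open>The condition passes to retracts of \<open>Y\<close>, in particular to copies of a
  direct sum or product on another type.\<close>

lemma unique_ext_iso:
  assumes c: "lin A Y Y' c" and d: "lin A Y' Y d" and cd: "\<And>y. y \<in> carrier Y' \<Longrightarrow> c (d y) = y"
    and ue: "unique_ext A P Q Y" and Q: "submod A P Q"
  shows "unique_ext A P Q Y'"
proof (rule unique_extI)
  fix g assume g: "lin A (sub P Q) Y' g"
  obtain h where h: "lin A P Y h" "\<And>x. x \<in> Q \<Longrightarrow> h x = d (g x)"
    using unique_ext_exists[OF ue lin_compose[OF g d]] by blast
  have "c (h x) = g x" if "x \<in> Q" for x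
    using h(2)[OF that] cd[OF lin_closed[OF g, of x]] that by simp
  then show "\<exists>h. lin A P Y' h \<and> (\<forall>x\<in>Q. h x = g x)" using lin_compose[OF h(1) c] by blast
next
  fix h x assume h: "lin A P Y' h" and ker: "\<And>x. x \<in> Q \<Longrightarrow> h x = \<zero>\<^bsub>Y'\<^esub>" and x: "x \<in> carrier P"
  have "d (h x) = \<zero>\<^bsub>Y\<^esub>"
    by (rule unique_ext_zero[OF ue lin_compose[OF h d] _ x]) (simp add: ker lin_zero[OF d])
  then show "h x = \<zero>\<^bsub>Y'\<^esub>" using cd[OF lin_closed[OF h x]] lin_zero[OF c] by metis
qed

text \<open>A five-lemma chase, which makes right perpendicular classes closed under extensions. The
  extension found in \<open>Z\<close> lifts to \<open>E\<close> because \<open>P\<close> is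
  projective; on \<open>Q\<close> the error between \<open>g\<close> and the lift lies in
  \<open>Y\<close>, where it can be extended once more.\<close>

lemma unique_ext_extension:
  fixes P E Z :: "('a, 'm) rmodule"
  assumes P: "P \<in> Mod_cat A" "projective A P" and Q: "submod A P Q"
    and E: "E \<in> Mod_cat A" and Z: "Z \<in> Mod_cat A"
    and i: "lin A Y E i" "inj_on i (carrier Y)" and q: "lin A E Z q" "q ` carrier E = carrier Z"
    and ex: "hom_kernel E Z q = i ` carrier Y"
    and ueY: "unique_ext A P Q Y" and ueZ: "unique_ext A P Q Z"
  shows "unique_ext A P Q E"
proof (rule unique_extI)
  fix g assume g: "lin A (sub P Q) E g"
  interpret E: right_module A E by (rule Mod_catD[OF E])
  have QP: "x \<in> carrier P" if "x \<in> Q" for x using that submod_subset[OF Q] by blast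
  obtain k where k: "lin A P Z k" "\<And>x. x \<in> Q \<Longrightarrow> k x = q (g x)"
    using unique_ext_exists[OF ueZ lin_compose[OF g q(1)]] by blast
  obtain l where l: "lin A P E l" "\<And>x. x \<in> carrier P \<Longrightarrow> q (l x) = k x"
    using projectiveD[OF P(2) E Z q k(1)] by blast
  have diff: "lin A (sub P Q) E (\<lambda>x. g x \<ominus>\<^bsub>E\<^esub> l x)" by (rule lin_diff[OF g lin_sub[OF l(1) Q]])
  have "g x \<ominus>\<^bsub>E\<^esub> l x \<in> i ` carrier Y" if x: "x \<in> carrier (sub P Q)" for x
  proof -
    have "q (g x \<ominus>\<^bsub>E\<^esub> l x) = \<zero>\<^bsub>Z\<^esub>"
      using x lin_closed[OF g x] lin_closed[OF l(1) QP] lin_closed[OF k(1) QP]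
      by (simp add: lin_minus[OF q(1)] l(2) QP k(2) minus_eq_zero_iff[OF lin_cod[OF q(1)]]
          lin_closed[OF q(1)])
    then show ?thesis using lin_closed[OF diff x] unfolding ex[symmetric] by (simp add: hom_kernel_def)
  qed
  then obtain m where m: "lin A (sub P Q) Y m" "\<And>x. x \<in> Q \<Longrightarrow> i (m x) = g x \<ominus>\<^bsub>E\<^esub> l x"
    using lin_lift_inj[OF i diff] by auto
  obtain n where n: "lin A P Y n" "\<And>x. x \<in> Q \<Longrightarrow> n x = m x"
    using unique_ext_exists[OF ueY m(1)] by blast
  have "i (n x) \<oplus>\<^bsub>E\<^esub> l x = g x" if "x \<in> Q" for x
    using that lin_closed[OF g, of x] lin_closed[OF l(1) QP]
    by (simp add: n m a_minus_def E.a_assoc E.l_neg)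
  then show "\<exists>h. lin A P E h \<and> (\<forall>x\<in>Q. h x = g x)"
    using lin_plus[OF lin_compose[OF n(1) i(1)] l(1)] by blast
next
  fix h x assume h: "lin A P E h" and ker: "\<And>x. x \<in> Q \<Longrightarrow> h x = \<zero>\<^bsub>E\<^esub>" and x: "x \<in> carrier P"
  have "q (h y) = \<zero>\<^bsub>Z\<^esub>" if "y \<in> carrier P" for y
    by (rule unique_ext_zero[OF ueZ lin_compose[OF h q(1)] _ that]) (simp add: ker lin_zero[OF q(1)])
  then have "h y \<in> i ` carrier Y" if "y \<in> carrier P" for y
    using that lin_closed[OF h that] unfolding ex[symmetric] by (simp add: hom_kernel_def)
  then obtain k where k: "lin A P Y k" "\<And>y. y \<in> carrier P \<Longrightarrow> i (k y) = h y"
    using lin_lift_inj[OF i h] by blast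
  have "k y = \<zero>\<^bsub>Y\<^esub>" if y: "y \<in> Q" for y
  proof (rule inj_onD[OF i(2)])
    have yP: "y \<in> carrier P" using y submod_subset[OF Q] by blast
    show "i (k y) = i \<zero>\<^bsub>Y\<^esub>" using k(2)[OF yP] ker[OF y] lin_zero[OF i(1)] by simp
    show "k y \<in> carrier Y" by (rule lin_closed[OF k(1) yP])
    show "\<zero>\<^bsub>Y\<^esub> \<in> carrier Y" by (rule submod_zero[OF submod_carrier[OF lin_dom[OF i(1)]]])
  qed
  then have "k x = \<zero>\<^bsub>Y\<^esub>" by (rule unique_ext_zero[OF ueY k(1) _ x])
  then show "h x = \<zero>\<^bsub>E\<^esub>" using k(2)[OF x] lin_zero[OF i(1)] by simp
qed

lemma unique_ext_dprod:
  assumes A: "ring A" and F: "\<And>j. j \<in> J \<Longrightarrow> right_module A (F j)" and P: "right_module A P"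
    and ue: "\<And>j. j \<in> J \<Longrightarrow> unique_ext A P Q (F j)"
  shows "unique_ext A P Q (dprod J F)"
proof (rule unique_extI)
  fix g assume g: "lin A (sub P Q) (dprod J F) g"
  have pr: "lin A (dprod J F) (F j) (\<lambda>v. v j)" if "j \<in> J" for j
    by (rule lin_dprod_proj[OF A F that])
  have "\<exists>h. lin A P (F j) h \<and> (\<forall>x\<in>Q. h x = g x j)" if j: "j \<in> J" for j
    by (rule unique_ext_exists[OF ue[OF j] lin_compose[OF g pr[OF j]]]) (intro exI conjI ballI)
  then have "\<exists>h. \<forall>j\<in>J. lin A P (F j) (h j) \<and> (\<forall>x\<in>Q. h j x = g x j)" by (intro bchoice ballI)
  then obtain h where hh: "\<forall>j\<in>J. lin A P (F j) (h j) \<and> (\<forall>x\<in>Q. h j x = g x j)" ..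
  have h: "\<And>j. j \<in> J \<Longrightarrow> lin A P (F j) (h j)" "\<And>j x. j \<in> J \<Longrightarrow> x \<in> Q \<Longrightarrow> h j x = g x j"
    using hh by simp_all
  have "(\<lambda>j\<in>J. h j x) = g x" if "x \<in> Q" for x
  proof -
    have gx: "g x \<in> (\<Pi>\<^sub>E j\<in>J. carrier (F j))"
      using lin_closed[OF g, of x] that by (simp add: carrier_dprod)
    show ?thesis using h(2)[OF _ that] PiE_arb[OF gx] by (auto simp: fun_eq_iff)
  qed
  moreover have "lin A P (dprod J F) (\<lambda>x. \<lambda>j\<in>J. h j x)" by (rule lin_dprod_tuple[OF A P h(1)])
  ultimately show "\<exists>h. lin A P (dprod J F) h \<and> (\<forall>x\<in>Q. h x = g x)"
    by (intro exI conjI ballI)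
next
  fix h x assume h: "lin A P (dprod J F) h" and ker: "\<And>x. x \<in> Q \<Longrightarrow> h x = \<zero>\<^bsub>dprod J F\<^esub>" and x: "x \<in> carrier P"
  have pr: "lin A (dprod J F) (F j) (\<lambda>v. v j)" if "j \<in> J" for j
    by (rule lin_dprod_proj[OF A F that])
  have z: "h x j = \<zero>\<^bsub>F j\<^esub>" if j: "j \<in> J" for j
    by (rule unique_ext_zero[OF ue[OF j] lin_compose[OF h pr[OF j]] _ x]) (simp add: ker zero_dprod j)
  have hx: "h x \<in> (\<Pi>\<^sub>E j\<in>J. carrier (F j))"
    using lin_closed[OF h x] by (simp add: carrier_dprod)
  show "h x = \<zero>\<^bsub>dprod J F\<^esub>"
    unfolding zero_dprod
  proof
    show "h x j = (\<lambda>j\<in>J. \<zero>\<^bsub>F j\<^esub>) j" for j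
      using z[of j] PiE_arb[OF hx, of j] by (cases "j \<in> J") simp_all
  qed
qed

text \<open>Finite generation of \<open>Q\<close> confines a homomorphism from \<open>Q\<close> into a coproduct to finitely many
  coordinates.\<close>

lemma unique_ext_dsum:
  assumes A: "ring A" and F: "\<And>j. j \<in> J \<Longrightarrow> right_module A (F j)"
    and Q: "submod A P Q" and fg: "fin_gen A P Q"
    and ue: "\<And>j. j \<in> J \<Longrightarrow> unique_ext A P Q (F j)"
  shows "unique_ext A P Q (dsum J F)"
proof (rule unique_extI)
  note P = submod_mod[OF Q]
  fix g assume g: "lin A (sub P Q) (dsum J F) g"
  have QP: "x \<in> carrier P" if "x \<in> Q" for x using that submod_subset[OF Q] by blast
  obtain B where B: "finite B" "B \<subseteq> Q" "\<And>S. submod A P S \<Longrightarrow> B \<subseteq> S \<Longrightarrow> Q \<subseteq> S"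
    using fg by (auto simp: fin_gen_def)
  have gm: "g x \<in> (\<Pi>\<^sub>E j\<in>J. carrier (F j))" "finite (supp J F (g x))" if "x \<in> Q" for x
    using lin_closed[OF g, of x] that by (simp_all add: carrier_dsum)
  define T where "T = (\<Union>x\<in>B. supp J F (g x))"
  have T: "finite T" "T \<subseteq> J" using B(1,2) gm by (auto simp: T_def supp_def)
  have zero: "g x j = \<zero>\<^bsub>F j\<^esub>" if j: "j \<in> J" "j \<notin> T" and x: "x \<in> Q" for j x
  proof -
    let ?K = "hom_kernel (sub P Q) (F j) (\<lambda>x. g x j)"
    have "submod A (sub P Q) ?K"
      by (rule submod_kernel[OF lin_compose[OF g lin_dsum_proj[OF A F j(1)]]])
    then have "submod A P ?K" by (rule submod_of_sub[OF _ Q])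
    moreover have "B \<subseteq> ?K" using j B(2) by (auto simp: hom_kernel_def T_def supp_def)
    ultimately have "Q \<subseteq> ?K" by (rule B(3))
    then show ?thesis using x by (auto simp: hom_kernel_def)
  qed
  have pr: "lin A (dsum J F) (F j) (\<lambda>v. v j)" if "j \<in> J" for j
    by (rule lin_dsum_proj[OF A F that])
  have "\<exists>h. lin A P (F j) h \<and> (\<forall>x\<in>Q. h x = g x j)" if j: "j \<in> J" for j
    by (rule unique_ext_exists[OF ue[OF j] lin_compose[OF g pr[OF j]]]) (intro exI conjI ballI)
  then have "\<exists>h. \<forall>j\<in>J. lin A P (F j) (h j) \<and> (\<forall>x\<in>Q. h j x = g x j)" by (intro bchoice ballI)
  then obtain h where hh: "\<forall>j\<in>J. lin A P (F j) (h j) \<and> (\<forall>x\<in>Q. h j x = g x j)" ..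
  have h: "\<And>j. j \<in> J \<Longrightarrow> lin A P (F j) (h j)" "\<And>j x. j \<in> J \<Longrightarrow> x \<in> Q \<Longrightarrow> h j x = g x j"
    using hh by simp_all
  \<comment> \<open>Uniqueness makes the chosen extensions vanish in every coordinate outside
    \<open>T\<close>, so together they land in the direct sum and not merely in the product.\<close>
  have h0: "h j x = \<zero>\<^bsub>F j\<^esub>" if "j \<in> J" "j \<notin> T" "x \<in> carrier P" for j x
    by (rule unique_ext_zero[OF ue[OF that(1)] h(1)[OF that(1)] _ that(3)])
      (simp add: h(2) that zero)
  have "(\<lambda>j\<in>J. h j x) = g x" if "x \<in> Q" for x
    using h(2)[OF _ that] PiE_arb[OF gm(1)[OF that]] by (auto simp: fun_eq_iff)
  moreover have "lin A P (dsum J F) (\<lambda>x. \<lambda>j\<in>J. h j x)"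
    by (rule lin_dsum_tuple[OF A P h(1)], assumption, rule finite_subset[OF _ T(1)]) (use h0 in blast)
  ultimately show "\<exists>h. lin A P (dsum J F) h \<and> (\<forall>x\<in>Q. h x = g x)"
    by (intro exI conjI ballI)
next
  fix h x assume h: "lin A P (dsum J F) h" and ker: "\<And>x. x \<in> Q \<Longrightarrow> h x = \<zero>\<^bsub>dsum J F\<^esub>" and x: "x \<in> carrier P"
  have pr: "lin A (dsum J F) (F j) (\<lambda>v. v j)" if "j \<in> J" for j
    by (rule lin_dsum_proj[OF A F that])
  have z: "h x j = \<zero>\<^bsub>F j\<^esub>" if j: "j \<in> J" for j
    by (rule unique_ext_zero[OF ue[OF j] lin_compose[OF h pr[OF j]] _ x]) (simp add: ker zero_dsum j)
  have hx: "h x \<in> (\<Pi>\<^sub>E j\<in>J. carrier (F j))"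
    using lin_closed[OF h x] by (simp add: carrier_dsum)
  show "h x = \<zero>\<^bsub>dsum J F\<^esub>"
    unfolding zero_dsum
  proof
    show "h x j = (\<lambda>j\<in>J. \<zero>\<^bsub>F j\<^esub>) j" for j
      using z[of j] PiE_arb[OF hx, of j] by (cases "j \<in> J") simp_all
  qed
qed

section \<open>Pushouts and categorical coproducts\<close>

context ring_universe
begin

text \<open>The extension of \<open>Z\<close> by \<open>Y\<close> classified by \<open>g\<close>:
  the quotient of the sum of \<open>P\<close> and \<open>Y\<close> by the pairs \<open>x\<close>,
  \<open>- g x\<close> with \<open>x\<close> in the kernel of \<open>f\<close>. Questions about
  extending \<open>g\<close> become questions about splitting \<open>q\<close>.\<close>

lemma pushout_exists:
  fixes P Y Z :: "('a, 'm) rmodule"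
  assumes P: "P \<in> Mod_cat A" and Y: "Y \<in> Mod_cat A" and f: "lin A P Z f" "f ` carrier P = carrier Z"
    and g: "lin A (sub P (hom_kernel P Z f)) Y g"
  obtains E :: "('a, 'm) rmodule" and i j q where "E \<in> Mod_cat A" "lin A Y E i" "inj_on i (carrier Y)"
    "lin A P E j" "lin A E Z q" "q ` carrier E = carrier Z" "hom_kernel E Z q = i ` carrier Y"
    "\<And>x. x \<in> hom_kernel P Z f \<Longrightarrow> j x = i (g x)" "\<And>x. x \<in> carrier P \<Longrightarrow> q (j x) = f x"
proof -
  let ?Q = "hom_kernel P Z f"
  interpret P: right_module A P by (rule Mod_catD[OF P])
  interpret Y: right_module A Y by (rule Mod_catD[OF Y])
  interpret Z: right_module A Z by (rule lin_cod[OF f(1)])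
  have Q: "submod A P ?Q" by (rule submod_kernel[OF f(1)])
  \<comment> \<open>The binary sum is the product over \<open>bool\<close>, with \<open>P\<close> at
    \<open>True\<close> and \<open>Y\<close> at \<open>False\<close>.\<close>
  define G where "G b = (if b then P else Y)" for b
  have G: "right_module A (G b)" for b by (simp add: G_def P.right_module_axioms Y.right_module_axioms)
  let ?D = "dprod UNIV G"
  interpret D: right_module A ?D by (rule right_module_dprod[OF ring G])
  define pr where "pr x y = (\<lambda>b. if b then x else y)" for x y :: 'm
  have prD: "pr x y \<in> carrier ?D" if "x \<in> carrier P" "y \<in> carrier Y" for x y
    using that by (auto simp: carrier_dprod pr_def G_def)
  have pr_lin: "lin A N ?D (\<lambda>z. pr (h z) (k z))" if "lin A N P h" "lin A N Y k" for N h k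
  proof -
    have "lin A N ?D (\<lambda>z. \<lambda>b\<in>UNIV. (if b then h else k) z)"
      by (rule lin_dprod_tuple[OF ring lin_dom[OF that(1)]]) (simp add: G_def that)
    then show ?thesis by (rule lin_cong) (auto simp: pr_def)
  qed
  have fst: "lin A ?D P (\<lambda>v. v True)" and snd: "lin A ?D Y (\<lambda>v. v False)"
    using lin_dprod_proj[where F = G and J = UNIV, OF ring G UNIV_I, of True]
      lin_dprod_proj[where F = G and J = UNIV, OF ring G UNIV_I, of False] by (simp_all add: G_def)
  have neg0: "\<ominus>\<^bsub>Y\<^esub> \<zero>\<^bsub>Y\<^esub> = \<zero>\<^bsub>Y\<^esub>" by (rule Y.minus_equality) simp_all
  have zeroD: "\<zero>\<^bsub>?D\<^esub> = pr \<zero>\<^bsub>P\<^esub> \<zero>\<^bsub>Y\<^esub>" by (auto simp: zero_dprod pr_def G_def)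
  define k where "k x = pr x (\<ominus>\<^bsub>Y\<^esub> g x)" for x
  have k: "lin A (sub P ?Q) ?D k"
    unfolding k_def[abs_def] by (rule pr_lin[OF lin_inclusion[OF Q] lin_uminus[OF g]])
  have S: "submod A ?D (k ` ?Q)"
    using submod_image[OF k submod_carrier[OF right_module_sub[OF Q]]] by simp
  have "small U (carrier P \<union> carrier Y)"
    using Union_small[of "UNIV :: bool set" "\<lambda>b. carrier (G b)"] finite_small[of "UNIV :: bool set"]
      Mod_cat_small P Y by (simp add: G_def UNIV_bool Un_commute)
  then have "small U (carrier ?D)"
    by (rule dprod_small[OF finite_small[OF finite_UNIV], rotated]) (auto simp: G_def)
  then obtain E :: "('a, 'm) rmodule" and c where E: "E \<in> Mod_cat A" and c: "lin A ?D E c"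
    and surj: "c ` carrier ?D = carrier E" and ker: "hom_kernel ?D E c = k ` ?Q"
    by (rule quotient_exists[OF S]) (rule that)
  interpret E: right_module A E by (rule Mod_catD[OF E])
  have c0: "c v = \<zero>\<^bsub>E\<^esub> \<longleftrightarrow> v \<in> k ` ?Q" if "v \<in> carrier ?D" for v
    using that unfolding ker[symmetric] by (simp add: hom_kernel_def)
  have f0: "f x = \<zero>\<^bsub>Z\<^esub>" "x \<in> carrier P" if "x \<in> ?Q" for x using that by (simp_all add: hom_kernel_def)
  define i where "i y = c (pr \<zero>\<^bsub>P\<^esub> y)" for y
  define j where "j x = c (pr x \<zero>\<^bsub>Y\<^esub>)" for x
  have i: "lin A Y E i"
    unfolding i_def[abs_def]
    by (rule lin_compose[OF pr_lin[OF lin_const_zero[OF Y.right_module_axioms P.right_module_axioms]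
          lin_id[OF Y.right_module_axioms]] c])
  have j: "lin A P E j"
    unfolding j_def[abs_def]
    by (rule lin_compose[OF pr_lin[OF lin_id[OF P.right_module_axioms]
          lin_const_zero[OF P.right_module_axioms Y.right_module_axioms]] c])
  have inj: "inj_on i (carrier Y)"
  proof (rule lin_kernel_inj[OF i])
    fix y assume y: "y \<in> carrier Y" "i y = \<zero>\<^bsub>E\<^esub>"
    then obtain x where x: "x \<in> ?Q" "pr \<zero>\<^bsub>P\<^esub> y = pr x (\<ominus>\<^bsub>Y\<^esub> g x)"
      using c0[OF prD[OF P.zero_closed y(1)]] by (auto simp: i_def k_def)
    from fun_cong[OF x(2), of True] have "x = \<zero>\<^bsub>P\<^esub>" by (simp add: pr_def)
    moreover from fun_cong[OF x(2), of False] have "y = \<ominus>\<^bsub>Y\<^esub> g x" by (simp add: pr_def)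
    ultimately show "y = \<zero>\<^bsub>Y\<^esub>" using lin_zero[OF g] neg0 by simp
  qed
  have ji: "j x = i (g x)" if x: "x \<in> ?Q" for x
  proof -
    have gx: "g x \<in> carrier Y" using lin_closed[OF g, of x] x by simp
    have xP: "x \<in> carrier P" using f0(2)[OF x] .
    have "pr x \<zero>\<^bsub>Y\<^esub> = k x \<oplus>\<^bsub>?D\<^esub> pr \<zero>\<^bsub>P\<^esub> (g x)"
      using gx xP by (auto simp: add_dprod pr_def k_def G_def Y.l_neg)
    then have "j x = c (k x) \<oplus>\<^bsub>E\<^esub> i (g x)"
      using lin_add[OF c, of "k x" "pr \<zero>\<^bsub>P\<^esub> (g x)"] lin_closed[OF k, of x] x prD[OF P.zero_closed gx]
      by (simp add: j_def i_def)
    moreover have "c (k x) = \<zero>\<^bsub>E\<^esub>" using c0 lin_closed[OF k, of x] x by simp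
    ultimately show ?thesis using lin_closed[OF i gx] by simp
  qed
  have "f (v True) = \<zero>\<^bsub>Z\<^esub>" if "v \<in> carrier ?D" "c v = \<zero>\<^bsub>E\<^esub>" for v
  proof -
    have "v \<in> k ` ?Q" using that c0 by simp
    then show ?thesis using f0 by (auto simp: k_def pr_def)
  qed
  then obtain q where q: "lin A E Z q" "\<And>v. v \<in> carrier ?D \<Longrightarrow> q (c v) = f (v True)"
    using lin_factor[OF c lin_compose[OF fst f(1)] surj] by blast
  have qj: "q (j x) = f x" if "x \<in> carrier P" for x
    using q(2)[OF prD[OF that Y.zero_closed]] by (simp add: j_def pr_def)
  have "f x \<in> q ` carrier E" if "x \<in> carrier P" for x
    by (rule image_eqI[OF _ lin_closed[OF j that]]) (simp add: qj that)
  then have qs: "q ` carrier E = carrier Z"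
    using lin_closed[OF q(1)] unfolding f(2)[symmetric] by blast
  have "hom_kernel E Z q = i ` carrier Y"
  proof (intro equalityI subsetI)
    fix z assume "z \<in> i ` carrier Y"
    then obtain y where y: "y \<in> carrier Y" "z = i y" by blast
    then show "z \<in> hom_kernel E Z q"
      using q(2)[OF prD[OF P.zero_closed y(1)]] lin_closed[OF i y(1)] lin_zero[OF f(1)]
      by (simp add: hom_kernel_def i_def pr_def)
  next
    fix z assume z: "z \<in> hom_kernel E Z q"
    then obtain v where v: "v \<in> carrier ?D" "z = c v" using surj by (auto simp: hom_kernel_def)
    have v': "v True \<in> carrier P" "v False \<in> carrier Y"
      using lin_closed[OF fst v(1)] lin_closed[OF snd v(1)] by simp_all
    have vQ: "v True \<in> ?Q" using z v q(2)[OF v(1)] v' by (simp add: hom_kernel_def)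
    have "v = pr (v True) \<zero>\<^bsub>Y\<^esub> \<oplus>\<^bsub>?D\<^esub> pr \<zero>\<^bsub>P\<^esub> (v False)"
    proof
      fix b show "v b = (pr (v True) \<zero>\<^bsub>Y\<^esub> \<oplus>\<^bsub>?D\<^esub> pr \<zero>\<^bsub>P\<^esub> (v False)) b"
        using v' by (cases b) (simp_all add: add_dprod pr_def G_def)
    qed
    then have "z = j (v True) \<oplus>\<^bsub>E\<^esub> i (v False)"
      using lin_add[OF c prD[OF v'(1) Y.zero_closed] prD[OF P.zero_closed v'(2)]] v(2)
      by (simp add: i_def j_def)
    also have "\<dots> = i (g (v True) \<oplus>\<^bsub>Y\<^esub> v False)"
      using ji[OF vQ] lin_add[OF i _ v'(2), of "g (v True)"] lin_closed[OF g, of "v True"] vQ by simp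
    finally show "z \<in> i ` carrier Y"
      using lin_closed[OF g, of "v True"] vQ v' by simp
  qed
  from that[OF E i inj j q(1) qs this ji qj] show thesis by blast
qed

lemma family_small:
  fixes F :: "'i \<Rightarrow> ('a, 'm) rmodule"
  assumes "small U J" "\<And>j. j \<in> J \<Longrightarrow> F j \<in> Mod_cat A"
  shows "small U (carrier (dprod J F))" "small U (carrier (dsum J F))"
proof -
  have "small U (\<Union>j\<in>J. carrier (F j))"
    using assms by (intro Union_small Mod_cat_small) auto
  then show "small U (carrier (dprod J F))" "small U (carrier (dsum J F))"
    using assms(1) by (intro dprod_small dsum_small; auto)+
qed

text \<open>Besides the universal property, the identification with \<open>dsum\<close> is returned,
  since later arguments inspect supports of elements of the coproduct.\<close>

lemma coproduct_exists:
  fixes F :: "'m \<Rightarrow> ('a, 'm) rmodule"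
  assumes J: "small U J" and F: "\<And>j. j \<in> J \<Longrightarrow> F j \<in> Mod_cat A"
  obtains C \<iota> c d where "is_coproduct A J F C \<iota>" "lin A (dsum J F) C c" "lin A C (dsum J F) d"
    "\<And>v. v \<in> carrier (dsum J F) \<Longrightarrow> d (c v) = v" "\<And>x. x \<in> carrier C \<Longrightarrow> c (d x) = x"
proof -
  have FM: "right_module A (F j)" if "j \<in> J" for j using F[OF that] by (rule Mod_catD)
  have DM: "right_module A (dsum J F)" by (rule right_module_dsum[OF ring FM])
  have Dsmall: "small U (carrier (dsum J F))" by (rule family_small(2)[OF J F])
  obtain C :: "('a, 'm) rmodule" and c d where C: "C \<in> Mod_cat A" and c: "lin A (dsum J F) C c"
    and d: "lin A C (dsum J F) d"
    and dc: "\<And>x. x \<in> carrier (dsum J F) \<Longrightarrow> d (c x) = x" and cd: "\<And>y. y \<in> carrier C \<Longrightarrow> c (d y) = y"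
    by (fact copy_exists[OF DM Dsmall])
  have s: "lin A (F j) (dsum J F) (single J F j)" if "j \<in> J" for j
    by (rule lin_single[where F = F, OF ring FM that])
  define \<iota> where "\<iota> j = restrict (\<lambda>x. c (single J F j x)) (carrier (F j))" for j
  have "is_coproduct A J F C \<iota>"
    unfolding is_coproduct_def
  proof (intro conjI ballI allI impI C)
    show "\<iota> j \<in> mod_hom A (F j) C" if "j \<in> J" for j
      unfolding \<iota>_def by (rule lin_restrict[OF lin_compose[OF s[OF that] c]])
    fix N :: "('a, 'm) rmodule" and g
    assume N: "N \<in> Mod_cat A" and g: "\<forall>i\<in>J. g i \<in> mod_hom A (F i) N"
    have gl: "lin A (F j) N (g j)" if "j \<in> J" for j
      using mod_hom_lin[OF FM[OF that] Mod_catD[OF N]] g that by blast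
    let ?h = "restrict (\<lambda>x. total J F N g (d x)) (carrier C)"
    have t: "lin A (dsum J F) N (total J F N g)" by (rule lin_total[OF ring Mod_catD[OF N] gl])
    have ts: "total J F N g (single J F j x) = g j x" if "j \<in> J" "x \<in> carrier (F j)" for j x
      by (rule total_single[where F = F and g = g, OF ring Mod_catD[OF N] gl that])
    show "\<exists>!h. h \<in> mod_hom A C N \<and> (\<forall>i\<in>J. compose (carrier (F i)) h (\<iota> i) = g i)"
    proof (rule ex1I[of _ ?h])
      show "?h \<in> mod_hom A C N \<and> (\<forall>i\<in>J. compose (carrier (F i)) ?h (\<iota> i) = g i)"
      proof (intro conjI ballI)
        show "?h \<in> mod_hom A C N" by (rule lin_restrict[OF lin_compose[OF d t]])
        fix i assume i: "i \<in> J"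
        show "compose (carrier (F i)) ?h (\<iota> i) = g i"
        proof
          fix x show "compose (carrier (F i)) ?h (\<iota> i) x = g i x"
            using i g extensional_arb[OF mod_hom_extensional[of "g i" A "F i" N], of x]
              lin_closed[OF s[OF i]] lin_closed[OF c]
              ts[OF i]
            by (cases "x \<in> carrier (F i)") (auto simp: compose_def \<iota>_def dc)
        qed
      qed
      fix h assume h: "h \<in> mod_hom A C N \<and> (\<forall>i\<in>J. compose (carrier (F i)) h (\<iota> i) = g i)"
      have hl: "lin A C N h" using mod_hom_lin[OF Mod_catD[OF C] Mod_catD[OF N]] h by blast
      have eq: "h (c v) = total J F N g v" if v: "v \<in> carrier (dsum J F)" for v
      proof -
        have "v \<in> {v \<in> carrier (dsum J F). h (c v) = total J F N g v}"
        proof (rule dsum_span[OF ring FM submod_equalizer[OF lin_compose[OF c hl] t] _ v])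
          fix j x assume j: "j \<in> J" and x: "x \<in> carrier (F j)"
          have "compose (carrier (F j)) h (\<iota> j) x = g j x" using h j by simp
          then have "h (\<iota> j x) = g j x" using x by (simp add: compose_def)
          then show "single J F j x \<in> {v \<in> carrier (dsum J F). h (c v) = total J F N g v}"
            using x lin_closed[OF s[OF j] x] ts[OF j x]
            by (simp add: \<iota>_def)
        qed
        then show ?thesis by simp
      qed
      show "h = ?h"
        by (rule mod_hom_eqI[of _ A C N])
          (use h eq[OF lin_closed[OF d]] cd lin_restrict[OF lin_compose[OF d t]] in auto)
    qed
  qed
  from that[OF this c d dc cd] show thesis by blast
qed

text \<open>Lets the concrete direct sum stand for an arbitrary coproduct; the retraction is in the
  form that \<open>unique_ext_iso\<close> asks for.\<close>

lemma coproduct_unique: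
  fixes F :: "'i \<Rightarrow> ('a, 'm) rmodule"
  assumes C: "is_coproduct A J F C \<iota>" and C': "is_coproduct A J F C' \<iota>'"
  obtains h k where "lin A C C' h" "lin A C' C k" "\<And>x. x \<in> carrier C' \<Longrightarrow> h (k x) = x"
proof -
  have M: "C \<in> Mod_cat A" "C' \<in> Mod_cat A" using C C' by (simp_all add: is_coproduct_def)
  have \<iota>: "\<And>i. i \<in> J \<Longrightarrow> \<iota> i \<in> mod_hom A (F i) C" and \<iota>': "\<And>i. i \<in> J \<Longrightarrow> \<iota>' i \<in> mod_hom A (F i) C'"
    using C C' by (simp_all add: is_coproduct_def)
  obtain h where h: "h \<in> mod_hom A C C'" "\<And>i. i \<in> J \<Longrightarrow> compose (carrier (F i)) h (\<iota> i) = \<iota>' i"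
    using C M(2) \<iota>' unfolding is_coproduct_def by metis
  obtain k where k: "k \<in> mod_hom A C' C" "\<And>i. i \<in> J \<Longrightarrow> compose (carrier (F i)) k (\<iota>' i) = \<iota> i"
    using C' M(1) \<iota> unfolding is_coproduct_def by metis
  have hl: "lin A C C' h" and kl: "lin A C' C k"
    using mod_hom_lin Mod_catD M h(1) k(1) by blast+
  let ?u = "restrict (\<lambda>x. h (k x)) (carrier C')" and ?v = "restrict (\<lambda>x. x) (carrier C')"
  have u: "?u \<in> mod_hom A C' C'" by (rule lin_restrict[OF lin_compose[OF kl hl]])
  have v: "?v \<in> mod_hom A C' C'" by (rule lin_restrict[OF lin_id[OF Mod_catD[OF M(2)]]])
  have cl: "\<iota>' i x \<in> carrier C'" if "i \<in> J" "x \<in> carrier (F i)" for i x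
    using \<iota>'[OF that(1)] that(2) by (auto simp: mod_hom_def)
  have arb: "\<iota>' i x = undefined" if "i \<in> J" "x \<notin> carrier (F i)" for i x
    using extensional_arb[OF mod_hom_extensional[OF \<iota>'[OF that(1)]] that(2)] .
  have "compose (carrier (F i)) ?v (\<iota>' i) = \<iota>' i" if "i \<in> J" for i
    using cl[OF that] arb[OF that] by (auto simp: compose_def fun_eq_iff)
  moreover have "compose (carrier (F i)) ?u (\<iota>' i) = \<iota>' i" if i: "i \<in> J" for i
  proof
    fix x
    show "compose (carrier (F i)) ?u (\<iota>' i) x = \<iota>' i x"
      using fun_cong[OF k(2)[OF i], of x] fun_cong[OF h(2)[OF i], of x] cl[OF i, of x] arb[OF i, of x]
      by (cases "x \<in> carrier (F i)") (simp_all add: compose_def)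
  qed
  moreover have "\<exists>!w. w \<in> mod_hom A C' C' \<and> (\<forall>i\<in>J. compose (carrier (F i)) w (\<iota>' i) = \<iota>' i)"
    using C' M(2) \<iota>' unfolding is_coproduct_def by blast
  ultimately have "?u = ?v" using u v by blast
  then have "h (k x) = x" if "x \<in> carrier C'" for x using that by (metis restrict_apply')
  with hl kl that show thesis by blast
qed

end

section \<open>Modules orthogonal to finitely presented modules\<close>

lemma (in ring_universe) presentation_exists:
  fixes X :: "('a, 'm) rmodule"
  assumes X: "X \<in> Mod_cat A"
  obtains P f where "presents A P f X"
  by (rule enough_projectives[OF X]) (rule that, simp add: presents_def X)

lemma (in ring_universe) finitely_presented_presentation:
  fixes K :: "('a, 'm) rmodule"
  assumes K: "K \<in> Mod_cat A" and fp: "finitely_presented A K"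
  obtains P g where "presents A P g K" "fin_gen A P (hom_kernel P K g)"
proof -
  obtain n f where f: "lin A (free A {..<n::nat}) K f" "f ` carrier (free A {..<n}) = carrier K"
    and fg: "fin_gen A (free A {..<n}) (hom_kernel (free A {..<n}) K f)"
    by (rule finitely_presented_cover[OF Mod_catD[OF K] fp]) (rule that)
  let ?F = "free A {..<n}"
  obtain P :: "('a, 'm) rmodule" and c d where P: "P \<in> Mod_cat A" "projective A P"
    and c: "lin A ?F P c" and d: "lin A P ?F d"
    and dc: "\<And>x. x \<in> carrier ?F \<Longrightarrow> d (c x) = x" and cd: "\<And>y. y \<in> carrier P \<Longrightarrow> c (d y) = y"
    by (rule free_copy_exists[OF finite_small[OF finite_lessThan[of n]]]) (rule that)
  let ?g = "\<lambda>x. f (d x)"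
  have g: "lin A P K ?g" by (rule lin_compose[OF d f(1)])
  have "?g ` carrier P = carrier K"
    by (rule image_compose_retraction[OF c d dc f(2)])
  then have pres: "presents A P ?g K" using P K g by (simp add: presents_def)
  have "hom_kernel P K ?g = c ` hom_kernel ?F K f"
  proof (intro equalityI subsetI)
    fix x assume x: "x \<in> hom_kernel P K ?g"
    then have "x = c (d x)" "d x \<in> hom_kernel ?F K f"
      using cd lin_closed[OF d] by (simp_all add: hom_kernel_def)
    then show "x \<in> c ` hom_kernel ?F K f" by (rule image_eqI)
  next
    fix x assume "x \<in> c ` hom_kernel ?F K f"
    then show "x \<in> hom_kernel P K ?g" using dc lin_closed[OF c] by (auto simp: hom_kernel_def)
  qed
  then have "fin_gen A P (hom_kernel P K ?g)"
    using fin_gen_image[OF c _ fg] by (simp add: hom_kernel_def subset_eq)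
  with pres show thesis by (rule that)
qed

lemma hom_zero_if_unique_ext:
  assumes P: "presents A P f X" and ue: "unique_ext A P (hom_kernel P X f) Y"
    and h: "lin A X Y h" and x: "x \<in> carrier X"
  shows "h x = \<zero>\<^bsub>Y\<^esub>"
proof -
  have f: "lin A P X f" "f ` carrier P = carrier X" using P by (simp_all add: presents_def)
  obtain p where p: "p \<in> carrier P" "x = f p" using x f(2) by blast
  have "h (f p) = \<zero>\<^bsub>Y\<^esub>"
    by (rule unique_ext_zero[OF ue lin_compose[OF f(1) h] _ p(1)]) (simp add: hom_kernel_def lin_zero[OF h])
  then show ?thesis by (simp add: p)
qed

text \<open>The vanishing of Ext in degree 1 in its lifting form: the pullback along
  \<open>t\<close> of an extension by \<open>Y\<close> splits.\<close>

lemma lift_if_unique_ext: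
  fixes P X E N :: "('a, 'm) rmodule"
  assumes P: "presents A P f X" and ue: "unique_ext A P (hom_kernel P X f) Y"
    and E: "E \<in> Mod_cat A" and N: "N \<in> Mod_cat A"
    and i: "lin A Y E i" "inj_on i (carrier Y)" and q: "lin A E N q" "q ` carrier E = carrier N"
    and ex: "hom_kernel E N q = i ` carrier Y" and t: "lin A X N t"
  obtains l where "lin A X E l" "\<And>x. x \<in> carrier X \<Longrightarrow> q (l x) = t x"
proof -
  interpret E: right_module A E by (rule Mod_catD[OF E])
  interpret N: right_module A N by (rule Mod_catD[OF N])
  let ?Q = "hom_kernel P X f"
  have f: "lin A P X f" "f ` carrier P = carrier X" and proj: "projective A P" using P by (simp_all add: presents_def)
  have Q: "submod A P ?Q" by (rule submod_kernel[OF f(1)])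
  obtain g where g: "lin A P E g" "\<And>x. x \<in> carrier P \<Longrightarrow> q (g x) = t (f x)"
    by (rule projectiveD[OF proj E N q lin_compose[OF f(1) t]]) (rule that)
  have im: "g x \<in> i ` carrier Y" if "x \<in> carrier (sub P ?Q)" for x
    using that g(2)[of x] lin_zero[OF t] lin_closed[OF g(1)] unfolding ex[symmetric]
    by (simp add: hom_kernel_def)
  obtain m where m: "lin A (sub P ?Q) Y m" "\<And>x. x \<in> carrier (sub P ?Q) \<Longrightarrow> i (m x) = g x"
    by (rule lin_lift_inj[OF i lin_sub[OF g(1) Q] im]) (assumption, rule that)
  obtain n where n: "lin A P Y n" "\<And>x. x \<in> ?Q \<Longrightarrow> n x = m x"
    using unique_ext_exists[OF ue m(1)] by blast
  \<comment> \<open>On the kernel of \<open>f\<close> the lift \<open>g\<close> takes values in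
    \<open>Y\<close>; subtracting an extension of this part to \<open>P\<close> makes the lift
    descend to \<open>X\<close>.\<close>
  let ?k = "\<lambda>x. g x \<ominus>\<^bsub>E\<^esub> i (n x)"
  have k: "lin A P E ?k" by (rule lin_diff[OF g(1) lin_compose[OF n(1) i(1)]])
  have "?k x = \<zero>\<^bsub>E\<^esub>" if x: "x \<in> carrier P" "f x = \<zero>\<^bsub>X\<^esub>" for x
  proof -
    have "x \<in> ?Q" using x by (simp add: hom_kernel_def)
    then show ?thesis
      using n(2) m(2) lin_closed[OF g(1) x(1)] by (simp add: minus_eq_zero_iff[OF E.right_module_axioms])
  qed
  then obtain l where l: "lin A X E l" "\<And>x. x \<in> carrier P \<Longrightarrow> l (f x) = ?k x"
    using lin_factor[OF f(1) k f(2)] by blast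
  have "q (l x) = t x" if x: "x \<in> carrier X" for x
  proof -
    obtain p where p: "p \<in> carrier P" "x = f p" using x f(2) by blast
    have ip: "i (n p) \<in> hom_kernel E N q" unfolding ex by (rule imageI[OF lin_closed[OF n(1) p(1)]])
    then have "q (?k p) = t (f p) \<ominus>\<^bsub>N\<^esub> \<zero>\<^bsub>N\<^esub>"
      using lin_minus[OF q(1) lin_closed[OF g(1) p(1)], of "i (n p)"] g(2)[OF p(1)]
      by (simp add: hom_kernel_def)
    also have "\<dots> = t (f p)"
      using lin_closed[OF lin_compose[OF f(1) t] p(1)]
      by (simp add: minus_zero_eq[OF N.right_module_axioms])
    finally show ?thesis using l(2)[OF p(1)] p(2) by simp
  qed
  with l(1) show thesis by (rule that)
qed

context hereditary_universe
begin

lemma right_perp_iff: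
  fixes Y :: "('a, 'm) rmodule"
  assumes C: "\<C> \<subseteq> Mod_cat A"
  shows "Y \<in> right_perp A \<C> \<longleftrightarrow> Y \<in> Mod_cat A \<and>
    (\<forall>X\<in>\<C>. \<forall>P f. presents A P f X \<longrightarrow> unique_ext A P (hom_kernel P X f) Y)"
proof
  assume "Y \<in> right_perp A \<C>"
  then show "Y \<in> Mod_cat A \<and> (\<forall>X\<in>\<C>. \<forall>P f. presents A P f X \<longrightarrow> unique_ext A P (hom_kernel P X f) Y)"
    using Ext_total_trivial_iff by (auto simp: right_perp_def)
next
  assume R: "Y \<in> Mod_cat A \<and> (\<forall>X\<in>\<C>. \<forall>P f. presents A P f X \<longrightarrow> unique_ext A P (hom_kernel P X f) Y)"
  have "trivial_group (Ext_total A X Y)" if X: "X \<in> \<C>" for X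
  proof -
    obtain P f where "presents A P f X" using presentation_exists X C by blast
    then show ?thesis using Ext_total_trivial_iff R X by blast
  qed
  with R show "Y \<in> right_perp A \<C>" by (simp add: right_perp_def)
qed

text \<open>One presentation per module suffices to prove membership, for instance one with finitely
  generated kernel, whereas \<open>right_perp_iff\<close> delivers the condition for all of
  them.\<close>

lemma right_perp_presentationI:
  fixes Y :: "('a, 'm) rmodule"
  assumes C: "\<C> \<subseteq> Mod_cat A" and Y: "Y \<in> Mod_cat A"
    and ue: "\<And>X. X \<in> \<C> \<Longrightarrow> \<exists>P f. presents A P f X \<and> unique_ext A P (hom_kernel P X f) Y"
  shows "Y \<in> right_perp A \<C>"
proof -
  have "trivial_group (Ext_total A X Y)" if X: "X \<in> \<C>" for X
    using Ext_total_trivial_iff[OF _ Y] ue[OF X] by blast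
  with Y show ?thesis by (simp add: right_perp_def)
qed

lemma coproducts_right_perp:
  fixes \<C> :: "('a, 'm) rmodule set"
  assumes C: "\<C> \<subseteq> {C \<in> Mod_cat A. finitely_presented A C}"
  shows "closed_under_coproducts A (right_perp A \<C>)"
  unfolding closed_under_coproducts_def
proof (intro allI impI)
  fix I :: "'m set" and F :: "'m \<Rightarrow> ('a, 'm) rmodule" and C' \<iota>'
  assume asm: "small TYPE('m) I \<and> (\<forall>i\<in>I. F i \<in> right_perp A \<C>) \<and> is_coproduct A I F C' \<iota>'"
  have CM: "\<C> \<subseteq> Mod_cat A" using C by blast
  have F: "F i \<in> Mod_cat A" if "i \<in> I" for i using asm that by (simp add: right_perp_def)
  have I: "small U I" using asm by (simp add: small_def)
  obtain C \<iota> c d where cop: "is_coproduct A I F C \<iota>" and c: "lin A (dsum I F) C c"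
    and d: "lin A C (dsum I F) d" and "\<And>v. v \<in> carrier (dsum I F) \<Longrightarrow> d (c v) = v"
    and cd: "\<And>x. x \<in> carrier C \<Longrightarrow> c (d x) = x"
    by (rule coproduct_exists[where F = F, OF I F]) (assumption, rule that)
  obtain h k where hk: "lin A C C' h" "lin A C' C k" "\<And>x. x \<in> carrier C' \<Longrightarrow> h (k x) = x"
    by (rule coproduct_unique[OF cop]) (use asm that in blast)+
  show "C' \<in> right_perp A \<C>"
  proof (rule right_perp_presentationI[OF CM])
    show "C' \<in> Mod_cat A" using asm by (simp add: is_coproduct_def)
    fix X assume X: "X \<in> \<C>"
    obtain P f where P: "presents A P f X" and fg: "fin_gen A P (hom_kernel P X f)"
      using finitely_presented_presentation X C by blast
    have Q: "submod A P (hom_kernel P X f)" using P by (intro submod_kernel) (simp add: presents_def)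
    have "unique_ext A P (hom_kernel P X f) (F i)" if "i \<in> I" for i
      using asm that X P unfolding right_perp_iff[OF CM] by blast
    then have "unique_ext A P (hom_kernel P X f) (dsum I F)"
      by (intro unique_ext_dsum[OF ring Mod_catD[OF F] Q fg])
    \<comment> \<open>Transported twice: from the direct sum to its copy \<open>C\<close>, then to
      the given coproduct \<open>C'\<close>.\<close>
    from unique_ext_iso[OF hk unique_ext_iso[OF c d cd this Q] Q] P
    show "\<exists>P f. presents A P f X \<and> unique_ext A P (hom_kernel P X f) C'" by blast
  qed
qed

text \<open>A family of lifts of the colimit cocone along an extension by \<open>Y\<close> is unique, hence
  automatically compatible, so it glues to a splitting over the colimit.\<close>

lemma unique_ext_colimit:
  fixes Y M :: "('a, 'm) rmodule"
  assumes Y: "Y \<in> Mod_cat A"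
    and colim: "is_colimit A J D T M \<iota>" and diagram: "mod_functor A J D T" and cat: "category J"
    and ue: "\<And>i P f. i \<in> obj J \<Longrightarrow> presents A P f (D i) \<Longrightarrow> unique_ext A P (hom_kernel P (D i) f) Y"
    and P: "presents A P f M"
  shows "unique_ext A P (hom_kernel P M f) Y"
proof -
  have PM: "P \<in> Mod_cat A" "projective A P" and M: "M \<in> Mod_cat A" and f: "lin A P M f" "f ` carrier P = carrier M"
    using P by (simp_all add: presents_def)
  have D: "D i \<in> Mod_cat A" if "i \<in> obj J" for i using diagram that by (simp add: mod_functor_def)
  have src: "src J u \<in> obj J" and tgt: "tgt J u \<in> obj J" if "u \<in> arr J" for u
    using category.src_obj[OF cat that] category.tgt_obj[OF cat that] by simp_all
  have T: "lin A (D (src J u)) (D (tgt J u)) (T u)" if "u \<in> arr J" for u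
    using diagram that D src tgt by (intro mod_hom_lin Mod_catD) (auto simp: mod_functor_def)
  have cone: "is_cocone A J D T M \<iota>" using colim by (simp add: is_colimit_def)
  have \<iota>: "lin A (D i) M (\<iota> i)" if "i \<in> obj J" for i
    using cone that D M by (intro mod_hom_lin Mod_catD) (auto simp: is_cocone_def)
  have \<iota>T: "\<iota> (tgt J u) (T u x) = \<iota> (src J u) x" if "u \<in> arr J" "x \<in> carrier (D (src J u))" for u x
  proof -
    have "compose (carrier (D (src J u))) (\<iota> (tgt J u)) (T u) x = \<iota> (src J u) x"
      using cone that by (simp add: is_cocone_def)
    then show ?thesis using that by (simp add: compose_def)
  qed
  have hom0: "h x = \<zero>\<^bsub>Y\<^esub>" if i: "i \<in> obj J" and h: "lin A (D i) Y h" and x: "x \<in> carrier (D i)" for i h x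
  proof -
    obtain P' f' where P': "presents A P' f' (D i)" using presentation_exists[OF D[OF i]] by blast
    show ?thesis by (rule hom_zero_if_unique_ext[OF P' ue[OF i P'] h x])
  qed
  \<comment> \<open>The colimit cocone is jointly epimorphic: \<open>h\<close> and \<open>k\<close>
    mediate the same cocone.\<close>
  have uniq: "h x = k x"
    if h: "lin A M N h" and k: "lin A M N k" and N: "N \<in> Mod_cat A"
      and eq: "\<And>i x. i \<in> obj J \<Longrightarrow> x \<in> carrier (D i) \<Longrightarrow> h (\<iota> i x) = k (\<iota> i x)" and x: "x \<in> carrier M"
    for N :: "('a, 'm) rmodule" and h k x
  proof -
    let ?c = "\<lambda>i. restrict (\<lambda>x. h (\<iota> i x)) (carrier (D i))"
    have "is_cocone A J D T N ?c"
      unfolding is_cocone_def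
    proof (intro conjI ballI N)
      show "?c i \<in> mod_hom A (D i) N" if "i \<in> obj J" for i
        by (rule lin_restrict[OF lin_compose[OF \<iota>[OF that] h]])
      show "compose (carrier (D (src J u))) (?c (tgt J u)) (T u) = ?c (src J u)" if u: "u \<in> arr J" for u
        using lin_closed[OF T[OF u]] \<iota>T[OF u] by (auto simp: compose_def)
    qed
    then have ex1: "\<exists>!w. w \<in> mod_hom A M N \<and> (\<forall>i\<in>obj J. compose (carrier (D i)) w (\<iota> i) = ?c i)"
      using colim unfolding is_colimit_def by blast
    have "compose (carrier (D i)) (restrict h (carrier M)) (\<iota> i) = ?c i" if "i \<in> obj J" for i
      using lin_closed[OF \<iota>[OF that]] by (auto simp: compose_def)
    moreover have "compose (carrier (D i)) (restrict k (carrier M)) (\<iota> i) = ?c i" if "i \<in> obj J" for i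
      using lin_closed[OF \<iota>[OF that]] eq[OF that] by (auto simp: compose_def)
    ultimately have "restrict h (carrier M) = restrict k (carrier M)"
      using ex1 lin_restrict[OF h] lin_restrict[OF k] by blast
    then show ?thesis using x by (metis restrict_apply')
  qed
  show ?thesis
  proof (rule unique_extI)
    fix g assume g: "lin A (sub P (hom_kernel P M f)) Y g"
    \<comment> \<open>The extension of \<open>M\<close> by \<open>Y\<close> attached to
      \<open>g\<close>; a section of \<open>q\<close> will yield the extension of \<open>g\<close>
      to \<open>P\<close>.\<close>
    obtain E :: "('a, 'm) rmodule" and i j q where E: "E \<in> Mod_cat A" and i: "lin A Y E i" "inj_on i (carrier Y)"
      and j: "lin A P E j" and q: "lin A E M q" "q ` carrier E = carrier M"
      and ex: "hom_kernel E M q = i ` carrier Y"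
      and ji: "\<And>x. x \<in> hom_kernel P M f \<Longrightarrow> j x = i (g x)" and qj: "\<And>x. x \<in> carrier P \<Longrightarrow> q (j x) = f x"
      by (rule pushout_exists[OF PM(1) Y f g]) (rule that)
    interpret E: right_module A E by (rule Mod_catD[OF E])
    have "\<exists>l. lin A (D k) E l \<and> (\<forall>x\<in>carrier (D k). q (l x) = \<iota> k x)" if k: "k \<in> obj J" for k
    proof -
      obtain P' f' where P': "presents A P' f' (D k)" using presentation_exists[OF D[OF k]] by blast
      show ?thesis
        by (rule lift_if_unique_ext[OF P' ue[OF k P'] E M i q ex \<iota>[OF k]]) blast
    qed
    then have "\<exists>l. \<forall>k\<in>obj J. lin A (D k) E (l k) \<and> (\<forall>x\<in>carrier (D k). q (l k x) = \<iota> k x)"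
      by (intro bchoice ballI)
    then obtain l where ll: "\<forall>k\<in>obj J. lin A (D k) E (l k) \<and> (\<forall>x\<in>carrier (D k). q (l k x) = \<iota> k x)" ..
    have l: "\<And>k. k \<in> obj J \<Longrightarrow> lin A (D k) E (l k)"
      "\<And>k x. k \<in> obj J \<Longrightarrow> x \<in> carrier (D k) \<Longrightarrow> q (l k x) = \<iota> k x"
      using ll by simp_all
    have lT: "l (tgt J u) (T u x) = l (src J u) x" if u: "u \<in> arr J" and x: "x \<in> carrier (D (src J u))" for u x
    proof -
      let ?d = "\<lambda>x. l (tgt J u) (T u x) \<ominus>\<^bsub>E\<^esub> l (src J u) x"
      have lt: "lin A (D (src J u)) E (\<lambda>x. l (tgt J u) (T u x))"
        by (rule lin_compose[OF T[OF u] l(1)[OF tgt[OF u]]])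
      note ls = l(1)[OF src[OF u]]
      have d: "lin A (D (src J u)) E ?d" by (rule lin_diff[OF lt ls])
      have "?d y \<in> i ` carrier Y" if y: "y \<in> carrier (D (src J u))" for y
      proof -
        have "q (?d y) = \<zero>\<^bsub>M\<^esub>"
          using lin_minus[OF q(1) lin_closed[OF lt y] lin_closed[OF ls y]]
            l(2)[OF tgt[OF u] lin_closed[OF T[OF u] y]] l(2)[OF src[OF u] y] \<iota>T[OF u y]
            lin_closed[OF \<iota>[OF src[OF u]] y]
          by (simp add: minus_eq_zero_iff[OF Mod_catD[OF M]])
        then show ?thesis using lin_closed[OF d y] unfolding ex[symmetric] by (simp add: hom_kernel_def)
      qed
      then obtain m where m: "lin A (D (src J u)) Y m" "\<And>y. y \<in> carrier (D (src J u)) \<Longrightarrow> i (m y) = ?d y"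
        using lin_lift_inj[OF i d] by blast
      \<comment> \<open>Two lifts of the same map differ by a homomorphism from
        \<open>D (src J u)\<close> to \<open>Y\<close>, and there are no nonzero ones.\<close>
      have "?d x = \<zero>\<^bsub>E\<^esub>" using m(2)[OF x] hom0[OF src[OF u] m(1) x] lin_zero[OF i(1)] by simp
      then show ?thesis
        using lin_closed[OF lt x] lin_closed[OF ls x] by (simp add: minus_eq_zero_iff[OF E.right_module_axioms])
    qed
    let ?c = "\<lambda>k. restrict (l k) (carrier (D k))"
    have "is_cocone A J D T E ?c"
      unfolding is_cocone_def
    proof (intro conjI ballI E)
      show "?c k \<in> mod_hom A (D k) E" if "k \<in> obj J" for k by (rule lin_restrict[OF l(1)[OF that]])
      show "compose (carrier (D (src J u))) (?c (tgt J u)) (T u) = ?c (src J u)" if u: "u \<in> arr J" for u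
        using lin_closed[OF T[OF u]] lT[OF u] by (auto simp: compose_def)
    qed
    then obtain w where w: "w \<in> mod_hom A M E" "\<And>k. k \<in> obj J \<Longrightarrow> compose (carrier (D k)) w (\<iota> k) = ?c k"
      using colim unfolding is_colimit_def by blast
    have wl: "lin A M E w" by (rule mod_hom_lin[OF Mod_catD[OF M] E.right_module_axioms w(1)])
    have w\<iota>: "w (\<iota> k x) = l k x" if "k \<in> obj J" "x \<in> carrier (D k)" for k x
      using fun_cong[OF w(2)[OF that(1)], of x] that(2) by (simp add: compose_def)
    have qw: "q (w x) = x" if x: "x \<in> carrier M" for x
      by (rule uniq[OF lin_compose[OF wl q(1)] lin_id[OF Mod_catD[OF M]] M _ x]) (simp add: w\<iota> l(2))
    \<comment> \<open>The section \<open>w\<close> cuts \<open>E\<close> down to \<open>Y\<close>: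
      \<open>j\<close> minus \<open>w \<circ> f\<close> is killed by \<open>q\<close>, and on the
      kernel of \<open>f\<close> it is \<open>j\<close>, that is \<open>i \<circ> g\<close>.\<close>
    let ?d = "\<lambda>x. j x \<ominus>\<^bsub>E\<^esub> w (f x)"
    have d: "lin A P E ?d" by (rule lin_diff[OF j lin_compose[OF f(1) wl]])
    have "?d x \<in> i ` carrier Y" if x: "x \<in> carrier P" for x
    proof -
      have "q (?d x) = \<zero>\<^bsub>M\<^esub>"
        using lin_minus[OF q(1) lin_closed[OF j x] lin_closed[OF lin_compose[OF f(1) wl] x]] qj[OF x]
          lin_closed[OF f(1) x]
        by (simp add: qw minus_eq_zero_iff[OF Mod_catD[OF M]])
      then show ?thesis using lin_closed[OF d x] unfolding ex[symmetric] by (simp add: hom_kernel_def)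
    qed
    then obtain m where m: "lin A P Y m" "\<And>x. x \<in> carrier P \<Longrightarrow> i (m x) = ?d x"
      using lin_lift_inj[OF i d] by blast
    have "m x = g x" if x: "x \<in> hom_kernel P M f" for x
    proof (rule inj_onD[OF i(2)])
      have xP: "x \<in> carrier P" "f x = \<zero>\<^bsub>M\<^esub>" using x by (simp_all add: hom_kernel_def)
      show gx: "g x \<in> carrier Y" using lin_closed[OF g, of x] x by simp
      show "m x \<in> carrier Y" by (rule lin_closed[OF m(1) xP(1)])
      show "i (m x) = i (g x)"
        using m(2)[OF xP(1)] xP(2) ji[OF x] lin_zero[OF wl] lin_closed[OF i(1) gx]
        by (simp add: minus_zero_eq[OF E.right_module_axioms])
    qed
    with m(1) show "\<exists>h. lin A P Y h \<and> (\<forall>x\<in>hom_kernel P M f. h x = g x)" by blast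
  next
    fix h x assume h: "lin A P Y h" and ker: "\<And>x. x \<in> hom_kernel P M f \<Longrightarrow> h x = \<zero>\<^bsub>Y\<^esub>" and x: "x \<in> carrier P"
    have "h y = \<zero>\<^bsub>Y\<^esub>" if "y \<in> carrier P" "f y = \<zero>\<^bsub>M\<^esub>" for y
      using ker that by (simp add: hom_kernel_def)
    then obtain k where k: "lin A M Y k" "\<And>x. x \<in> carrier P \<Longrightarrow> k (f x) = h x"
      using lin_factor[OF f(1) h f(2)] by blast
    have "k (f x) = \<zero>\<^bsub>Y\<^esub>"
      by (rule uniq[OF k(1) lin_const_zero[OF Mod_catD[OF M] Mod_catD[OF Y]] Y _ lin_closed[OF f(1) x]])
        (simp add: hom0[OF _ lin_compose[OF \<iota> k(1)]])
    then show "h x = \<zero>\<^bsub>Y\<^esub>" using k(2)[OF x] by simp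
  qed
qed

text \<open>Orthogonality to the modules of a diagram passes to its colimit. With the finitely
  presented modules of \<open>\<X>\<close> as \<open>\<C>\<close>, this shows that they form a
  witness for (3).\<close>

lemma right_perp_filtered_colimits:
  fixes \<X> \<C> :: "('a, 'm) rmodule set"
  assumes sub: "\<C> \<subseteq> \<X>" and X: "\<X> \<subseteq> Mod_cat A"
    and colim: "\<And>M. M \<in> \<X> \<Longrightarrow> filtered_colimit_of A \<C> M"
  shows "right_perp A \<C> = right_perp A \<X>"
proof
  show "right_perp A \<X> \<subseteq> right_perp A \<C>" using sub by (auto simp: right_perp_def)
  have C: "\<C> \<subseteq> Mod_cat A" using sub X by blast
  show "right_perp A \<C> \<subseteq> right_perp A \<X>"
  proof
    fix Y assume Y: "Y \<in> right_perp A \<C>"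
    then have YM: "Y \<in> Mod_cat A" by (simp add: right_perp_def)
    have "unique_ext A P (hom_kernel P M f) Y" if M: "M \<in> \<X>" and P: "presents A P f M" for M P f
    proof -
      obtain J :: "('m, 'm) cat" and D T \<iota> where J: "filtered_category J" and F: "mod_functor A J D T"
        and D: "\<forall>i\<in>obj J. D i \<in> \<C>" and c: "is_colimit A J D T M \<iota>"
        using colim[OF M] unfolding filtered_colimit_of_def by blast
      show ?thesis
      proof (rule unique_ext_colimit[OF YM c F _ _ P])
        show "category J" using J by (simp add: filtered_category_def)
        show "unique_ext A P' (hom_kernel P' (D i) f') Y" if "i \<in> obj J" "presents A P' f' (D i)" for i P' f'
          using Y that D unfolding right_perp_iff[OF C] by blast
      qed
    qed
    then show "Y \<in> right_perp A \<X>" unfolding right_perp_iff[OF X] using YM by blast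
  qed
qed

end

section \<open>Directed colimits\<close>

text \<open>The elementwise criterion: every element comes from some stage, and an element of a
  stage that dies in \<open>M\<close> dies at a later stage. The indices form a preorder on a subset
  of \<open>'m\<close>, as \<open>filtered_colimit_of\<close> expects its diagrams there.\<close>

lemma (in ring_universe) directed_colimit:
  fixes S :: "'m set" and D :: "'m \<Rightarrow> ('a, 'm) rmodule" and M :: "('a, 'm) rmodule"
    and le :: "'m \<Rightarrow> 'm \<Rightarrow> bool"
  assumes small: "small U S" and ne: "S \<noteq> {}"
    and refl: "\<And>i. i \<in> S \<Longrightarrow> le i i"
    and trans: "\<And>i j k. i \<in> S \<Longrightarrow> j \<in> S \<Longrightarrow> k \<in> S \<Longrightarrow> le i j \<Longrightarrow> le j k \<Longrightarrow> le i k"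
    and directed: "\<And>i j. i \<in> S \<Longrightarrow> j \<in> S \<Longrightarrow> \<exists>k\<in>S. le i k \<and> le j k"
    and D: "\<And>i. i \<in> S \<Longrightarrow> D i \<in> Mod_cat A" and D\<S>: "\<And>i. i \<in> S \<Longrightarrow> D i \<in> \<S>"
    and T: "\<And>i j. i \<in> S \<Longrightarrow> j \<in> S \<Longrightarrow> le i j \<Longrightarrow> lin A (D i) (D j) (T i j)"
    and T_id: "\<And>i x. i \<in> S \<Longrightarrow> x \<in> carrier (D i) \<Longrightarrow> T i i x = x"
    and T_comp: "\<And>i j k x. i \<in> S \<Longrightarrow> j \<in> S \<Longrightarrow> k \<in> S \<Longrightarrow> le i j \<Longrightarrow> le j k \<Longrightarrow> x \<in> carrier (D i) \<Longrightarrow>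
      T j k (T i j x) = T i k x"
    and M: "M \<in> Mod_cat A" and \<iota>: "\<And>i. i \<in> S \<Longrightarrow> lin A (D i) M (\<iota> i)"
    and \<iota>T: "\<And>i j x. i \<in> S \<Longrightarrow> j \<in> S \<Longrightarrow> le i j \<Longrightarrow> x \<in> carrier (D i) \<Longrightarrow> \<iota> j (T i j x) = \<iota> i x"
    and surj: "\<And>y. y \<in> carrier M \<Longrightarrow> \<exists>i\<in>S. \<exists>x\<in>carrier (D i). \<iota> i x = y"
    and ker: "\<And>i x. i \<in> S \<Longrightarrow> x \<in> carrier (D i) \<Longrightarrow> \<iota> i x = \<zero>\<^bsub>M\<^esub> \<Longrightarrow>
      \<exists>j\<in>S. le i j \<and> T i j x = \<zero>\<^bsub>D j\<^esub>"
  shows "filtered_colimit_of A \<S> M"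
proof -
  obtain p :: "'m \<times> 'm \<Rightarrow> 'm" where p: "inj p" using pairing_exists by blast
  \<comment> \<open>A preorder as a category: the arrow from \<open>i\<close> to \<open>j\<close> is
    the code of the pair, and source and target are decoded from it.\<close>
  define J :: "('m, 'm) cat" where "J = \<lparr>obj = S, arr = p ` {(i, j). i \<in> S \<and> j \<in> S \<and> le i j},
    src = (\<lambda>w. fst (inv_into UNIV p w)), tgt = (\<lambda>w. snd (inv_into UNIV p w)), idt = (\<lambda>i. p (i, i)),
    cmp = (\<lambda>v u. p (fst (inv_into UNIV p u), snd (inv_into UNIV p v)))\<rparr>"
  have [simp]: "obj J = S" "src J (p (i, j)) = i" "tgt J (p (i, j)) = j" "idt J i = p (i, i)"
    "cmp J (p (j', k)) (p (i, j)) = p (i, k)" for i j j' k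
    by (simp_all add: J_def inv_f_f[OF p])
  have arr: "w \<in> arr J \<longleftrightarrow> (\<exists>i j. w = p (i, j) \<and> i \<in> S \<and> j \<in> S \<and> le i j)" for w
    by (auto simp: J_def)
  have arrows: "w \<in> arrows J i j \<longleftrightarrow> w = p (i, j) \<and> i \<in> S \<and> j \<in> S \<and> le i j" for w i j
    by (auto simp: arrows_def arr)
  have cat: "category J"
    by unfold_locales (auto simp: arrows arr refl intro: trans)
  have filt: "filtered_category J"
    unfolding filtered_category_def
  proof (intro conjI ballI cat)
    show "obj J \<noteq> {}" using ne by simp
    show "\<exists>k\<in>obj J. arrows J i k \<noteq> {} \<and> arrows J j k \<noteq> {}" if "i \<in> obj J" "j \<in> obj J" for i j
    proof -
      obtain k where "k \<in> S" "le i k" "le j k" using directed \<open>i \<in> obj J\<close> \<open>j \<in> obj J\<close> by auto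
      then have "p (i, k) \<in> arrows J i k" "p (j, k) \<in> arrows J j k"
        using \<open>i \<in> obj J\<close> \<open>j \<in> obj J\<close> by (simp_all add: arrows)
      then show ?thesis using \<open>k \<in> S\<close> by auto
    qed
    show "\<exists>k\<in>obj J. \<exists>w\<in>arrows J j k. cmp J w u = cmp J w v"
      if "i \<in> obj J" "j \<in> obj J" "u \<in> arrows J i j" "v \<in> arrows J i j" for i j u v
      by (rule bexI[of _ j], rule bexI[of _ "p (j, j)"]) (use that refl in \<open>auto simp: arrows\<close>)
  qed
  define T' where "T' w = restrict (T (src J w) (tgt J w)) (carrier (D (src J w)))" for w
  define \<iota>' where "\<iota>' i = restrict (\<iota> i) (carrier (D i))" for i
  have functor': "mod_functor A J D T'"
    unfolding mod_functor_def
  proof (intro conjI ballI impI)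
    show "T' u \<in> mod_hom A (D (src J u)) (D (tgt J u))" if "u \<in> arr J" for u
      using that T by (auto simp: arr T'_def intro!: lin_restrict)
    show "T' (idt J i) = (\<lambda>x\<in>carrier (D i). x)" if "i \<in> obj J" for i
      using that T_id by (auto simp: T'_def)
    show "T' (cmp J v u) = compose (carrier (D (src J u))) (T' v) (T' u)"
      if "u \<in> arr J" "v \<in> arr J" "src J v = tgt J u" for u v
      using that T_comp lin_closed[OF T] by (auto simp: arr T'_def compose_def)
  qed (simp add: D)
  have "is_cocone A J D T' M \<iota>'"
    unfolding is_cocone_def
  proof (intro conjI ballI M)
    show "\<iota>' i \<in> mod_hom A (D i) M" if "i \<in> obj J" for i
      using that \<iota> by (simp add: \<iota>'_def lin_restrict)
    show "compose (carrier (D (src J u))) (\<iota>' (tgt J u)) (T' u) = \<iota>' (src J u)" if "u \<in> arr J" for u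
      using that \<iota>T lin_closed[OF T] by (auto simp: arr T'_def \<iota>'_def compose_def)
  qed
  moreover have "\<exists>!h. h \<in> mod_hom A M N \<and> (\<forall>i\<in>obj J. compose (carrier (D i)) h (\<iota>' i) = g i)"
    if N: "is_cocone A J D T' N g" for N g
  proof -
    have NM: "N \<in> Mod_cat A" using N by (simp add: is_cocone_def)
    have g: "lin A (D i) N (g i)" if "i \<in> S" for i
      using N that D NM by (intro mod_hom_lin Mod_catD) (auto simp: is_cocone_def)
    have gT: "g j (T i j x) = g i x" if ij: "i \<in> S" "j \<in> S" "le i j" and x: "x \<in> carrier (D i)" for i j x
    proof -
      have "compose (carrier (D (src J (p (i, j))))) (g (tgt J (p (i, j)))) (T' (p (i, j))) = g (src J (p (i, j)))"
      proof -
        have "p (i, j) \<in> arr J" using ij unfolding arr by blast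
        then show ?thesis using N unfolding is_cocone_def by blast
      qed
      from fun_cong[OF this, of x] x show ?thesis by (simp add: compose_def T'_def)
    qed
    \<comment> \<open>Move both representatives to a common stage \<open>k\<close>; their difference
      dies in \<open>M\<close>, hence already at a stage \<open>l\<close>, where the two values of
      the cocone agree.\<close>
    have well: "g i x = g j y"
      if i: "i \<in> S" and j: "j \<in> S" and x: "x \<in> carrier (D i)" and y: "y \<in> carrier (D j)"
        and eq: "\<iota> i x = \<iota> j y" for i j x y
    proof -
      obtain k where k: "k \<in> S" "le i k" "le j k" using directed i j by blast
      let ?z = "T i k x \<ominus>\<^bsub>D k\<^esub> T j k y"
      have xy: "T i k x \<in> carrier (D k)" "T j k y \<in> carrier (D k)"
        using lin_closed[OF T] i j k x y by blast+
      have z: "?z \<in> carrier (D k)"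
        using submod_minus[OF submod_carrier[OF Mod_catD[OF D[OF k(1)]]]] xy by blast
      have "\<iota> k ?z = \<zero>\<^bsub>M\<^esub>"
        using lin_minus[OF \<iota>[OF k(1)] xy] \<iota>T i j k x y eq lin_closed[OF \<iota>]
        by (simp add: minus_eq_zero_iff[OF Mod_catD[OF M]])
      then obtain l where l: "l \<in> S" "le k l" "T k l ?z = \<zero>\<^bsub>D l\<^esub>" using ker k(1) z by blast
      note Tl = T[OF k(1) l(1,2)]
      have "T k l (T i k x) = T k l (T j k y)"
        using l(3) lin_minus[OF Tl xy] lin_closed[OF Tl xy(1)] lin_closed[OF Tl xy(2)]
        by (simp add: minus_eq_zero_iff[OF Mod_catD[OF D[OF l(1)]]])
      then have "g k (T i k x) = g k (T j k y)"
        using gT[OF k(1) l(1,2) xy(1)] gT[OF k(1) l(1,2) xy(2)] by simp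
      then show ?thesis using gT i j k x y by simp
    qed
    have "\<exists>w. \<forall>i\<in>S. \<forall>x\<in>carrier (D i). \<iota> i x = y \<longrightarrow> w = g i x" if y: "y \<in> carrier M" for y
    proof -
      obtain i x where ix: "i \<in> S" "x \<in> carrier (D i)" "\<iota> i x = y" using surj y by blast
      show ?thesis
        by (intro exI[of _ "g i x"] ballI impI, rule well) (simp_all add: ix)
    qed
    then have "\<exists>h. \<forall>y\<in>carrier M. \<forall>i\<in>S. \<forall>x\<in>carrier (D i). \<iota> i x = y \<longrightarrow> h y = g i x"
      by (intro bchoice ballI)
    then obtain h where hh: "\<forall>y\<in>carrier M. \<forall>i\<in>S. \<forall>x\<in>carrier (D i). \<iota> i x = y \<longrightarrow> h y = g i x" ..
    have h: "h (\<iota> i x) = g i x" if "i \<in> S" "x \<in> carrier (D i)" for i x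
      using hh that lin_closed[OF \<iota>] by simp
    have hlin: "lin A M N h"
    proof (rule linI[OF Mod_catD[OF M] Mod_catD[OF NM]])
      fix y assume "y \<in> carrier M"
      then obtain i x where i: "i \<in> S" and x: "x \<in> carrier (D i)" and y: "y = \<iota> i x" using surj by blast
      show "h y \<in> carrier N" using h i x y lin_closed[OF g] by simp
      show "h (y \<triangleleft>\<^bsub>M\<^esub> a) = h y \<triangleleft>\<^bsub>N\<^esub> a" if a: "a \<in> carrier A" for a
        using h[OF i right_module.ract_closed[OF Mod_catD[OF D[OF i]] x a]] h[OF i x] y
          lin_ract[OF \<iota>[OF i] x a] lin_ract[OF g[OF i] x a] by simp
      fix y' assume "y' \<in> carrier M"
      then obtain j x' where j: "j \<in> S" and x': "x' \<in> carrier (D j)" and y': "y' = \<iota> j x'" using surj by blast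
      obtain k where k: "k \<in> S" "le i k" "le j k" using directed i j by blast
      have xx: "T i k x \<in> carrier (D k)" "T j k x' \<in> carrier (D k)"
        using lin_closed[OF T] i j k x x' by blast+
      have "y \<oplus>\<^bsub>M\<^esub> y' = \<iota> k (T i k x \<oplus>\<^bsub>D k\<^esub> T j k x')"
        using lin_add[OF \<iota>[OF k(1)] xx] \<iota>T i j k x x' y y' by simp
      then have "h (y \<oplus>\<^bsub>M\<^esub> y') = g k (T i k x \<oplus>\<^bsub>D k\<^esub> T j k x')"
        using h[OF k(1) submod_add[OF submod_carrier[OF Mod_catD[OF D[OF k(1)]]] xx]] by simp
      also have "\<dots> = h y \<oplus>\<^bsub>N\<^esub> h y'"
        using lin_add[OF g[OF k(1)] xx] gT i j k x x' h y y' by simp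
      finally show "h (y \<oplus>\<^bsub>M\<^esub> y') = h y \<oplus>\<^bsub>N\<^esub> h y'" .
    qed
    have gext: "g i x = undefined" if "i \<in> S" "x \<notin> carrier (D i)" for i x
      using N that by (intro extensional_arb[OF mod_hom_extensional]) (auto simp: is_cocone_def)
    show ?thesis
    proof (rule ex1I[of _ "restrict h (carrier M)"])
      show "restrict h (carrier M) \<in> mod_hom A M N \<and>
          (\<forall>i\<in>obj J. compose (carrier (D i)) (restrict h (carrier M)) (\<iota>' i) = g i)"
        using lin_restrict[OF hlin] h lin_closed[OF \<iota>] gext
        by (auto simp: compose_def \<iota>'_def fun_eq_iff)
      fix k assume k: "k \<in> mod_hom A M N \<and> (\<forall>i\<in>obj J. compose (carrier (D i)) k (\<iota>' i) = g i)"
      have "k y = restrict h (carrier M) y" if y: "y \<in> carrier M" for y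
      proof -
        obtain i x where i: "i \<in> S" and x: "x \<in> carrier (D i)" and y': "y = \<iota> i x" using surj y by blast
        have "compose (carrier (D i)) k (\<iota>' i) x = g i x" using k i by simp
        then show ?thesis using h[OF i x] x y y' by (simp add: compose_def \<iota>'_def)
      qed
      then show "k = restrict h (carrier M)"
        by (intro mod_hom_eqI[OF conjunct1[OF k] lin_restrict[OF hlin]])
    qed
  qed
  ultimately have "is_colimit A J D T' M \<iota>'" by (simp add: is_colimit_def)
  moreover have "small U (arr J)"
  proof -
    have "arr J \<subseteq> p ` (S \<times> S)" by (auto simp: J_def)
    then show ?thesis by (rule small_subset[OF small_image[OF Times_small[OF small small]]])
  qed
  ultimately show ?thesis
    unfolding filtered_colimit_of_def using filt functor' D\<S> small
    by (intro exI[of _ J] exI[of _ D] exI[of _ T'] exI[of _ \<iota>']) (simp add: small_def)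
qed

section \<open>Finitely generated subpresentations\<close>

text \<open>A dual basis writes the identity of \<open>Q\<close> as a locally finite sum of
  endomorphisms \<open>\<theta> j\<close>, each with values in the multiples of \<open>j\<close>.
  For a map \<open>h\<close>, the family of all \<open>h \<circ> \<theta> j\<close> is one map from
  \<open>Q\<close> to a coproduct of copies of \<open>Y\<close>; it extends to \<open>P\<close>, and
  at \<open>c\<close> the extension has finitely many nonzero coordinates, whose sum is
  \<open>h c\<close>. One finite set serves all \<open>Y\<close> and \<open>h\<close> at once,
  because infinitely many bad indices could be gathered in one coproduct. The basis is indexed by
  \<open>Q\<close> itself, a small subset of \<open>'m\<close> as closure under coproducts
  demands.\<close>

lemma (in ring_universe) finite_support_of_unique_ext:
  fixes P :: "('a, 'm) rmodule" and \<Y> :: "('a, 'm) rmodule set"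
  assumes P: "P \<in> Mod_cat A" and Q: "submod A P Q" and proj: "projective A (sub P Q)"
    and Y: "\<Y> \<subseteq> Mod_cat A" and closed: "closed_under_coproducts A \<Y>"
    and ue: "\<And>Y. Y \<in> \<Y> \<Longrightarrow> unique_ext A P Q Y" and c: "c \<in> carrier P"
  shows "\<exists>B. finite B \<and> B \<subseteq> Q \<and>
    (\<forall>Y\<in>\<Y>. \<forall>h. lin A P Y h \<longrightarrow> (\<forall>x\<in>B. h x = \<zero>\<^bsub>Y\<^esub>) \<longrightarrow> h c = \<zero>\<^bsub>Y\<^esub>)"
proof -
  let ?Q = "sub P Q"
  have QM: "?Q \<in> Mod_cat A" by (rule Mod_cat_sub[OF P Q])
  have smallQ: "small U Q" using Mod_cat_small[OF QM] by simp
  have QP: "Q \<subseteq> carrier P" by (rule submod_subset[OF Q])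
  interpret Q: right_module A ?Q by (rule Mod_catD[OF QM])
  obtain s where s: "lin A ?Q (free A Q) s"
    and s_id: "\<And>x. x \<in> Q \<Longrightarrow> free_map A Q ?Q (\<lambda>y. y) (s x) = x"
    using dual_basis[OF QM proj] by auto
  define \<theta> where "\<theta> j x = j \<triangleleft>\<^bsub>?Q\<^esub> s x j" for j x
  have \<theta>: "lin A ?Q ?Q (\<theta> j)" if "j \<in> Q" for j
  proof -
    have "lin A (free A Q) (reg A) (\<lambda>v. v j)"
      by (rule lin_dsum_proj[where F = "\<lambda>_. reg A", OF ring right_module_reg[OF ring] that])
    from lin_compose[OF lin_compose[OF s this] lin_generator[OF Q.right_module_axioms, of j]] that
    show ?thesis by (simp add: \<theta>_def[abs_def])
  qed
  have fin: "finite {j \<in> Q. s x j \<noteq> \<zero>\<^bsub>A\<^esub>}" if "x \<in> Q" for x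
    using lin_closed[OF s, of x] that by (simp add: carrier_dsum supp_def zero_reg)
  have \<theta>0: "\<theta> j x = \<zero>\<^bsub>P\<^esub>" if "s x j = \<zero>\<^bsub>A\<^esub>" "j \<in> Q" for j x
    using Q.ract_zero_right[of j] that by (simp add: \<theta>_def)
  \<comment> \<open>Closure under coproducts extends the locally finite family \<open>g j \<circ> \<theta> j\<close> to a map into the
    coproduct; its value at \<open>c\<close> then has finite support.\<close>
  have G: "\<exists>G. lin A P (dsum K F) G \<and> (\<forall>x\<in>Q. G x = (\<lambda>j\<in>K. g j (\<theta> j x)))"
    if K: "K \<subseteq> Q" and F: "\<And>j. j \<in> K \<Longrightarrow> F j \<in> \<Y>" and g: "\<And>j. j \<in> K \<Longrightarrow> lin A ?Q (F j) (g j)"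
    for K and F :: "'m \<Rightarrow> ('a, 'm) rmodule" and g
  proof -
    have FM: "F j \<in> Mod_cat A" if "j \<in> K" for j using F[OF that] Y by blast
    have Ks: "small U K" by (rule small_subset[OF smallQ K])
    obtain C \<iota> c d where cop: "is_coproduct A K F C \<iota>" and c: "lin A (dsum K F) C c"
      and d: "lin A C (dsum K F) d" and dc: "\<And>v. v \<in> carrier (dsum K F) \<Longrightarrow> d (c v) = v"
      by (rule coproduct_exists[where F = F, OF Ks FM]) (assumption, rule that, assumption+)
    have CY: "C \<in> \<Y>" using closed cop F Ks unfolding closed_under_coproducts_def by (auto simp: small_def)
    let ?G = "\<lambda>x. \<lambda>j\<in>K. g j (\<theta> j x)"
    have t: "lin A ?Q (dsum K F) ?G"
    proof (rule lin_dsum_tuple[OF ring Q.right_module_axioms])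
      show "lin A ?Q (F j) (\<lambda>x. g j (\<theta> j x))" if "j \<in> K" for j
        using lin_compose[OF \<theta> g[OF that]] that K by blast
      show "finite {j \<in> K. g j (\<theta> j x) \<noteq> \<zero>\<^bsub>F j\<^esub>}" if x: "x \<in> carrier ?Q" for x
      proof (rule finite_subset[OF _ fin[of x]])
        have "g j (\<theta> j x) = \<zero>\<^bsub>F j\<^esub>" if "j \<in> K" "s x j = \<zero>\<^bsub>A\<^esub>" for j
          using \<theta>0[OF that(2)] that(1) K lin_zero[OF g[OF that(1)]] by auto
        then show "{j \<in> K. g j (\<theta> j x) \<noteq> \<zero>\<^bsub>F j\<^esub>} \<subseteq> {j \<in> Q. s x j \<noteq> \<zero>\<^bsub>A\<^esub>}" using K by auto
      qed (use x in simp)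
    qed
    obtain G where G: "lin A P C G" "\<And>x. x \<in> Q \<Longrightarrow> G x = c (?G x)"
      using unique_ext_exists[OF ue[OF CY] lin_compose[OF t c]] by blast
    have "d (G x) = ?G x" if "x \<in> Q" for x
      using G(2)[OF that] dc lin_closed[OF t, of x] that by simp
    with lin_compose[OF G(1) d] show ?thesis by blast
  qed
  \<comment> \<open>The indices that can matter at \<open>c\<close> for at least one module of the
    class and one map \<open>g\<close> on \<open>Q\<close>.\<close>
  define B where "B = {j \<in> Q. \<exists>Y\<in>\<Y>. \<exists>g h. lin A ?Q Y g \<and> lin A P Y h \<and>
    (\<forall>x\<in>Q. h x = g (\<theta> j x)) \<and> h c \<noteq> \<zero>\<^bsub>Y\<^esub>}"
  have BQ: "B \<subseteq> Q" by (auto simp: B_def)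
  have "finite B"
  proof -
    have "\<forall>j\<in>B. \<exists>t. case t of (Y, g, h) \<Rightarrow> Y \<in> \<Y> \<and> lin A ?Q Y g \<and> lin A P Y h \<and>
        (\<forall>x\<in>Q. h x = g (\<theta> j x)) \<and> h c \<noteq> \<zero>\<^bsub>Y\<^esub>"
      by (auto simp: B_def)
    from bchoice[OF this] obtain t where t: "\<forall>j\<in>B. case t j of (Y, g, h) \<Rightarrow> Y \<in> \<Y> \<and> lin A ?Q Y g \<and>
        lin A P Y h \<and> (\<forall>x\<in>Q. h x = g (\<theta> j x)) \<and> h c \<noteq> \<zero>\<^bsub>Y\<^esub>" ..
    define F where "F j = fst (t j)" for j
    define g where "g j = fst (snd (t j))" for j
    define h where "h j = snd (snd (t j))" for j
    have t': "F j \<in> \<Y>" "lin A ?Q (F j) (g j)" "lin A P (F j) (h j)"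
      "\<And>x. x \<in> Q \<Longrightarrow> h j x = g j (\<theta> j x)" "h j c \<noteq> \<zero>\<^bsub>F j\<^esub>" if "j \<in> B" for j
      using bspec[OF t that] by (simp_all add: F_def g_def h_def split: prod.splits)
    obtain G where G: "lin A P (dsum B F) G" "\<And>x. x \<in> Q \<Longrightarrow> G x = (\<lambda>j\<in>B. g j (\<theta> j x))"
    proof -
      have "\<exists>G. lin A P (dsum B F) G \<and> (\<forall>x\<in>Q. G x = (\<lambda>j\<in>B. g j (\<theta> j x)))"
        by (rule G[OF BQ t'(1,2)])
      then show thesis using that by blast
    qed
    \<comment> \<open>Coordinate \<open>j\<close> of \<open>G\<close> agrees with \<open>h j\<close>
      on \<open>Q\<close>, hence everywhere. Thus \<open>G c\<close> is nonzero at every index of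
      \<open>B\<close>, while its support is finite.\<close>
    have "G c j = h j c" if j: "j \<in> B" for j
    proof -
      have pr: "lin A (dsum B F) (F j) (\<lambda>v. v j)"
      proof (rule lin_dsum_proj[OF ring _ j])
        show "right_module A (F i)" if "i \<in> B" for i using t'(1)[OF that] Y Mod_catD by blast
      qed
      show ?thesis
        by (rule unique_ext_eq[OF ue[OF t'(1)[OF j]] lin_compose[OF G(1) pr] t'(3)[OF j] _ QP c])
          (simp add: G(2) t'(4)[OF j] j)
    qed
    then have "B \<subseteq> supp B F (G c)" using t'(5) by (auto simp: supp_def)
    moreover have "finite (supp B F (G c))" using lin_closed[OF G(1) c] by (simp add: carrier_dsum)
    ultimately show ?thesis by (rule finite_subset)
  qed
  moreover have "h c = \<zero>\<^bsub>Y\<^esub>"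
    if YY: "Y \<in> \<Y>" and h: "lin A P Y h" and h0: "\<And>x. x \<in> B \<Longrightarrow> h x = \<zero>\<^bsub>Y\<^esub>" for Y h
  proof -
    have YM: "right_module A Y" using YY Y Mod_catD by blast
    have hQ: "lin A ?Q Y h" by (rule lin_sub[OF h Q])
    let ?D = "dsum Q (\<lambda>_. Y)"
    obtain G where G: "lin A P ?D G" "\<And>x. x \<in> Q \<Longrightarrow> G x = (\<lambda>j\<in>Q. h (\<theta> j x))"
      using G[of Q "\<lambda>_. Y" "\<lambda>_. h"] YY hQ by auto
    have pr: "lin A ?D Y (\<lambda>v. v j)" if "j \<in> Q" for j
      by (rule lin_dsum_proj[where F = "\<lambda>_. Y", OF ring YM that])
    have "G c j = \<zero>\<^bsub>Y\<^esub>" if j: "j \<in> Q" for j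
    \<comment> \<open>For \<open>j\<close> in \<open>B\<close>, \<open>h\<close> kills
      \<open>j\<close> and therefore all of \<open>h \<circ> \<theta> j\<close>. For other
      \<open>j\<close> the coordinate vanishes at \<open>c\<close> by the choice of
      \<open>B\<close>.\<close>
    proof (cases "j \<in> B")
      case True
      have "G x j = \<zero>\<^bsub>Y\<^esub>" if x: "x \<in> Q" for x
      proof -
        have a: "s x j \<in> carrier A" using lin_closed[OF s, of x] x j by (auto simp: carrier_dsum carrier_reg)
        have "h (\<theta> j x) = h j \<triangleleft>\<^bsub>Y\<^esub> s x j"
          using lin_ract[OF hQ _ a, of j] j by (simp add: \<theta>_def)
        then show ?thesis
          using h0[OF True] right_module.ract_zero_left[OF YM a] x j by (simp add: G(2))
      qed
      then show ?thesis by (rule unique_ext_zero[OF ue[OF YY] lin_compose[OF G(1) pr[OF j]] _ c])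
    next
      case False
      have "\<forall>x\<in>Q. G x j = h (\<theta> j x)" using G(2) j by simp
      then show ?thesis
        using False j YY hQ lin_compose[OF G(1) pr[OF j]] by (simp add: B_def) blast
    qed
    moreover have "G c \<in> (\<Pi>\<^sub>E j\<in>Q. carrier Y)" using lin_closed[OF G(1) c] by (simp add: carrier_dsum)
    ultimately have Gc: "G c = \<zero>\<^bsub>?D\<^esub>"
      by (intro PiE_ext[of "G c" Q "\<lambda>_. carrier Y"])
        (use submod_zero[OF submod_carrier[OF lin_cod[OF G(1)]]] in \<open>auto simp: zero_dsum carrier_dsum\<close>)
    let ?t = "total Q (\<lambda>_. Y) Y (\<lambda>_ y. y)"
    have t: "lin A ?D Y ?t" by (rule lin_total[OF ring YM lin_id[OF YM]])
    have ts: "?t (single Q (\<lambda>_. Y) j y) = y" if "j \<in> Q" "y \<in> carrier Y" for j y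
      by (rule total_single[where F = "\<lambda>_. Y" and g = "\<lambda>_ y. y", OF ring YM lin_id[OF YM] that])
    \<comment> \<open>The family \<open>h \<circ> \<theta> j\<close>, written on the whole free
      module before composition with \<open>s\<close>. There the claim that its sum is
      \<open>h\<close> can be tested on unit vectors.\<close>
    define W where "W v = (\<lambda>j\<in>Q. h (j \<triangleleft>\<^bsub>?Q\<^esub> v j))" for v
    have W: "lin A (free A Q) ?D W"
      unfolding W_def[abs_def]
    proof (rule lin_dsum_tuple[OF ring right_module_free[OF ring]])
      fix j assume j: "j \<in> Q"
      have "lin A (free A Q) (reg A) (\<lambda>v. v j)"
        by (rule lin_dsum_proj[where F = "\<lambda>_. reg A", OF ring right_module_reg[OF ring] j])
      then show "lin A (free A Q) Y (\<lambda>v. h (j \<triangleleft>\<^bsub>?Q\<^esub> v j))"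
        using lin_compose[OF lin_compose[OF _ lin_generator[OF Q.right_module_axioms, of j]] hQ] j by simp
    next
      fix v assume v: "v \<in> carrier (free A Q)"
      have "h (j \<triangleleft>\<^bsub>?Q\<^esub> v j) = \<zero>\<^bsub>Y\<^esub>" if "j \<in> Q" "v j = \<zero>\<^bsub>A\<^esub>" for j
        using Q.ract_zero_right[of j] that lin_zero[OF h] by simp
      then have "{j \<in> Q. h (j \<triangleleft>\<^bsub>?Q\<^esub> v j) \<noteq> \<zero>\<^bsub>Y\<^esub>} \<subseteq> supp Q (\<lambda>_. reg A) v"
        by (auto simp: supp_def zero_reg)
      then show "finite {j \<in> Q. h (j \<triangleleft>\<^bsub>?Q\<^esub> v j) \<noteq> \<zero>\<^bsub>Y\<^esub>}"
        using v by (auto simp: carrier_dsum intro: finite_subset)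
    qed
    have m: "lin A (free A Q) ?Q (free_map A Q ?Q (\<lambda>y. y))"
      by (rule lin_free_map[OF Q.right_module_axioms]) simp
    have eq: "?t (W v) = h (free_map A Q ?Q (\<lambda>y. y) v)" if v: "v \<in> carrier (free A Q)" for v
    proof (rule free_lin_eqI[OF lin_compose[OF W t] lin_compose[OF m hQ] _ v])
      fix j assume j: "j \<in> Q"
      have "W (unit_vec A Q j) = single Q (\<lambda>_. Y) j (h j)"
      proof
        fix i show "W (unit_vec A Q j) i = single Q (\<lambda>_. Y) j (h j) i"
          using Q.ract_one[of j] Q.ract_zero_right[of i] lin_zero[OF h]
          by (cases "i \<in> Q"; cases "i = j") (simp_all add: W_def single_def zero_reg)
      qed
      moreover have "free_map A Q ?Q (\<lambda>y. y) (unit_vec A Q j) = j"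
        by (rule free_map_unit[OF Q.right_module_axioms _ j]) simp
      ultimately show "?t (W (unit_vec A Q j)) = h (free_map A Q ?Q (\<lambda>y. y) (unit_vec A Q j))"
        using ts[OF j] lin_closed[OF hQ, of j] j by simp
    qed
    have "h c = ?t (G c)"
    proof (rule unique_ext_eq[OF ue[OF YY] h lin_compose[OF G(1) t] _ QP c])
      fix x assume x: "x \<in> Q"
      have "G x = W (s x)" using x by (simp add: G(2) W_def \<theta>_def)
      then show "h x = ?t (G x)" using eq[OF lin_closed[OF s]] s_id x by simp
    qed
    then show ?thesis using Gc lin_zero[OF t] by simp
  qed
  ultimately show ?thesis using BQ by (intro exI[of _ B] conjI ballI allI impI) simp_all
qed

section \<open>Relative finite generation and rejects\<close>

lemma fin_gen_sub:
  assumes "submod A M N" "fin_gen A M Q" "Q \<subseteq> N"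
  shows "fin_gen A (sub M N) Q"
proof -
  obtain B where B: "finite B" "B \<subseteq> Q" "\<And>S. submod A M S \<Longrightarrow> B \<subseteq> S \<Longrightarrow> Q \<subseteq> S"
    using assms(2) by (auto simp: fin_gen_def)
  show ?thesis
    unfolding fin_gen_def
    by (intro exI[of _ B] conjI allI impI B) (rule submod_of_sub[OF _ assms(1)])
qed

lemma fin_gen_of_sub:
  assumes "submod A M N" "fin_gen A (sub M N) Q" "Q \<subseteq> N"
  shows "fin_gen A M Q"
  using fin_gen_image[OF lin_inclusion[OF assms(1)] _ assms(2)] assms(3) by simp

text \<open>The preimage in \<open>P\<close> of what is called the reject of the class in
  \<open>P / L\<close>; formulated in \<open>P\<close>, it needs no quotient module.\<close>

definition reject ::
  "('a, 'r) ring_scheme \<Rightarrow> ('a, 'm) rmodule set \<Rightarrow> ('a, 'm) rmodule \<Rightarrow> 'm set \<Rightarrow> 'm set" where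
  "reject A \<Y> P L = {p \<in> carrier P. \<forall>Y\<in>\<Y>. \<forall>h. lin A P Y h \<longrightarrow>
     (\<forall>x\<in>L. h x = \<zero>\<^bsub>Y\<^esub>) \<longrightarrow> h p = \<zero>\<^bsub>Y\<^esub>}"

lemma rejectI:
  assumes "p \<in> carrier P"
    and "\<And>Y h. Y \<in> \<Y> \<Longrightarrow> lin A P Y h \<Longrightarrow> (\<And>x. x \<in> L \<Longrightarrow> h x = \<zero>\<^bsub>Y\<^esub>) \<Longrightarrow> h p = \<zero>\<^bsub>Y\<^esub>"
  shows "p \<in> reject A \<Y> P L"
  using assms by (simp add: reject_def)

lemma rejectD:
  assumes "p \<in> reject A \<Y> P L" "Y \<in> \<Y>" "lin A P Y h" "\<And>x. x \<in> L \<Longrightarrow> h x = \<zero>\<^bsub>Y\<^esub>"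
  shows "h p = \<zero>\<^bsub>Y\<^esub>"
  using assms by (simp add: reject_def)

lemma submod_reject:
  assumes "right_module A P"
  shows "submod A P (reject A \<Y> P L)"
proof -
  interpret P: right_module A P by fact
  have sub: "x \<in> carrier P" if "x \<in> reject A \<Y> P L" for x using that by (simp add: reject_def)
  show ?thesis
  proof (rule submodI[OF P.right_module_axioms])
    fix x y assume x: "x \<in> reject A \<Y> P L" and y: "y \<in> reject A \<Y> P L"
    show "x \<oplus>\<^bsub>P\<^esub> y \<in> reject A \<Y> P L"
    proof (rule rejectI)
      fix Y h assume Y: "Y \<in> \<Y>" "lin A P Y h" "\<And>x. x \<in> L \<Longrightarrow> h x = \<zero>\<^bsub>Y\<^esub>"
      show "h (x \<oplus>\<^bsub>P\<^esub> y) = \<zero>\<^bsub>Y\<^esub>"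
        using lin_add[OF Y(2) sub[OF x] sub[OF y]] rejectD[OF x Y] rejectD[OF y Y]
          submod_add[OF submod_singleton_zero[OF lin_cod[OF Y(2)]]] by simp
    qed (simp add: sub x y)
  next
    fix x a assume x: "x \<in> reject A \<Y> P L" and a: "a \<in> carrier A"
    show "x \<triangleleft>\<^bsub>P\<^esub> a \<in> reject A \<Y> P L"
    proof (rule rejectI)
      fix Y h assume Y: "Y \<in> \<Y>" "lin A P Y h" "\<And>x. x \<in> L \<Longrightarrow> h x = \<zero>\<^bsub>Y\<^esub>"
      show "h (x \<triangleleft>\<^bsub>P\<^esub> a) = \<zero>\<^bsub>Y\<^esub>"
        using lin_ract[OF Y(2) sub[OF x] a] rejectD[OF x Y]
          right_module.ract_zero_left[OF lin_cod[OF Y(2)] a] by simp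
    qed (simp add: P.ract_closed sub x a)
  qed (auto simp: reject_def lin_zero)
qed

context hereditary_universe
begin

lemma right_perp_dprod_copy:
  fixes F :: "'i \<Rightarrow> ('a, 'm) rmodule" and \<X> :: "('a, 'm) rmodule set"
  assumes X: "\<X> \<subseteq> Mod_cat A" and J: "small U J" and F: "\<And>j. j \<in> J \<Longrightarrow> F j \<in> right_perp A \<X>"
  obtains N c d where "N \<in> right_perp A \<X>" "lin A (dprod J F) N c" "lin A N (dprod J F) d"
    "\<And>v. v \<in> carrier (dprod J F) \<Longrightarrow> d (c v) = v"
proof -
  have FM: "F j \<in> Mod_cat A" if "j \<in> J" for j using F[OF that] by (simp add: right_perp_def)
  have FR: "right_module A (F j)" if "j \<in> J" for j using FM[OF that] by (rule Mod_catD)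
  have DM: "right_module A (dprod J F)" by (rule right_module_dprod[OF ring FR])
  have Dsmall: "small U (carrier (dprod J F))" by (rule family_small(1)[OF J FM])
  obtain N :: "('a, 'm) rmodule" and c d where N: "N \<in> Mod_cat A" and c: "lin A (dprod J F) N c"
    and d: "lin A N (dprod J F) d"
    and dc: "\<And>x. x \<in> carrier (dprod J F) \<Longrightarrow> d (c x) = x" and cd: "\<And>y. y \<in> carrier N \<Longrightarrow> c (d y) = y"
    by (fact copy_exists[OF DM Dsmall])
  have "unique_ext A P (hom_kernel P X f) N" if "X \<in> \<X>" "presents A P f X" for X P f
  proof -
    have f: "lin A P X f" using that(2) by (simp add: presents_def)
    have "unique_ext A P (hom_kernel P X f) (dprod J F)"
    proof (rule unique_ext_dprod[OF ring FR lin_dom[OF f]])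
      show "unique_ext A P (hom_kernel P X f) (F j)" if "j \<in> J" for j
        using F[OF that] \<open>X \<in> \<X>\<close> \<open>presents A P f X\<close> unfolding right_perp_iff[OF X] by blast
    qed
    from unique_ext_iso[OF c d cd this submod_kernel[OF f]] show ?thesis .
  qed
  then have "N \<in> right_perp A \<X>" unfolding right_perp_iff[OF X] using N by blast
  with c d dc show thesis by (intro that)
qed

lemma right_perp_extension:
  fixes \<X> :: "('a, 'm) rmodule set" and E :: "('a, 'm) rmodule"
  assumes X: "\<X> \<subseteq> Mod_cat A" and Y: "Y \<in> right_perp A \<X>" and Z: "Z \<in> right_perp A \<X>"
    and E: "E \<in> Mod_cat A" and i: "lin A Y E i" "inj_on i (carrier Y)"
    and q: "lin A E Z q" "q ` carrier E = carrier Z" and ex: "hom_kernel E Z q = i ` carrier Y"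
  shows "E \<in> right_perp A \<X>"
proof -
  have "unique_ext A P (hom_kernel P X' f) E" if X': "X' \<in> \<X>" and P: "presents A P f X'" for X' P f
  proof (rule unique_ext_extension[OF _ _ submod_kernel E _ i q ex])
    show "P \<in> Mod_cat A" "projective A P" "lin A P X' f" using P by (simp_all add: presents_def)
    show "Z \<in> Mod_cat A" using Z by (simp add: right_perp_def)
    show "unique_ext A P (hom_kernel P X' f) Y" "unique_ext A P (hom_kernel P X' f) Z"
      using Y Z X' P unfolding right_perp_iff[OF X] by blast+
  qed
  then show ?thesis unfolding right_perp_iff[OF X] using E by blast
qed

text \<open>Let \<open>R\<close> be the reject and embed \<open>P / R\<close> into a module \<open>N\<close> of the class
  \<open>right_perp A \<X>\<close>.  Because \<open>A\<close> is hereditary,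
  every extension of \<open>P / R\<close> by \<open>Y\<close> is the pullback of an extension of \<open>N\<close>, which is again in the class.
  Hence \<open>k\<close>, composed with an embedding of \<open>Y\<close>, becomes the restriction of a homomorphism from \<open>P / L\<close> into a
  module of the class, and vanishes.\<close>

lemma reject_hom_zero:
  fixes \<X> :: "('a, 'm) rmodule set" and P Y :: "('a, 'm) rmodule"
  assumes X: "\<X> \<subseteq> Mod_cat A" and P: "P \<in> Mod_cat A" "projective A P" and L: "L \<subseteq> carrier P"
    and R: "R = reject A (right_perp A \<X>) P L"
    and Y: "Y \<in> right_perp A \<X>" and k: "lin A (sub P R) Y k"
    and kL: "\<And>x. x \<in> L \<Longrightarrow> k x = \<zero>\<^bsub>Y\<^esub>" and x: "x \<in> R"
  shows "k x = \<zero>\<^bsub>Y\<^esub>"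
proof -
  have YM: "Y \<in> Mod_cat A" using Y by (simp add: right_perp_def)
  interpret P: right_module A P by (rule Mod_catD[OF P(1)])
  have RP: "submod A P R" unfolding R by (rule submod_reject[OF P.right_module_axioms])
  have LR: "L \<subseteq> R" using L by (auto simp: R reject_def)
  \<comment> \<open>One factor for each element outside \<open>R\<close>, with a map that kills
    \<open>L\<close> but not this element. The index set is small, so the product stays in the
    class, and the resulting map \<open>H\<close> has kernel exactly \<open>R\<close>.\<close>
  let ?J = "carrier P - R"
  have "\<exists>t. fst t \<in> right_perp A \<X> \<and> lin A P (fst t) (snd t) \<and> (\<forall>x\<in>L. snd t x = \<zero>\<^bsub>fst t\<^esub>) \<and>
      snd t p \<noteq> \<zero>\<^bsub>fst t\<^esub>" if "p \<in> ?J" for p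
  proof -
    obtain Z h where "Z \<in> right_perp A \<X>" "lin A P Z h" "\<forall>x\<in>L. h x = \<zero>\<^bsub>Z\<^esub>" "h p \<noteq> \<zero>\<^bsub>Z\<^esub>"
      using \<open>p \<in> ?J\<close> by (auto simp: R reject_def)
    then show ?thesis by (intro exI[of _ "(Z, h)"]) simp
  qed
  then have "\<exists>t. \<forall>p\<in>?J. fst (t p) \<in> right_perp A \<X> \<and> lin A P (fst (t p)) (snd (t p)) \<and>
      (\<forall>x\<in>L. snd (t p) x = \<zero>\<^bsub>fst (t p)\<^esub>) \<and> snd (t p) p \<noteq> \<zero>\<^bsub>fst (t p)\<^esub>"
    by (intro bchoice ballI)
  then obtain t where tt: "\<forall>p\<in>?J. fst (t p) \<in> right_perp A \<X> \<and> lin A P (fst (t p)) (snd (t p)) \<and>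
      (\<forall>x\<in>L. snd (t p) x = \<zero>\<^bsub>fst (t p)\<^esub>) \<and> snd (t p) p \<noteq> \<zero>\<^bsub>fst (t p)\<^esub>" ..
  define F where "F p = fst (t p)" for p
  define w where "w p = snd (t p)" for p
  have F: "F p \<in> right_perp A \<X>" and w: "lin A P (F p) (w p)" and wL: "\<And>x. x \<in> L \<Longrightarrow> w p x = \<zero>\<^bsub>F p\<^esub>"
    and wp: "w p p \<noteq> \<zero>\<^bsub>F p\<^esub>" if "p \<in> ?J" for p
    using bspec[OF tt that] by (simp_all add: F_def w_def)
  have "small U ?J" by (rule small_subset[OF Mod_cat_small[OF P(1)]]) auto
  then obtain N c d where N: "N \<in> right_perp A \<X>" and c: "lin A (dprod ?J F) N c"
    and d: "lin A N (dprod ?J F) d" and dc: "\<And>v. v \<in> carrier (dprod ?J F) \<Longrightarrow> d (c v) = v"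
    by (rule right_perp_dprod_copy[where F = F, OF X _ F]) (assumption, rule that, assumption+)
  have NM: "N \<in> Mod_cat A" using N by (simp add: right_perp_def)
  interpret N: right_module A N by (rule Mod_catD[OF NM])
  let ?H0 = "\<lambda>x. \<lambda>p\<in>?J. w p x"
  have H0: "lin A P (dprod ?J F) ?H0" by (rule lin_dprod_tuple[OF ring P.right_module_axioms w])
  define H where "H x = c (?H0 x)" for x
  have H: "lin A P N H" unfolding H_def[abs_def] by (rule lin_compose[OF H0 c])
  have HR: "H p = \<zero>\<^bsub>N\<^esub> \<longleftrightarrow> p \<in> R" if p: "p \<in> carrier P" for p
  proof
    assume "H p = \<zero>\<^bsub>N\<^esub>"
    then have eq0: "?H0 p = \<zero>\<^bsub>dprod ?J F\<^esub>"
      using dc[OF lin_closed[OF H0 p]] lin_zero[OF d] by (simp add: H_def)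
    have z: "w i p = \<zero>\<^bsub>F i\<^esub>" if "i \<in> ?J" for i
      using fun_cong[OF eq0, of i] that by (simp add: zero_dprod)
    show "p \<in> R"
    proof (rule ccontr)
      assume "p \<notin> R"
      then have pJ: "p \<in> ?J" using p by simp
      show False using z[OF pJ] wp[OF pJ] by simp
    qed
  next
    assume "p \<in> R"
    then have p: "p \<in> reject A (right_perp A \<X>) P L" by (simp add: R)
    have "w i p = \<zero>\<^bsub>F i\<^esub>" if "i \<in> ?J" for i
      by (rule rejectD[OF p F[OF that] w[OF that] wL[OF that]])
    then have "?H0 p = \<zero>\<^bsub>dprod ?J F\<^esub>" by (auto simp: zero_dprod)
    then show "H p = \<zero>\<^bsub>N\<^esub>" using lin_zero[OF c] by (simp add: H_def)
  qed
  \<comment> \<open>Present \<open>N\<close> by \<open>V\<close> and restrict to the preimage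
    \<open>VS\<close> of the image of \<open>H\<close>, a copy of \<open>P / R\<close>. Heredity
    makes \<open>VS\<close> projective, so that it maps back to \<open>P\<close> by
    \<open>lm\<close>.\<close>
  obtain V u where V: "presents A V u N" using presentation_exists[OF NM] by blast
  have VM: "V \<in> Mod_cat A" "projective A V" and u: "lin A V N u" "u ` carrier V = carrier N"
    using V by (simp_all add: presents_def)
  let ?S = "H ` carrier P"
  have S: "submod A N ?S" by (rule submod_image[OF H submod_carrier[OF P.right_module_axioms]])
  define VS where "VS = {p \<in> carrier V. u p \<in> ?S}"
  have VS: "submod A V VS" unfolding VS_def by (rule submod_vimage[OF u(1) S])
  have VS_proj: "projective A (sub V VS)" by (rule projective_sub[OF VM VS])
  have H': "lin A P (sub N ?S) H" by (rule lin_into_sub[OF H S]) simp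
  have uS: "lin A (sub V VS) (sub N ?S) u" by (rule lin_into_sub[OF lin_sub[OF u(1) VS] S]) (simp add: VS_def)
  have Hsurj: "H ` carrier P = carrier (sub N ?S)" by simp
  obtain lm where lm: "lin A (sub V VS) P lm" "\<And>p. p \<in> carrier (sub V VS) \<Longrightarrow> H (lm p) = u p"
  proof -
    note pD = projectiveD[OF VS_proj P(1) Mod_cat_sub[OF NM S] H' Hsurj uS]
    show thesis by (rule pD) (rule that)
  qed
  obtain \<mu> where \<mu>: "lin A P V \<mu>" "\<And>p. p \<in> carrier P \<Longrightarrow> u (\<mu> p) = H p"
    by (rule projectiveD[OF P(2) VM(1) NM u H]) (rule that)
  have \<mu>S: "\<mu> p \<in> VS" if "p \<in> carrier P" for p
    using that lin_closed[OF \<mu>(1) that] \<mu>(2)[OF that] by (simp add: VS_def)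
  have \<mu>': "lin A P (sub V VS) \<mu>" by (rule lin_into_sub[OF \<mu>(1) VS \<mu>S])
  let ?K = "hom_kernel V N u"
  have K: "submod A V ?K" by (rule submod_kernel[OF u(1)])
  have KS: "?K \<subseteq> VS" using lin_zero[OF H] P.zero_closed by (auto simp: VS_def hom_kernel_def intro!: image_eqI[of _ _ "\<zero>\<^bsub>P\<^esub>"])
  \<comment> \<open>\<open>lm\<close> carries the kernel of \<open>u\<close> into \<open>R\<close>,
    so \<open>k \<circ> lm\<close> is defined there and yields an extension of the whole of
    \<open>N\<close> by \<open>Y\<close>.\<close>
  have lmK: "lin A (sub V ?K) (sub P R) lm"
  proof (rule lin_into_sub[OF _ RP])
    show "lin A (sub V ?K) P lm" using lin_sub[OF lm(1) submod_sub[OF VS K KS]] by simp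
    show "lm p \<in> R" if "p \<in> carrier (sub V ?K)" for p
    proof -
      have pS: "p \<in> VS" using that KS by auto
      have "H (lm p) = \<zero>\<^bsub>N\<^esub>" using lm(2)[of p] pS that by (simp add: hom_kernel_def)
      then show ?thesis using HR[OF lin_closed[OF lm(1)]] pS by simp
    qed
  qed
  obtain E :: "('a, 'm) rmodule" and i j q where E: "E \<in> Mod_cat A" and i: "lin A Y E i" "inj_on i (carrier Y)"
    and j: "lin A V E j" and q: "lin A E N q" "q ` carrier E = carrier N" and ex: "hom_kernel E N q = i ` carrier Y"
    and ji: "\<And>x. x \<in> ?K \<Longrightarrow> j x = i (k (lm x))"
    by (rule pushout_exists[OF VM(1) YM u lin_compose[OF lmK k]]) (rule that)
  interpret E: right_module A E by (rule Mod_catD[OF E])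
  interpret Y: right_module A Y by (rule Mod_catD[OF YM])
  have EY: "E \<in> right_perp A \<X>" by (rule right_perp_extension[OF X Y N E i q ex])
  define \<delta> where "\<delta> x = x \<ominus>\<^bsub>P\<^esub> lm (\<mu> x)" for x
  have lm\<mu>: "lin A P P (\<lambda>x. lm (\<mu> x))" by (rule lin_compose[OF \<mu>' lm(1)])
  have \<delta>P: "lin A P P \<delta>" unfolding \<delta>_def[abs_def] by (rule lin_diff[OF lin_id[OF P.right_module_axioms] lm\<mu>])
  have \<delta>: "lin A P (sub P R) \<delta>"
  proof (rule lin_into_sub[OF \<delta>P RP])
    show "\<delta> p \<in> R" if p: "p \<in> carrier P" for p
    proof -
      have "H (\<delta> p) = \<zero>\<^bsub>N\<^esub>"
        using lin_minus[OF H p lin_closed[OF lm\<mu> p]] lm(2)[of "\<mu> p"] \<mu>S[OF p] \<mu>(2)[OF p] lin_closed[OF H p]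
        by (simp add: \<delta>_def minus_eq_zero_iff[OF N.right_module_axioms])
      then show ?thesis using HR[OF lin_closed[OF \<delta>P p]] by simp
    qed
  qed
  \<comment> \<open>On \<open>R\<close> the identity is \<open>lm \<circ> \<mu>\<close> plus
    \<open>\<delta>\<close>. The pushout handles the first part and \<open>k\<close> the second, so
    \<open>m\<close> extends \<open>i \<circ> k\<close> from \<open>R\<close> to all of
    \<open>P\<close>.\<close>
  define m where "m x = j (\<mu> x) \<oplus>\<^bsub>E\<^esub> i (k (\<delta> x))" for x
  have m: "lin A P E m"
    unfolding m_def[abs_def]
    by (rule lin_plus[OF lin_compose[OF \<mu>(1) j] lin_compose[OF \<delta> lin_compose[OF k i(1)]]])
  have mR: "m p = i (k p)" if p: "p \<in> R" for p
  proof -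
    have pP: "p \<in> carrier P" using p submod_subset[OF RP] by blast
    have \<mu>K: "\<mu> p \<in> ?K" using lin_closed[OF \<mu>(1) pP] \<mu>(2)[OF pP] HR[OF pP] p by (simp add: hom_kernel_def)
    have lR: "lm (\<mu> p) \<in> R" using lin_closed[OF lmK] \<mu>K by simp
    have dR: "\<delta> p \<in> R" using lin_closed[OF \<delta> pP] by simp
    have "m p = i (k (lm (\<mu> p)) \<oplus>\<^bsub>Y\<^esub> k (\<delta> p))"
      using ji[OF \<mu>K] lin_add[OF i(1)] lin_closed[OF k] lR dR by (simp add: m_def)
    also have "k (lm (\<mu> p)) \<oplus>\<^bsub>Y\<^esub> k (\<delta> p) = k (lm (\<mu> p) \<oplus>\<^bsub>P\<^esub> \<delta> p)"
      using lin_add[OF k, of "lm (\<mu> p)" "\<delta> p"] lR dR by simp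
    also have "lm (\<mu> p) \<oplus>\<^bsub>P\<^esub> \<delta> p = p"
      using pP lin_closed[OF lm\<mu> pP]
      by (simp add: \<delta>_def a_minus_def P.a_comm[of "lm (\<mu> p)"] P.a_assoc P.l_neg)
    finally show ?thesis .
  qed
  have "m y = \<zero>\<^bsub>E\<^esub>" if "y \<in> L" for y
    using mR[of y] kL[OF that] lin_zero[OF i(1)] LR that by auto
  \<comment> \<open>Now \<open>m\<close> is defined on \<open>P\<close>, kills \<open>L\<close> and
    has its target in the class, so the definition of the reject applies.\<close>
  then have "m x = \<zero>\<^bsub>E\<^esub>" by (rule rejectD[OF x[unfolded R] EY m])
  then have "i (k x) = i \<zero>\<^bsub>Y\<^esub>" using mR[OF x] lin_zero[OF i(1)] by simp
  then show ?thesis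
    using inj_onD[OF i(2)] lin_closed[OF k, of x] x by simp
qed

end

section \<open>Finitely generated orthogonal subquotients and their directed union\<close>

context hereditary_universe
begin

text \<open>Prescribing the finite sets \<open>B\<close> and \<open>C\<close> is what later makes
  the pairs directed and exhausting: generators of given pairs, elements to be reached and elements
  to be killed are all fed in here.\<close>

lemma fin_gen_orthogonal_subquotient:
  fixes \<X> :: "('a, 'm) rmodule set" and P :: "('a, 'm) rmodule"
  assumes X: "\<X> \<subseteq> Mod_cat A" and closed: "closed_under_coproducts A (right_perp A \<X>)"
    and P: "P \<in> Mod_cat A" "projective A P" and Q: "submod A P Q"
    and ue: "\<And>Y. Y \<in> right_perp A \<X> \<Longrightarrow> unique_ext A P Q Y"
    and C: "finite C" "C \<subseteq> carrier P" and B: "finite B" "B \<subseteq> Q"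
  obtains L N where "submod A P L" "submod A P N" "B \<subseteq> L" "L \<subseteq> Q" "L \<subseteq> N" "C \<subseteq> N"
    "fin_gen A P L" "fin_gen A P N" "\<And>Y. Y \<in> right_perp A \<X> \<Longrightarrow> unique_ext A (sub P N) L Y"
proof -
  let ?Y = "right_perp A \<X>"
  have YM: "?Y \<subseteq> Mod_cat A" by (auto simp: right_perp_def)
  have QM: "sub P Q \<in> Mod_cat A" by (rule Mod_cat_sub[OF P(1) Q])
  have Qproj: "projective A (sub P Q)" by (rule projective_sub[OF P Q])
  have QP: "Q \<subseteq> carrier P" by (rule submod_subset[OF Q])
  have "\<exists>B. finite B \<and> B \<subseteq> Q \<and>
    (\<forall>Y\<in>?Y. \<forall>h. lin A P Y h \<longrightarrow> (\<forall>x\<in>B. h x = \<zero>\<^bsub>Y\<^esub>) \<longrightarrow> h c = \<zero>\<^bsub>Y\<^esub>)" if "c \<in> C" for c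
    using that C(2) by (intro finite_support_of_unique_ext[OF P(1) Q Qproj YM closed ue]) auto
  then have "\<exists>b. \<forall>c\<in>C. finite (b c) \<and> b c \<subseteq> Q \<and>
    (\<forall>Y\<in>?Y. \<forall>h. lin A P Y h \<longrightarrow> (\<forall>x\<in>b c. h x = \<zero>\<^bsub>Y\<^esub>) \<longrightarrow> h c = \<zero>\<^bsub>Y\<^esub>)"
    by (intro bchoice ballI)
  then obtain b where b: "\<forall>c\<in>C. finite (b c) \<and> b c \<subseteq> Q \<and>
    (\<forall>Y\<in>?Y. \<forall>h. lin A P Y h \<longrightarrow> (\<forall>x\<in>b c. h x = \<zero>\<^bsub>Y\<^esub>) \<longrightarrow> h c = \<zero>\<^bsub>Y\<^esub>)" ..
  \<comment> \<open>Besides the prescribed \<open>B\<close>, \<open>L\<close> has to contain the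
    finite supports of all elements of \<open>C\<close>; this puts \<open>C\<close> inside the
    reject.\<close>
  let ?B = "B \<union> (\<Union>c\<in>C. b c)"
  have Bfin: "finite ?B" "?B \<subseteq> carrier (sub P Q)" using b B C(1) by auto
  obtain \<rho> where \<rho>: "lin A (sub P Q) (sub P Q) \<rho>" "\<And>x. x \<in> carrier (sub P Q) \<Longrightarrow> \<rho> (\<rho> x) = \<rho> x"
    "\<And>x. x \<in> ?B \<Longrightarrow> \<rho> x = x" "fin_gen A (sub P Q) (\<rho> ` carrier (sub P Q))"
    by (rule finite_subset_in_fin_gen_summand[OF QM Qproj Bfin]) (rule that)
  define L where "L = \<rho> ` Q"
  have LQ: "L \<subseteq> Q" using lin_closed[OF \<rho>(1)] by (auto simp: L_def)
  have L: "submod A P L"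
    unfolding L_def using submod_of_sub[OF submod_image[OF \<rho>(1) submod_carrier[OF Mod_catD[OF QM]]] Q] by simp
  have BL: "?B \<subseteq> L"
  proof
    fix x assume x: "x \<in> ?B"
    have "x \<in> Q" using Bfin(2) x by auto
    then show "x \<in> L" unfolding L_def using \<rho>(3)[OF x] by (metis imageI)
  qed
  have Lfg: "fin_gen A P L" using fin_gen_of_sub[OF Q _ LQ] \<rho>(4) by (simp add: L_def)
  have \<rho>L: "\<rho> x = x" if "x \<in> L" for x using that \<rho>(2) by (auto simp: L_def)
  have \<rho>': "lin A (sub P Q) (sub P L) \<rho>"
    by (rule lin_into_sub[OF lin_from_sub[OF \<rho>(1) Q] L]) (simp add: L_def)
  define R where "R = reject A ?Y P L"
  have R: "submod A P R" unfolding R_def by (rule submod_reject[OF Mod_catD[OF P(1)]])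
  have RM: "sub P R \<in> Mod_cat A" by (rule Mod_cat_sub[OF P(1) R])
  have LR: "L \<subseteq> R" using LQ QP by (auto simp: R_def reject_def)
  have CR: "C \<subseteq> R"
  proof
    fix c assume c: "c \<in> C"
    have "h c = \<zero>\<^bsub>Y\<^esub>" if Y: "Y \<in> ?Y" "lin A P Y h" and L0: "\<And>x. x \<in> L \<Longrightarrow> h x = \<zero>\<^bsub>Y\<^esub>" for Y h
    proof -
      have "\<forall>x\<in>b c. h x = \<zero>\<^bsub>Y\<^esub>" using BL c L0 by blast
      then show ?thesis using b c Y by blast
    qed
    then show "c \<in> R" unfolding R_def using c C(2) by (intro rejectI) auto
  qed
  \<comment> \<open>Generators of \<open>L\<close> are enclosed together with \<open>C\<close>, so
    that the summand of \<open>R\<close> contains \<open>L\<close>.\<close>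
  obtain B' where B': "finite B'" "B' \<subseteq> L" "\<And>S. submod A P S \<Longrightarrow> B' \<subseteq> S \<Longrightarrow> L \<subseteq> S"
    using Lfg by (auto simp: fin_gen_def)
  have BC: "finite (B' \<union> C)" "B' \<union> C \<subseteq> carrier (sub P R)" using B' C(1) LR CR by auto
  obtain \<sigma> where \<sigma>: "lin A (sub P R) (sub P R) \<sigma>" "\<And>x. x \<in> carrier (sub P R) \<Longrightarrow> \<sigma> (\<sigma> x) = \<sigma> x"
    "\<And>x. x \<in> B' \<union> C \<Longrightarrow> \<sigma> x = x" "fin_gen A (sub P R) (\<sigma> ` carrier (sub P R))"
    by (rule finite_subset_in_fin_gen_summand[OF RM projective_sub[OF P R] BC]) (rule that)
  define N where "N = \<sigma> ` R"
  have NR: "N \<subseteq> R" using lin_closed[OF \<sigma>(1)] by (auto simp: N_def)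
  have N: "submod A P N"
    unfolding N_def using submod_of_sub[OF submod_image[OF \<sigma>(1) submod_carrier[OF Mod_catD[OF RM]]] R] by simp
  have Nfg: "fin_gen A P N" using fin_gen_of_sub[OF R _ NR] \<sigma>(4) by (simp add: N_def)
  have \<sigma>N: "\<sigma> x = x" if "x \<in> N" for x using that \<sigma>(2) by (auto simp: N_def)
  have fixN: "x \<in> N" if "x \<in> B' \<union> C" for x
  proof -
    have "x \<in> R" using that BC(2) by auto
    then show ?thesis unfolding N_def using \<sigma>(3)[OF that] by (metis imageI)
  qed
  have LN: "L \<subseteq> N" by (rule B'(3)[OF N]) (use fixN in blast)
  have \<sigma>': "lin A (sub P R) (sub P N) \<sigma>"
    by (rule lin_into_sub[OF lin_from_sub[OF \<sigma>(1) R] N]) (simp add: N_def)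
  have "unique_ext A (sub P N) L Y" if Y: "Y \<in> ?Y" for Y
  proof (rule unique_extI)
    fix g assume g: "lin A (sub (sub P N) L) Y g"
    then have "lin A (sub P L) Y g" by simp
    \<comment> \<open>Existence: \<open>g \<circ> \<rho>\<close> is defined on \<open>Q\<close>,
      extends to \<open>P\<close>, and agrees with \<open>g\<close> on \<open>L\<close>, which
      \<open>\<rho>\<close> fixes.\<close>
    then obtain h where h: "lin A P Y h" "\<And>x. x \<in> Q \<Longrightarrow> h x = g (\<rho> x)"
      using unique_ext_exists[OF ue[OF Y] lin_compose[OF \<rho>']] by blast
    have "h x = g x" if "x \<in> L" for x using h(2)[of x] \<rho>L[OF that] LQ that by auto
    then show "\<exists>h. lin A (sub P N) Y h \<and> (\<forall>x\<in>L. h x = g x)" using lin_sub[OF h(1) N] by blast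
  next
    fix h x assume h: "lin A (sub P N) Y h" and h0: "\<And>x. x \<in> L \<Longrightarrow> h x = \<zero>\<^bsub>Y\<^esub>" and x: "x \<in> carrier (sub P N)"
    have LP: "L \<subseteq> carrier P" using LQ QP by blast
    have xN: "x \<in> N" using x by simp
    \<comment> \<open>Uniqueness: the projection \<open>\<sigma>\<close> extends \<open>h\<close>
      from the summand \<open>N\<close> to \<open>R\<close>, where every homomorphism that kills
      \<open>L\<close> is zero.\<close>
    have "h (\<sigma> x) = \<zero>\<^bsub>Y\<^esub>"
    proof (rule reject_hom_zero[OF X P LP R_def Y lin_compose[OF \<sigma>' h]])
      show "h (\<sigma> y) = \<zero>\<^bsub>Y\<^esub>" if "y \<in> L" for y
        using h0[OF that] \<sigma>N LN that by auto
      show "x \<in> R" using xN NR by blast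
    qed
    then show "h x = \<zero>\<^bsub>Y\<^esub>" using \<sigma>N[OF xN] by simp
  qed
  moreover have "B \<subseteq> L" "C \<subseteq> N" using BL fixN by auto
  ultimately show thesis using that[OF L N _ LQ LN _ Lfg Nfg] by blast
qed

text \<open>A presentation \<open>Q \<rightarrow> P \<rightarrow> M\<close> is the directed union of its subpresentations \<open>L \<rightarrow> N\<close> by
  finitely generated submodules with \<open>N / L\<close> in \<open>\<X>\<close>.\<close>

lemma filtered_colimit_of_finitely_presented:
  fixes \<X> :: "('a, 'm) rmodule set" and M :: "('a, 'm) rmodule"
  assumes pair: "ext_orthogonal_pair A \<X> \<Y>" and closed: "closed_under_coproducts A \<Y>"
    and M: "M \<in> \<X>"
  shows "filtered_colimit_of A {X \<in> \<X>. finitely_presented A X} M"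
proof -
  have X: "\<X> \<subseteq> Mod_cat A" and \<Y>: "right_perp A \<X> = \<Y>" and \<X>: "\<X> = left_perp A \<Y>"
    using pair unfolding ext_orthogonal_pair_def by blast+
  have \<Y>M: "\<Y> \<subseteq> Mod_cat A" using pair by (simp add: ext_orthogonal_pair_def)
  have MM: "M \<in> Mod_cat A" using M X by blast
  obtain P f where pres: "presents A P f M" using presentation_exists[OF MM] by blast
  have P: "P \<in> Mod_cat A" "projective A P" and f: "lin A P M f" "f ` carrier P = carrier M"
    using pres by (simp_all add: presents_def)
  define Q where "Q = hom_kernel P M f"
  have Q: "submod A P Q" unfolding Q_def by (rule submod_kernel[OF f(1)])
  have QP: "Q \<subseteq> carrier P" by (rule submod_subset[OF Q])
  have ue: "unique_ext A P Q Y" if "Y \<in> right_perp A \<X>" for Y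
    using that M pres unfolding right_perp_iff[OF X] Q_def by blast
  \<comment> \<open>The index set consists of pairs rather than modules \<open>N / L\<close>:
    ordered by inclusion in both components, they yield canonical transition maps.\<close>
  define S where "S = {(L, N). submod A P L \<and> submod A P N \<and> L \<subseteq> Q \<and> L \<subseteq> N \<and>
    fin_gen A P L \<and> fin_gen A P N \<and> (\<forall>Y\<in>\<Y>. unique_ext A (sub P N) L Y)}"
  have S: "submod A P (fst i)" "submod A P (snd i)" "fst i \<subseteq> Q" "fst i \<subseteq> snd i"
    "fin_gen A P (fst i)" "fin_gen A P (snd i)" "\<And>Y. Y \<in> \<Y> \<Longrightarrow> unique_ext A (sub P (snd i)) (fst i) Y"
    if "i \<in> S" for i
    using that by (auto simp: S_def)
  have enlarge: "\<exists>i\<in>S. B \<subseteq> fst i \<and> C \<subseteq> snd i"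
    if BC: "finite B" "B \<subseteq> Q" "finite C" "C \<subseteq> carrier P" for B C
  proof -
    obtain L N where "submod A P L" "submod A P N" "B \<subseteq> L" "L \<subseteq> Q" "L \<subseteq> N" "C \<subseteq> N"
      "fin_gen A P L" "fin_gen A P N" "\<And>Y. Y \<in> right_perp A \<X> \<Longrightarrow> unique_ext A (sub P N) L Y"
      by (rule fin_gen_orthogonal_subquotient[OF X closed[folded \<Y>] P Q ue BC(3,4,1,2)])
        (assumption, rule that)
    then show ?thesis unfolding \<Y> by (intro bexI[of _ "(L, N)"]) (auto simp: S_def)
  qed
  \<comment> \<open>The additional set \<open>B\<close> is empty for directedness; a singleton kills
    a given element at a later stage.\<close>
  have bound: "\<exists>k\<in>S. fst i \<subseteq> fst k \<and> snd i \<subseteq> snd k \<and> fst j \<subseteq> fst k \<and> snd j \<subseteq> snd k \<and> B \<subseteq> fst k"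
    if i: "i \<in> S" and j: "j \<in> S" and B: "finite B" "B \<subseteq> Q" for i j B
  proof -
    obtain Bi where Bi: "finite Bi" "Bi \<subseteq> fst i" "\<And>S. submod A P S \<Longrightarrow> Bi \<subseteq> S \<Longrightarrow> fst i \<subseteq> S"
      using S(5)[OF i] by (auto simp: fin_gen_def)
    obtain Ci where Ci: "finite Ci" "Ci \<subseteq> snd i" "\<And>S. submod A P S \<Longrightarrow> Ci \<subseteq> S \<Longrightarrow> snd i \<subseteq> S"
      using S(6)[OF i] by (auto simp: fin_gen_def)
    obtain Bj where Bj: "finite Bj" "Bj \<subseteq> fst j" "\<And>S. submod A P S \<Longrightarrow> Bj \<subseteq> S \<Longrightarrow> fst j \<subseteq> S"
      using S(5)[OF j] by (auto simp: fin_gen_def)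
    obtain Cj where Cj: "finite Cj" "Cj \<subseteq> snd j" "\<And>S. submod A P S \<Longrightarrow> Cj \<subseteq> S \<Longrightarrow> snd j \<subseteq> S"
      using S(6)[OF j] by (auto simp: fin_gen_def)
    have "Bi \<union> Bj \<union> B \<subseteq> Q" using Bi(2) Bj(2) S(3)[OF i] S(3)[OF j] B(2) by blast
    moreover have "Ci \<union> Cj \<subseteq> carrier P"
      using Ci(2) Cj(2) submod_subset[OF S(2)[OF i]] submod_subset[OF S(2)[OF j]] by blast
    ultimately obtain k where k: "k \<in> S" "Bi \<union> Bj \<union> B \<subseteq> fst k" "Ci \<union> Cj \<subseteq> snd k"
      using enlarge[of "Bi \<union> Bj \<union> B" "Ci \<union> Cj"] Bi(1) Bj(1) B(1) Ci(1) Cj(1) by auto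
    have "fst i \<subseteq> fst k" "snd i \<subseteq> snd k" "fst j \<subseteq> fst k" "snd j \<subseteq> snd k" "B \<subseteq> fst k"
      using Bi(3)[OF S(1)[OF k(1)]] Bj(3)[OF S(1)[OF k(1)]] Ci(3)[OF S(2)[OF k(1)]]
        Cj(3)[OF S(2)[OF k(1)]] k(2,3) by simp_all
    then show ?thesis using k(1) by blast
  qed
  have "\<exists>t :: ('a, 'm) rmodule \<times> ('m \<Rightarrow> 'm). fst t \<in> Mod_cat A \<and> lin A (sub P (snd i)) (fst t) (snd t) \<and>
      snd t ` snd i = carrier (fst t) \<and> hom_kernel (sub P (snd i)) (fst t) (snd t) = fst i"
    if i: "i \<in> S" for i
  proof -
    have L: "submod A (sub P (snd i)) (fst i)" by (rule submod_sub[OF S(2,1,4)[OF i]])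
    have "small U (carrier (sub P (snd i)))" by (rule Mod_cat_small[OF Mod_cat_sub[OF P(1) S(2)[OF i]]])
    from quotient_exists[OF L this] obtain D :: "('a, 'm) rmodule" and c where
      "D \<in> Mod_cat A" "lin A (sub P (snd i)) D c" "c ` carrier (sub P (snd i)) = carrier D"
      "hom_kernel (sub P (snd i)) D c = fst i" by blast
    then show ?thesis by (intro exI[of _ "(D, c)"]) simp
  qed
  then have "\<exists>t :: _ \<Rightarrow> ('a, 'm) rmodule \<times> ('m \<Rightarrow> 'm). \<forall>i\<in>S. fst (t i) \<in> Mod_cat A \<and> lin A (sub P (snd i)) (fst (t i)) (snd (t i)) \<and>
      snd (t i) ` snd i = carrier (fst (t i)) \<and>
      hom_kernel (sub P (snd i)) (fst (t i)) (snd (t i)) = fst i"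
    by (intro bchoice ballI)
  then obtain t :: "_ \<Rightarrow> ('a, 'm) rmodule \<times> ('m \<Rightarrow> 'm)"
    where t: "\<forall>i\<in>S. fst (t i) \<in> Mod_cat A \<and> lin A (sub P (snd i)) (fst (t i)) (snd (t i)) \<and>
      snd (t i) ` snd i = carrier (fst (t i)) \<and>
      hom_kernel (sub P (snd i)) (fst (t i)) (snd (t i)) = fst i" ..
  define D where "D i = fst (t i)" for i
  define c where "c i = snd (t i)" for i
  have D: "D i \<in> Mod_cat A" and c: "lin A (sub P (snd i)) (D i) (c i)" and csurj: "c i ` snd i = carrier (D i)"
    and cker: "hom_kernel (sub P (snd i)) (D i) (c i) = fst i" if "i \<in> S" for i
    using bspec[OF t that] by (simp_all add: D_def c_def)
  have c0: "c i x = \<zero>\<^bsub>D i\<^esub> \<longleftrightarrow> x \<in> fst i" if "i \<in> S" "x \<in> snd i" for i x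
    unfolding cker[OF that(1), symmetric] using that(2) by (simp add: hom_kernel_def)
  have Dfp: "D i \<in> {X \<in> \<X>. finitely_presented A X}" if i: "i \<in> S" for i
  proof -
    have N: "sub P (snd i) \<in> Mod_cat A" "projective A (sub P (snd i))"
      using Mod_cat_sub[OF P(1) S(2)[OF i]] projective_sub[OF P S(2)[OF i]] by simp_all
    have pr: "presents A (sub P (snd i)) (c i) (D i)"
      using N D[OF i] c[OF i] csurj[OF i] by (simp add: presents_def)
    have "trivial_group (Ext_total A (D i) Y)" if "Y \<in> \<Y>" for Y
      using Ext_total_trivial_iff[OF pr, of Y] S(7)[OF i that] \<Y>M that by (auto simp: cker[OF i])
    \<comment> \<open>Here the other half of the orthogonal pair enters, that \<open>\<X>\<close> is
      the left perpendicular class of \<open>\<Y>\<close>.\<close>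
    then have "D i \<in> \<X>" unfolding \<X> left_perp_def using D[OF i] by blast
    moreover have "finitely_presented A (D i)"
    proof (rule finitely_presentedI[OF N c[OF i]])
      show "c i ` carrier (sub P (snd i)) = carrier (D i)" using csurj[OF i] by simp
      show "fin_gen A (sub P (snd i)) (carrier (sub P (snd i)))"
        using fin_gen_sub[OF S(2)[OF i] S(6)[OF i]] by simp
      show "fin_gen A (sub P (snd i)) (hom_kernel (sub P (snd i)) (D i) (c i))"
        unfolding cker[OF i] by (rule fin_gen_sub[OF S(2,5,4)[OF i]])
    qed
    ultimately show ?thesis by simp
  qed
  define le where "le i j \<longleftrightarrow> fst i \<subseteq> fst j \<and> snd i \<subseteq> snd j" for i j :: "'m set \<times> 'm set"
  \<comment> \<open>The transition map induced by inclusion; surjectivity of \<open>c i\<close>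
    determines it on the carrier of \<open>D i\<close>, so functoriality can be checked on
    representatives in \<open>P\<close>.\<close>
  define T where "T i j = (SOME h. lin A (D i) (D j) h \<and> (\<forall>x\<in>snd i. h (c i x) = c j x))" for i j
  define \<iota> where "\<iota> i = (SOME h. lin A (D i) M h \<and> (\<forall>x\<in>snd i. h (c i x) = f x))" for i
  have T: "lin A (D i) (D j) (T i j) \<and> (\<forall>x\<in>snd i. T i j (c i x) = c j x)"
    if i: "i \<in> S" and j: "j \<in> S" and ij: "le i j" for i j
  proof -
    have Nij: "submod A (sub P (snd j)) (snd i)" "fst i \<subseteq> fst j" "snd i \<subseteq> snd j"
      using submod_sub[OF S(2)[OF j] S(2)[OF i]] ij by (simp_all add: le_def)
    have cj: "lin A (sub P (snd i)) (D j) (c j)" using lin_sub[OF c[OF j] Nij(1)] by simp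
    have cs: "c i ` carrier (sub P (snd i)) = carrier (D i)" using csurj[OF i] by simp
    have ker: "c j x = \<zero>\<^bsub>D j\<^esub>" if "x \<in> carrier (sub P (snd i))" "c i x = \<zero>\<^bsub>D i\<^esub>" for x
    proof -
      have "x \<in> fst i" using c0[OF i] that by simp
      then show ?thesis using c0[OF j] Nij(2,3) that(1) by auto
    qed
    obtain h where "lin A (D i) (D j) h" "\<And>x. x \<in> carrier (sub P (snd i)) \<Longrightarrow> h (c i x) = c j x"
      by (rule lin_factor[OF c[OF i] cj cs ker]) (assumption, assumption, rule that)
    then have "\<exists>h. lin A (D i) (D j) h \<and> (\<forall>x\<in>snd i. h (c i x) = c j x)" by auto
    then show ?thesis unfolding T_def by (rule someI_ex)
  qed
  have \<iota>: "lin A (D i) M (\<iota> i) \<and> (\<forall>x\<in>snd i. \<iota> i (c i x) = f x)" if i: "i \<in> S" for i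
  proof -
    have cs: "c i ` carrier (sub P (snd i)) = carrier (D i)" using csurj[OF i] by simp
    have ker: "f x = \<zero>\<^bsub>M\<^esub>" if "x \<in> carrier (sub P (snd i))" "c i x = \<zero>\<^bsub>D i\<^esub>" for x
      using c0[OF i, of x] that S(3)[OF i] by (auto simp: Q_def hom_kernel_def)
    obtain h where "lin A (D i) M h" "\<And>x. x \<in> carrier (sub P (snd i)) \<Longrightarrow> h (c i x) = f x"
      by (rule lin_factor[OF c[OF i] lin_sub[OF f(1) S(2)[OF i]] cs ker]) (assumption, assumption, rule that)
    then have "\<exists>h. lin A (D i) M h \<and> (\<forall>x\<in>snd i. h (c i x) = f x)" by auto
    then show ?thesis unfolding \<iota>_def by (rule someI_ex)
  qed
  have Tc: "T i j (c i x) = c j x" if "i \<in> S" "j \<in> S" "le i j" "x \<in> snd i" for i j x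
    using T[OF that(1-3)] that(4) by blast
  have \<iota>c: "\<iota> i (c i x) = f x" if "i \<in> S" "x \<in> snd i" for i x
    using \<iota>[OF that(1)] that(2) by blast
  have rep: "\<exists>x\<in>snd i. y = c i x" if "i \<in> S" "y \<in> carrier (D i)" for i y
    using csurj[OF that(1)] that(2) by blast
  have "S \<subseteq> Pow (carrier P) \<times> Pow (carrier P)"
    using submod_subset by (auto simp: S_def)
  then have smallS: "small U S"
    by (rule small_subset[OF Times_small[OF Pow_small Pow_small], OF Mod_cat_small Mod_cat_small, OF P(1) P(1)])
  \<comment> \<open>Pairs of submodules are not elements of \<open>'m\<close>; they are encoded
    injectively, and \<open>r\<close> decodes an index.\<close>
  obtain b :: "'m set \<times> 'm set \<Rightarrow> 'm" where b: "inj_on b S" by (rule small_inj[OF smallS])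
  define r where "r = inv_into S b"
  have r: "r u \<in> S" if "u \<in> b ` S" for u using that by (simp add: r_def inv_into_into)
  have rb: "r (b i) = i" if "i \<in> S" for i using that b by (simp add: r_def)
  show ?thesis
  proof (rule directed_colimit[where S = "b ` S" and D = "\<lambda>u. D (r u)" and le = "\<lambda>u v. le (r u) (r v)"
        and T = "\<lambda>u v. T (r u) (r v)" and \<iota> = "\<lambda>u. \<iota> (r u)"])
    show "small U (b ` S)" by (rule small_image[OF smallS])
    show "b ` S \<noteq> {}" using enlarge[of "{}" "{}"] by auto
    show "M \<in> Mod_cat A" by (rule MM)
    show "le (r u) (r u)" for u by (simp add: le_def)
    show "le (r u) (r w)" if "le (r u) (r v)" "le (r v) (r w)" for u v w using that by (auto simp: le_def)
    show "\<exists>w\<in>b ` S. le (r u) (r w) \<and> le (r v) (r w)" if uv: "u \<in> b ` S" "v \<in> b ` S" for u v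
    proof -
      obtain k where k: "k \<in> S" "le (r u) k" "le (r v) k"
        using bound[OF r[OF uv(1)] r[OF uv(2)], of "{}"] unfolding le_def by blast
      then show ?thesis using rb[OF k(1)] by (intro bexI[of _ "b k"]) simp_all
    qed
    show "D (r u) \<in> Mod_cat A" if "u \<in> b ` S" for u using D[OF r[OF that]] .
    show "D (r u) \<in> {X \<in> \<X>. finitely_presented A X}" if "u \<in> b ` S" for u using Dfp[OF r[OF that]] .
    show "lin A (D (r u)) (D (r v)) (T (r u) (r v))" if "u \<in> b ` S" "v \<in> b ` S" "le (r u) (r v)" for u v
      using T[OF r[OF that(1)] r[OF that(2)] that(3)] by blast
    show "T (r u) (r u) x = x" if "u \<in> b ` S" "x \<in> carrier (D (r u))" for u x
      using rep[OF r[OF that(1)] that(2)] Tc[OF r[OF that(1)] r[OF that(1)]] by (auto simp: le_def)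
    show "T (r v) (r w) (T (r u) (r v) x) = T (r u) (r w) x"
      if uv: "u \<in> b ` S" "v \<in> b ` S" "w \<in> b ` S" "le (r u) (r v)" "le (r v) (r w)" "x \<in> carrier (D (r u))" for u v w x
    proof -
      note rr = r[OF uv(1)] r[OF uv(2)] r[OF uv(3)]
      obtain p where p: "p \<in> snd (r u)" "x = c (r u) p" using rep[OF rr(1) uv(6)] by blast
      have "p \<in> snd (r v)" "le (r u) (r w)" using p(1) uv(4,5) by (auto simp: le_def)
      then show ?thesis
        using Tc[OF rr(1,2) uv(4) p(1)] Tc[OF rr(2,3) uv(5)] Tc[OF rr(1,3) _ p(1)] p(2) by simp
    qed
    show "lin A (D (r u)) M (\<iota> (r u))" if "u \<in> b ` S" for u using \<iota>[OF r[OF that]] by blast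
    show "\<iota> (r v) (T (r u) (r v) x) = \<iota> (r u) x"
      if uv: "u \<in> b ` S" "v \<in> b ` S" "le (r u) (r v)" "x \<in> carrier (D (r u))" for u v x
    proof -
      note rr = r[OF uv(1)] r[OF uv(2)]
      obtain p where p: "p \<in> snd (r u)" "x = c (r u) p" using rep[OF rr(1) uv(4)] by blast
      have "p \<in> snd (r v)" using p(1) uv(3) by (auto simp: le_def)
      then show ?thesis using Tc[OF rr uv(3) p(1)] \<iota>c[OF rr(1) p(1)] \<iota>c[OF rr(2)] p(2) by simp
    qed
    show "\<exists>u\<in>b ` S. \<exists>x\<in>carrier (D (r u)). \<iota> (r u) x = y" if y: "y \<in> carrier M" for y
    proof -
      obtain p where p: "p \<in> carrier P" "y = f p" using y f(2) by blast
      obtain i where i: "i \<in> S" "p \<in> snd i" using enlarge[of "{}" "{p}"] p(1) by auto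
      have "c i p \<in> carrier (D i)" using csurj[OF i(1)] i(2) by blast
      then show ?thesis
        using i \<iota>c[OF i] p(2) rb[OF i(1)] by (intro bexI[of _ "b i"] bexI[of _ "c i p"]) simp_all
    qed
    show "\<exists>v\<in>b ` S. le (r u) (r v) \<and> T (r u) (r v) x = \<zero>\<^bsub>D (r v)\<^esub>"
      if u: "u \<in> b ` S" and x: "x \<in> carrier (D (r u))" and x0: "\<iota> (r u) x = \<zero>\<^bsub>M\<^esub>" for u x
    proof -
      obtain p where p: "p \<in> snd (r u)" "x = c (r u) p" using rep[OF r[OF u] x] by blast
      have "f p = \<zero>\<^bsub>M\<^esub>" using \<iota>c[OF r[OF u] p(1)] x0 p(2) by simp
      moreover have "p \<in> carrier P" using p(1) submod_subset[OF S(2)[OF r[OF u]]] by blast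
      ultimately have "p \<in> Q" by (simp add: Q_def hom_kernel_def)
      \<comment> \<open>A representative that \<open>f\<close> kills lies in \<open>Q\<close>; a
        larger pair whose first component contains it makes it zero.\<close>
      then obtain k where k: "k \<in> S" "fst (r u) \<subseteq> fst k" "snd (r u) \<subseteq> snd k" "p \<in> fst k"
        using bound[OF r[OF u] r[OF u], of "{p}"] by auto
      have uk: "le (r u) k" using k by (simp add: le_def)
      have "T (r u) k x = \<zero>\<^bsub>D k\<^esub>"
        using Tc[OF r[OF u] k(1) uk p(1)] p k c0[OF k(1), of p] by auto
      then show ?thesis using uk k(1) rb[OF k(1)] by (intro bexI[of _ "b k"]) simp_all
    qed
  qed
qed

end

theorem theorem5p1:
  fixes A :: "('a, 'r) ring_scheme"
    and \<X> \<Y> :: "('a, 'm) rmodule set"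
  assumes "grothendieck_universe TYPE('m)"
    and "small TYPE('m) (carrier A)"
    and "hereditary_ring TYPE('m) A"
    and "ext_orthogonal_pair A \<X> \<Y>"
  shows "(closed_under_coproducts A \<Y> \<longleftrightarrow>
          (\<forall>M \<in> \<X>. filtered_colimit_of A {X \<in> \<X>. finitely_presented A X} M)) \<and>
         ((\<forall>M \<in> \<X>. filtered_colimit_of A {X \<in> \<X>. finitely_presented A X} M) \<longleftrightarrow>
          (\<exists>\<C> \<subseteq> {C \<in> Mod_cat A. finitely_presented A C}. right_perp A \<C> = \<Y>))"
    (is "(?one \<longleftrightarrow> ?two) \<and> (?two \<longleftrightarrow> ?three)")
proof -
  interpret hereditary_universe "TYPE('m)" A
    by (intro hereditary_universe.intro ring_universe.intro universe.intro ring_universe_axioms.intro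
        hereditary_universe_axioms.intro)
      (use assms in \<open>simp_all add: hereditary_ring_def\<close>)
  have X: "\<X> \<subseteq> Mod_cat A" and Y: "right_perp A \<X> = \<Y>"
    using assms(4) unfolding ext_orthogonal_pair_def by blast+
  have "?one \<Longrightarrow> ?two"
    using filtered_colimit_of_finitely_presented[OF assms(4)] by blast
  moreover have ?three if two: ?two
  proof (intro exI[of _ "{X \<in> \<X>. finitely_presented A X}"] conjI)
    show "{X \<in> \<X>. finitely_presented A X} \<subseteq> {C \<in> Mod_cat A. finitely_presented A C}"
      using X by blast
    show "right_perp A {X \<in> \<X>. finitely_presented A X} = \<Y>"
      using right_perp_filtered_colimits[OF _ X, of "{X \<in> \<X>. finitely_presented A X}"] two Y by blast
  qed
  moreover have "?three \<Longrightarrow> ?one"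
    using coproducts_right_perp by blast
  ultimately show ?thesis by blast
qed

end
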